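(* Let $\mathcal{G}=(\mathcal{V},\mathcal{E})$ be a graph endowed with a unitary connection satisfying $\cos(\theta_C)\ge0$ for every cycle $C$ of $\mathcal{G}$, and let $q>0$. The expected number of calls to random_successor (i.e. the expected number of random walk steps) in the MTSF-sampling algorithm described in the context is upper-bounded by $$\mathrm{tr}\bigl((\mathsf{L}+q\mathsf{I})^{-1}(\mathsf{D}+q\mathsf{I})\bigr).$$ Also, this algorithm can be implemented with an expected time complexity upper-bounded by $\mathcal{O}\left(\frac{|\mathcal{E}|}{q}\right)$.
   Context: $\mathcal{G}=(\mathcal{V},\mathcal{E})$ is a finite undirected, unweighted graph with adjacency matrix $\mathsf{A}$, degrees $d_v$, diagonal degree matrix $\mathsf{D}$, and combinatorial Laplacian $\mathsf{L}=\mathsf{D}-\mathsf{A}$. A unitary connection assigns to each oriented edge $e$ an angle $\theta_e$ with $\theta_{(j,i)}=-\theta_{(i,j)}$; for a cycle $C$, $\theta_C$ is the sum of the $\theta_e$ along one traversal of $C$ (so $\cos\theta_C$ is orientation-independent; going back and forth along an edge counts as a cycle with $\theta_C=0$). $\Gamma\notin\mathcal{V}$ is an additional (boundary) node. The function random_successor$(u)$ outputs, at each call and independently, $\Gamma$ with probability $\frac{q}{d_u+q}$ or a node $v\in\mathcal{V}$ with probability $\frac{\mathsf{A}_{u,v}}{d_u+q}$. The nodes of $\mathcal{V}$ are arbitrarily ordered in a queue. A node is spanned by a set $\phi\subseteq\mathcal{V}\cup\mathcal{E}$ if it belongs to $\phi$ or is an endpoint of an edge in $\phi$. MTSF-sampling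 algorithm: start with $\phi=\emptyset$. While $\phi$ does not span all nodes: let $i$ be the first node in the queue not spanned by $\phi$; set $u\leftarrow i$ and let $p$ be the empty path. While $u\neq\Gamma$ and $p$ neither intersects (a node spanned by) $\phi$ nor contains a cycle: call $u'\leftarrow$ random_successor$(u)$; if $u'\ne\Gamma$, append the edge $(u,u')$ to $p$; if $p$ now contains a cycle $C$, remove this cycle from $p$ with probability $\cos(\theta_C)$ (otherwise keep it); set $u_{\mathrm{old}}\leftarrow u$, $u\leftarrow u'$. When this inner loop ends: if $u=\Gamma$, add to $\phi$ the (non-oriented) edges of $p$ and the node $u_{\mathrm{old}}$ (a root); otherwise add to $\phi$ the (non-oriented) edges of $p$. When $\phi$ spans all nodes, output $\phi$.
   Formalization: The time bound O(|E|/q) is stated for families of inputs with |V| ≤ K|E|/q, the constant depending on K; without such a relation it fails (a graph without edges still needs |V| calls), since every run makes at least |V| calls. *)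

theory Defs
  imports
    "HOL-Probability.Probability"
    "HOL-Library.Sublist"
    "Jordan_Normal_Form.Gauss_Jordan_Elimination"
begin

section \<open>Graphs with a unitary connection\<close>

text \<open>
  The node set is \<open>{..<n}\<close>, an edge is a two-element set of nodes, and \<open>\<theta> u v\<close> is the angle of
  the oriented edge \<open>(u, v)\<close>; values of \<open>\<theta>\<close> off the edges are irrelevant.
\<close>

definition simple_graph :: "nat \<Rightarrow> nat set set \<Rightarrow> bool" where
  "simple_graph n E \<longleftrightarrow> 0 < n \<and> E \<subseteq> {{u, v} | u v. u < n \<and> v < n \<and> u \<noteq> v}"

definition neighbours :: "nat set set \<Rightarrow> nat \<Rightarrow> nat set" where
  "neighbours E u = {v. {u, v} \<in> E}"

definition adj :: "nat set set \<Rightarrow> nat \<Rightarrow> nat \<Rightarrow> real" where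
  "adj E u v = (if {u, v} \<in> E then 1 else 0)"

definition deg :: "nat set set \<Rightarrow> nat \<Rightarrow> nat" where
  "deg E u = card (neighbours E u)"

definition unitary_connection :: "nat set set \<Rightarrow> (nat \<Rightarrow> nat \<Rightarrow> real) \<Rightarrow> bool" where
  "unitary_connection E \<theta> \<longleftrightarrow> (\<forall>u v. {u, v} \<in> E \<longrightarrow> \<theta> v u = - \<theta> u v)"

text \<open>Paths and cycles are lists of oriented edges.\<close>

definition is_cycle :: "(nat \<times> nat) list \<Rightarrow> bool" where
  "is_cycle C \<longleftrightarrow> C \<noteq> [] \<and> (\<forall>k. Suc k < length C \<longrightarrow> snd (C ! k) = fst (C ! Suc k))
     \<and> snd (last C) = fst (hd C) \<and> distinct (map fst C)"

definition cycle_in :: "nat set set \<Rightarrow> (nat \<times> nat) list \<Rightarrow> bool" where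
  "cycle_in E C \<longleftrightarrow> is_cycle C \<and> (\<forall>(u, v) \<in> set C. {u, v} \<in> E)"

definition angle_sum :: "(nat \<Rightarrow> nat \<Rightarrow> real) \<Rightarrow> (nat \<times> nat) list \<Rightarrow> real" where
  "angle_sum \<theta> C = (\<Sum>(u, v) \<leftarrow> C. \<theta> u v)"

definition degree_matrix :: "nat \<Rightarrow> nat set set \<Rightarrow> real mat" where
  "degree_matrix n E = mat n n (\<lambda>(i, j). if i = j then real (deg E i) else 0)"

definition adjacency_matrix :: "nat \<Rightarrow> nat set set \<Rightarrow> real mat" where
  "adjacency_matrix n E = mat n n (\<lambda>(i, j). adj E i j)"

definition laplacian :: "nat \<Rightarrow> nat set set \<Rightarrow> real mat" where
  "laplacian n E = degree_matrix n E - adjacency_matrix n E"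

definition mat_trace :: "real mat \<Rightarrow> real" where
  "mat_trace M = (\<Sum>i<dim_row M. M $$ (i, i))"


section \<open>The sampling algorithm\<close>

text \<open>The boundary node is \<^const>\<open>None\<close>; a node \<open>v\<close> of the graph is \<open>Some v\<close>.\<close>

definition random_successor :: "nat set set \<Rightarrow> real \<Rightarrow> nat \<Rightarrow> nat option pmf" where
  "random_successor E q u = embed_pmf (\<lambda>x. case x of
       None \<Rightarrow> q / (real (deg E u) + q)
     | Some v \<Rightarrow> adj E u v / (real (deg E u) + q))"

lemma finite_neighbours: "simple_graph n E \<Longrightarrow> finite (neighbours E u)"
  by (rule finite_subset[of _ "{..<n}"])
     (auto simp: simple_graph_def neighbours_def doubleton_eq_iff)

lemma pmf_random_successor:
  assumes "simple_graph n E" and "0 < q"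
  shows "pmf (random_successor E q u) x = (case x of
       None \<Rightarrow> q / (real (deg E u) + q)
     | Some v \<Rightarrow> adj E u v / (real (deg E u) + q))"
  unfolding random_successor_def
proof (rule pmf_embed_pmf)
  let ?f = "\<lambda>x. case x of
       None \<Rightarrow> q / (real (deg E u) + q)
     | Some v \<Rightarrow> adj E u v / (real (deg E u) + q)"
  show nn: "0 \<le> ?f x" for x
    using assms by (auto simp: adj_def split: option.split)
  let ?S = "insert None (Some ` neighbours E u)"
  have fin: "finite (neighbours E u)"
    using assms finite_neighbours by blast
  have "(\<integral>\<^sup>+ x. ennreal (?f x) \<partial>count_space UNIV) = (\<Sum>x\<in>?S. ennreal (?f x))"
    using fin by (intro nn_integral_count_space')
      (auto simp: adj_def neighbours_def split: option.splits if_splits)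
  also have "\<dots> = ennreal (\<Sum>x\<in>?S. ?f x)"
    using nn by (rule sum_ennreal)
  also have "(\<Sum>x\<in>?S. ?f x) =
      q / (real (deg E u) + q) + (\<Sum>v\<in>neighbours E u. adj E u v / (real (deg E u) + q))"
    using fin by (subst sum.insert) (auto simp: sum.reindex)
  also have "(\<Sum>v\<in>neighbours E u. adj E u v / (real (deg E u) + q)) =
      (\<Sum>v\<in>neighbours E u. 1 / (real (deg E u) + q))"
    by (intro sum.cong) (auto simp: adj_def neighbours_def)
  also have "q / (real (deg E u) + q) + \<dots> = 1"
    using assms(2) by (simp add: deg_def add_divide_distrib[symmetric] add.commute)
  finally show "(\<integral>\<^sup>+ x. ennreal (?f x) \<partial>count_space UNIV) = 1"
    by simp
qed

datatype element = Node nat | Edge "nat set"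

definition spanned :: "element set \<Rightarrow> nat \<Rightarrow> bool" where
  "spanned \<phi> v \<longleftrightarrow> Node v \<in> \<phi> \<or> (\<exists>e. Edge e \<in> \<phi> \<and> v \<in> e)"

definition intersects :: "(nat \<times> nat) list \<Rightarrow> element set \<Rightarrow> bool" where
  "intersects p \<phi> \<longleftrightarrow> (\<exists>(u, v) \<in> set p. spanned \<phi> u \<or> spanned \<phi> v)"

definition contains_cycle :: "(nat \<times> nat) list \<Rightarrow> bool" where
  "contains_cycle p \<longleftrightarrow> (\<exists>C. is_cycle C \<and> sublist C p)"

text \<open>
  When the last edge of a path ends at \<open>w\<close> and closes a cycle, that cycle is the part of the path
  from the first edge leaving \<open>w\<close> onwards.
\<close>

definition closed_part :: "(nat \<times> nat) list \<Rightarrow> (nat \<times> nat) list" where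
  "closed_part p = dropWhile (\<lambda>e. fst e \<noteq> snd (last p)) p"

definition open_part :: "(nat \<times> nat) list \<Rightarrow> (nat \<times> nat) list" where
  "open_part p = takeWhile (\<lambda>e. fst e \<noteq> snd (last p)) p"

text \<open>
  Being a least fixed point in the order of subprobability distributions, the result has as
  missing mass (that is, as the probability of \<^const>\<open>None\<close>) the probability that the loop does
  not terminate.
\<close>

partial_function (spmf) while_spmf ::
  "('s \<Rightarrow> bool) \<Rightarrow> ('s \<Rightarrow> 's spmf) \<Rightarrow> 's \<Rightarrow> 's spmf" where
  "while_spmf b f s = (if b s then bind_spmf (f s) (while_spmf b f) else return_spmf s)"

text \<open>
  All calls to \<^const>\<open>random_successor\<close> are logged with argument and result. The state of a walk
  consists of the path, \<open>u\<close>, \<open>u\<^sub>o\<^sub>l\<^sub>d\<close> and the log; \<open>u\<^sub>o\<^sub>l\<^sub>d\<close> has a dummy value before the first call.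
\<close>

type_synonym call_log = "(nat \<times> nat option) list"
type_synonym walk = "(nat \<times> nat) list \<times> nat option \<times> nat \<times> call_log"

definition walk_continues :: "element set \<Rightarrow> walk \<Rightarrow> bool" where
  "walk_continues \<phi> = (\<lambda>(p, u, _, _). u \<noteq> None \<and> \<not> intersects p \<phi> \<and> \<not> contains_cycle p)"

definition walk_step ::
  "nat set set \<Rightarrow> (nat \<Rightarrow> nat \<Rightarrow> real) \<Rightarrow> real \<Rightarrow> walk \<Rightarrow> walk spmf" where
  "walk_step E \<theta> q = (\<lambda>(p, u, _, l).
     bind_spmf (spmf_of_pmf (random_successor E q (the u))) (\<lambda>u'.
       let l' = l @ [(the u, u')] in
       case u' of
         None \<Rightarrow> return_spmf (p, u', the u, l')
       | Some w \<Rightarrow>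
           let p' = p @ [(the u, w)] in
           if contains_cycle p'
           then bind_spmf (spmf_of_pmf (bernoulli_pmf (cos (angle_sum \<theta> (closed_part p')))))
                  (\<lambda>b. return_spmf (if b then open_part p' else p', u', the u, l'))
           else return_spmf (p', u', the u, l')))"

definition grow ::
  "nat set set \<Rightarrow> (nat \<Rightarrow> nat \<Rightarrow> real) \<Rightarrow> real \<Rightarrow> nat list \<Rightarrow>
   element set \<times> call_log \<Rightarrow> (element set \<times> call_log) spmf" where
  "grow E \<theta> q queue = (\<lambda>(\<phi>, l).
     let i = hd (filter (\<lambda>v. \<not> spanned \<phi> v) queue) in
     bind_spmf (while_spmf (walk_continues \<phi>) (walk_step E \<theta> q) ([], Some i, i, l))
       (\<lambda>(p, u, u\<^sub>o\<^sub>l\<^sub>d, l').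
          return_spmf
            (\<phi> \<union> {Edge {a, b} | a b. (a, b) \<in> set p} \<union> (if u = None then {Node u\<^sub>o\<^sub>l\<^sub>d} else {}), l')))"

definition mtsf_sampling ::
  "nat \<Rightarrow> nat set set \<Rightarrow> (nat \<Rightarrow> nat \<Rightarrow> real) \<Rightarrow> real \<Rightarrow> nat list \<Rightarrow>
   (element set \<times> call_log) spmf" where
  "mtsf_sampling n E \<theta> q queue =
     while_spmf (\<lambda>(\<phi>, _). \<exists>v<n. \<not> spanned \<phi> v) (grow E \<theta> q queue) ({}, [])"

text \<open>
  The expectation of a count over the runs of a probabilistic computation; runs that do not
  terminate contribute \<open>\<infinity>\<close>.
\<close>

definition expected_count :: "('r \<Rightarrow> nat) \<Rightarrow> 'r spmf \<Rightarrow> ennreal" where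
  "expected_count f p =
     (\<integral>\<^sup>+ x. (case x of None \<Rightarrow> \<infinity> | Some r \<Rightarrow> of_nat (f r)) \<partial>measure_pmf p)"

definition expected_calls ::
  "nat \<Rightarrow> nat set set \<Rightarrow> (nat \<Rightarrow> nat \<Rightarrow> real) \<Rightarrow> real \<Rightarrow> nat list \<Rightarrow> ennreal" where
  "expected_calls n E \<theta> q queue =
     expected_count (\<lambda>(\<phi>, l). length l) (mtsf_sampling n E \<theta> q queue)"

definition mtsf_instance ::
  "nat \<Rightarrow> nat set set \<Rightarrow> (nat \<Rightarrow> nat \<Rightarrow> real) \<Rightarrow> real \<Rightarrow> nat list \<Rightarrow> bool" where
  "mtsf_instance n E \<theta> q queue \<longleftrightarrow>
     simple_graph n E \<and> unitary_connection E \<theta> \<and>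
     (\<forall>C. cycle_in E C \<longrightarrow> 0 \<le> cos (angle_sum \<theta> C)) \<and>
     0 < q \<and> distinct queue \<and> set queue = {..<n}"


section \<open>A randomised random access machine\<close>

text \<open>
  The cost model is a unit-cost real random access machine with structured control flow. The memory
  consists of banks of cells holding natural numbers and banks of cells holding real numbers. Bank
  numbers are fixed in the program text, cell indices are computed. Each executed elementary command
  and each test costs one unit of time; the size of the expressions in a program is a constant
  independent of the input, so this agrees up to a constant factor with charging for every
  operation.
\<close>

record memory =
  nats :: "nat \<Rightarrow> nat \<Rightarrow> nat"
  reals :: "nat \<Rightarrow> nat \<Rightarrow> real"

datatype nexp = NConst nat | NCell nat nexp | NPlus nexp nexp | NMinus nexp nexp

datatype rexp = OfNat nexp | RCell nat nexp | RPlus rexp rexp | RMinus rexp rexp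
  | RTimes rexp rexp | RDivide rexp rexp | Cos rexp

datatype bexp = Less nexp nexp | BNot bexp | BAnd bexp bexp

datatype com =
    Skip
  | NAssign nat nexp nexp
  | RAssign nat nexp rexp
  | Flip nat nexp rexp
  | Uniform nat nexp nexp
  | Seq com com
  | If bexp com com
  | While bexp com

primrec nval :: "nexp \<Rightarrow> memory \<Rightarrow> nat" where
  "nval (NConst k) m = k"
| "nval (NCell b i) m = nats m b (nval i m)"
| "nval (NPlus x y) m = nval x m + nval y m"
| "nval (NMinus x y) m = nval x m - nval y m"

primrec rval :: "rexp \<Rightarrow> memory \<Rightarrow> real" where
  "rval (OfNat x) m = real (nval x m)"
| "rval (RCell b i) m = reals m b (nval i m)"
| "rval (RPlus x y) m = rval x m + rval y m"
| "rval (RMinus x y) m = rval x m - rval y m"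
| "rval (RTimes x y) m = rval x m * rval y m"
| "rval (RDivide x y) m = rval x m / rval y m"
| "rval (Cos x) m = cos (rval x m)"

primrec bval :: "bexp \<Rightarrow> memory \<Rightarrow> bool" where
  "bval (Less x y) m \<longleftrightarrow> nval x m < nval y m"
| "bval (BNot x) m \<longleftrightarrow> \<not> bval x m"
| "bval (BAnd x y) m \<longleftrightarrow> bval x m \<and> bval y m"

definition write_nat :: "nat \<Rightarrow> nat \<Rightarrow> nat \<Rightarrow> memory \<Rightarrow> memory" where
  "write_nat b i x m = m\<lparr>nats := (nats m)(b := (nats m b)(i := x))\<rparr>"

definition write_real :: "nat \<Rightarrow> nat \<Rightarrow> real \<Rightarrow> memory \<Rightarrow> memory" where
  "write_real b i x m = m\<lparr>reals := (reals m)(b := (reals m b)(i := x))\<rparr>"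

text \<open>
  The second component of the state is the elapsed time. \<^const>\<open>Flip\<close> stores a Bernoulli variable
  as 0 or 1, and \<open>Uniform b i x\<close> stores a uniform element of \<open>{0, \<dots>, x}\<close>.
\<close>

primrec exec :: "com \<Rightarrow> memory \<times> nat \<Rightarrow> (memory \<times> nat) spmf" where
  "exec Skip = (\<lambda>(m, t). return_spmf (m, Suc t))"
| "exec (NAssign b i x) = (\<lambda>(m, t). return_spmf (write_nat b (nval i m) (nval x m) m, Suc t))"
| "exec (RAssign b i x) = (\<lambda>(m, t). return_spmf (write_real b (nval i m) (rval x m) m, Suc t))"
| "exec (Flip b i x) = (\<lambda>(m, t).
     map_spmf (\<lambda>c. (write_nat b (nval i m) (of_bool c) m, Suc t))
       (spmf_of_pmf (bernoulli_pmf (rval x m))))"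
| "exec (Uniform b i x) = (\<lambda>(m, t).
     map_spmf (\<lambda>k. (write_nat b (nval i m) k m, Suc t))
       (spmf_of_pmf (pmf_of_set {..nval x m})))"
| "exec (Seq c d) = (\<lambda>s. bind_spmf (exec c s) (exec d))"
| "exec (If b c d) = (\<lambda>(m, t). if bval b m then exec c (m, Suc t) else exec d (m, Suc t))"
| "exec (While b c) = (\<lambda>(m, t).
     while_spmf (\<lambda>(m, _). bval b m) (\<lambda>(m, t). bind_spmf (exec c (m, t))
       (\<lambda>(m, t). return_spmf (m, Suc t))) (m, Suc t))"

text \<open>
  Input: \<open>n\<close> and \<open>q\<close>, the queue, and adjacency lists in arbitrary order. Bank 2 holds the degrees,
  bank 3 the position in bank 4 at which the list of a node starts, and real bank 1 the angles of
  the oriented edges listed in bank 4. All banks that carry no input are zero.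
\<close>

definition input_memory ::
  "nat \<Rightarrow> nat set set \<Rightarrow> (nat \<Rightarrow> nat \<Rightarrow> real) \<Rightarrow> real \<Rightarrow> nat list \<Rightarrow> memory \<Rightarrow> bool" where
  "input_memory n E \<theta> q queue m \<longleftrightarrow>
     nats m 0 0 = n \<and> reals m 0 0 = q \<and>
     (\<forall>k<n. nats m 1 k = queue ! k) \<and>
     (\<forall>u<n. nats m 2 u = deg E u \<and>
        bij_betw (\<lambda>j. nats m 4 (nats m 3 u + j)) {..<deg E u} (neighbours E u) \<and>
        (\<forall>j<deg E u. reals m 1 (nats m 3 u + j) = \<theta> u (nats m 4 (nats m 3 u + j)))) \<and>
     (\<forall>b\<ge>5. nats m b = (\<lambda>_. 0)) \<and> (\<forall>b\<ge>2. reals m b = (\<lambda>_. 0))"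

text \<open>
  Output: a list of pairs for the sampled set and one for the log, in banks 5 to 7 and 8 to 10,
  respectively (number of entries, first components, second components). A second component \<open>n\<close>
  stands for the boundary node, so that the pair \<open>(a, n)\<close> in the first list denotes the root \<open>a\<close>.
\<close>

definition decode_output :: "nat \<Rightarrow> memory \<Rightarrow> element set \<times> call_log" where
  "decode_output n m =
     ((\<lambda>k. if nats m 7 k = n then Node (nats m 6 k) else Edge {nats m 6 k, nats m 7 k})
         ` {..<nats m 5 0},
      map (\<lambda>k. (nats m 9 k, if nats m 10 k = n then None else Some (nats m 10 k)))
         [0..<nats m 8 0])"

text \<open>
  An implementation has to reproduce the joint law of the output and of the whole sequence of calls
  to \<^const>\<open>random_successor\<close>, so it cannot be some other sampler with the same output law.
\<close>

definition implements_mtsf_sampling :: "com \<Rightarrow> bool" where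
  "implements_mtsf_sampling P \<longleftrightarrow>
     (\<forall>n E \<theta> q queue m. mtsf_instance n E \<theta> q queue \<longrightarrow> input_memory n E \<theta> q queue m \<longrightarrow>
        map_spmf (\<lambda>(m', t). decode_output n m') (exec P (m, 0)) = mtsf_sampling n E \<theta> q queue)"

definition expected_time :: "com \<Rightarrow> memory \<Rightarrow> ennreal" where
  "expected_time P m = expected_count (\<lambda>(m', t). t) (exec P (m, 0))"

end

theory Submission
  imports Defs "Jordan_Normal_Form.Determinant"
begin

text \<open>
  \<^bold>\<open>The number of calls.\<close> Imagine that every node \<open>u\<close> owns a deck of cards, drawn independently from the law
  of \<open>random_successor u\<close>, and that a call at \<open>u\<close> turns up the next card of \<open>u\<close>. If all cycles are removed,
  the algorithm is Wilson's: the cards that lie on top form a partial functional graph, and whenever they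
  close a cycle, the cards of that cycle are discarded. Turning up cards at two different nodes commutes
  (\<open>reveal_commute\<close>), so the order in which nodes are explored has no influence on the number of cards
  that each node uses up. To count the cards of \<open>x\<close>, explore from \<open>x\<close> first: this is the random walk from \<open>x\<close>
  with erasure of loops, it turns up a card of \<open>x\<close> at each visit to \<open>x\<close>, and after it has been absorbed no
  further card of \<open>x\<close> is used. Hence the expected number is the Green function of the walk killed at \<open>\<Gamma>\<close>, which
  at \<open>(x, x)\<close> is the diagonal entry of \<open>(L + q)\<^sup>-\<^sup>1 (D + q)\<close>; the sum over \<open>x\<close> is the trace. Keeping a cycle
  instead of removing it, and adding a path to the output, only freezes nodes, which can save calls but not
  cause new ones (\<open>visits_freeze\<close>).

  The decks need not be drawn in advance. For each \<open>x\<close> the expected number \<open>visits\<close> of cards of \<open>x\<close>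
  used by the strategy that explores from \<open>x\<close> is a function of the cards on top alone, and commutation makes it a
  supersolution for every other strategy (\<open>visits_supersolution\<close>). So \<open>remaining_reveals\<close>, the sum over
  \<open>x\<close>, is a potential which every call decreases by one or more in expectation. By \<open>wp_while_le\<close> it bounds the
  expected number of calls and shows at the same time that the loops terminate almost surely.

  \<^bold>\<open>The running time.\<close> Every spanned node is the source of exactly one edge of the path on which it was reached, or
  it is a root. So the output and the current path fit into one table of pairs (node, successor), whose
  initial part is the output. With the position of each node in the table and with the prefix sums of the angles,
  membership of a node is tested in constant time, the angle of a cycle is a difference of two prefix sums, and a
  cycle is removed by lowering the number of entries. Thus each call costs a bounded number of commands, and
  \<open>t \<le> 21 \<ell> + 12 n + 1\<close> on every terminating run with \<open>\<ell>\<close> calls. As the entries of \<open>(L + q)\<^sup>-\<^sup>1\<close> are at most \<open>1 / q\<close> (\<open>green_matrix_le\<close>),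
  the trace is at most \<open>2 |E| / q + n\<close>.
\<close>

section \<open>Cards, chains and popping\<close>

text \<open>
  \<^const>\<open>None\<close> means that no card of the node is turned up. A card \<open>Some None\<close> shows the boundary; it also stands for
  nodes whose fate is settled.
\<close>

type_synonym 'a cards = "'a \<Rightarrow> 'a option option"

definition arcs :: "'a cards \<Rightarrow> ('a \<times> 'a) set" where
  "arcs f = {(a, b). f a = Some (Some b)}"

definition acyclic_cards :: "'a cards \<Rightarrow> bool" where
  "acyclic_cards f \<longleftrightarrow> acyclic (arcs f)"

text \<open>
  Popping all cycles, and not only one through a given node, makes successive reveals commute without a case
  distinction. It changes nothing on acyclic cards.
\<close>

definition pop :: "'a cards \<Rightarrow> 'a cards" where
  "pop f = (\<lambda>v. if (v, v) \<in> (arcs f)\<^sup>+ then None else f v)"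

definition reveal :: "'a \<Rightarrow> 'a option \<Rightarrow> 'a cards \<Rightarrow> 'a cards" where
  "reveal u c f = pop (f(u \<mapsto> c))"

text \<open>
  The chain of successors of \<open>x\<close> is known up to \<open>y\<close>, whose card has to be turned up next in order to prolong it.
\<close>

definition open_end :: "'a cards \<Rightarrow> 'a \<Rightarrow> 'a \<Rightarrow> bool" where
  "open_end f x y \<longleftrightarrow> (x, y) \<in> (arcs f)\<^sup>* \<and> f y = None"

lemma single_valued_arcs: "single_valued (arcs f)"
  by (auto simp: arcs_def single_valued_def)

lemma arcs_comparable:
  assumes "(x, y) \<in> (arcs f)\<^sup>*" and "(x, z) \<in> (arcs f)\<^sup>*"
  shows "(y, z) \<in> (arcs f)\<^sup>* \<or> (z, y) \<in> (arcs f)\<^sup>*"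
  using assms single_valued_confluent[OF single_valued_arcs] by metis

lemma arcs_stuck: "f y = None \<or> f y = Some None \<Longrightarrow> (y, z) \<in> (arcs f)\<^sup>* \<longleftrightarrow> z = y"
  by (auto simp: arcs_def elim: converse_rtranclE)

lemma arcs_stuck_trancl: "f y = None \<or> f y = Some None \<Longrightarrow> (y, z) \<notin> (arcs f)\<^sup>+"
  by (auto simp: arcs_def elim: converse_tranclE)

text \<open>
  Each node has at most one successor, so a chain that starts on a cycle cannot leave it.
\<close>

lemma cyclic_forward:
  assumes "(v, v) \<in> (arcs f)\<^sup>+" and "(v, w) \<in> (arcs f)\<^sup>*"
  shows "(w, v) \<in> (arcs f)\<^sup>* \<and> (w, w) \<in> (arcs f)\<^sup>+"
  using assms(2)
proof (induction rule: rtrancl_induct)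
  case base
  then show ?case using assms(1) by simp
next
  case (step y z)
  from step.IH obtain z' where z': "(y, z') \<in> arcs f" "(z', y) \<in> (arcs f)\<^sup>*"
    by (meson tranclD)
  then have "z' = z" using step.hyps by (auto simp: arcs_def)
  then show ?case using z' step
    by (meson rtrancl_into_trancl1 rtrancl_trans)
qed

lemma open_end_not_cyclic:
  assumes "open_end f x y"
  shows "(x, x) \<notin> (arcs f)\<^sup>+"
  using assms cyclic_forward[of x f y] arcs_stuck_trancl[of f y y] by (auto simp: open_end_def)

lemma open_end_unique: "open_end f x y \<Longrightarrow> open_end f x z \<Longrightarrow> y = z"
  using arcs_comparable[of x y f z] arcs_stuck[of f] by (auto simp: open_end_def)

lemma open_end_resolved:
  assumes "(x, a) \<in> (arcs f)\<^sup>*" and "f a = Some None"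
  shows "\<not> open_end f x y"
  using arcs_comparable[OF assms(1), of y] arcs_stuck[of f] assms(2)
  by (force simp: open_end_def)

lemma arcs_pop: "(a, b) \<in> arcs (pop f) \<longleftrightarrow> (a, b) \<in> arcs f \<and> (a, a) \<notin> (arcs f)\<^sup>+"
  by (auto simp: arcs_def pop_def)

lemma arcs_pop_subset: "arcs (pop f) \<subseteq> arcs f"
  using arcs_pop by fastforce

lemma acyclic_pop: "acyclic_cards (pop f)"
  unfolding acyclic_cards_def acyclic_def
proof (intro allI notI)
  fix v assume v: "(v, v) \<in> (arcs (pop f))\<^sup>+"
  then have "(v, v) \<in> (arcs f)\<^sup>+" by (metis arcs_pop_subset trancl_mono)
  moreover from v obtain w where "(v, w) \<in> arcs (pop f)" by (meson tranclD)
  ultimately show False by (simp add: arcs_pop)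
qed

lemma pop_acyclic: "acyclic_cards f \<Longrightarrow> pop f = f"
  by (auto simp: pop_def acyclic_cards_def acyclic_def)

lemma acyclic_reveal: "acyclic_cards (reveal u c f)"
  by (simp add: reveal_def acyclic_pop)

lemma arcs_upd_mono: "f v = None \<Longrightarrow> arcs f \<subseteq> arcs (f(v := c))"
  by (auto simp: arcs_def)

text \<open>
  Popping destroys only arcs that leave a cyclic node.
\<close>

lemma rtrancl_pop:
  assumes "(x, y) \<in> (arcs f)\<^sup>*" and "\<And>z. (x, z) \<in> (arcs f)\<^sup>* \<Longrightarrow> (z, y) \<in> (arcs f)\<^sup>+ \<Longrightarrow> (z, z) \<notin> (arcs f)\<^sup>+"
  shows "(x, y) \<in> (arcs (pop f))\<^sup>*"
  using assms
proof (induction rule: converse_rtrancl_induct)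
  case base then show ?case by simp
next
  case (step x x')
  have "(x', y) \<in> (arcs (pop f))\<^sup>*"
    using step by (meson converse_rtrancl_into_rtrancl)
  moreover have "(x, x') \<in> arcs (pop f)"
    using step by (meson arcs_pop rtrancl.rtrancl_refl rtrancl_into_trancl2)
  ultimately show ?case by simp
qed

text \<open>
  A cycle of \<open>g\<close> does not contain \<open>v\<close>, which has no card, and so it survives the new card. By \<open>cyclic_forward\<close> a
  cycle through \<open>v\<close> shares no node with an old cycle and is not harmed when the old ones are popped. Popping in
  stages therefore agrees with popping once at the end.
\<close>

lemma pop_pop_upd:
  assumes v: "g v = None"
  shows "pop ((pop g)(v \<mapsto> d)) = pop (g(v \<mapsto> d))"
proof
  fix y
  let ?h = "g(v \<mapsto> d)" and ?k = "(pop g)(v \<mapsto> d)"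
  have gh: "arcs g \<subseteq> arcs ?h" using v by (rule arcs_upd_mono)
  have kh: "arcs ?k \<subseteq> arcs ?h" by (auto simp: arcs_def pop_def split: if_splits)
  show "pop ?k y = pop ?h y"
  proof (cases "(y, y) \<in> (arcs g)\<^sup>+")
    case True
    then have "(y, y) \<in> (arcs ?h)\<^sup>+" using gh by (metis trancl_mono)
    moreover have "y \<noteq> v" using True v arcs_stuck_trancl[of g v] by auto
    ultimately show ?thesis using True by (simp add: pop_def)
  next
    case False
    have "(y, y) \<in> (arcs ?k)\<^sup>+" if c: "(y, y) \<in> (arcs ?h)\<^sup>+"
    proof -
      \<comment> \<open>The cycle of \<open>y\<close> avoids the old cycles: from such a cycle one could not come back to \<open>y\<close>.\<close>
      have nc: "(z, z) \<notin> (arcs g)\<^sup>+" if "(y, z) \<in> (arcs ?h)\<^sup>*" for z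
      proof
        assume z: "(z, z) \<in> (arcs g)\<^sup>+"
        have "(z, w) \<in> (arcs ?h)\<^sup>* \<Longrightarrow> (w, w) \<in> (arcs g)\<^sup>+" for w
        proof (induction rule: rtrancl_induct)
          case base then show ?case by (rule z)
        next
          case (step a b)
          then have "(a, b) \<in> arcs g" using v arcs_stuck_trancl[of g v v]
            by (cases "a = v") (auto simp: arcs_def)
          then show ?case using step.IH cyclic_forward by (metis r_into_rtrancl)
        qed
        moreover have "(z, y) \<in> (arcs ?h)\<^sup>*" using cyclic_forward[OF c that] by simp
        ultimately show False using False by blast
      qed
      have "(y, z) \<in> (arcs ?h)\<^sup>+ \<Longrightarrow> (y, z) \<in> (arcs ?k)\<^sup>+" for z
      proof (induction rule: trancl_induct)
        case (base z)
        have "(y, z) \<in> arcs ?k" using base nc[of y] by (auto simp: arcs_def pop_def split: if_splits)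
        then show ?case by (rule r_into_trancl)
      next
        case (step a b)
        have "(a, b) \<in> arcs ?k" using step nc[of a]
          by (auto simp: arcs_def pop_def trancl_into_rtrancl split: if_splits)
        then show ?case using step.IH by (meson trancl.trancl_into_trancl)
      qed
      with c show ?thesis by simp
    qed
    moreover have "(y, y) \<in> (arcs ?k)\<^sup>+ \<Longrightarrow> (y, y) \<in> (arcs ?h)\<^sup>+"
      using kh by (metis trancl_mono)
    ultimately show ?thesis using False by (auto simp: pop_def)
  qed
qed

text \<open>
  This is why the order of exploration does not matter.
\<close>

lemma reveal_commute:
  assumes "f u = None" "f v = None" "u \<noteq> v"
  shows "reveal v d (reveal u c f) = reveal u c (reveal v d f)"
  using assms pop_pop_upd[of "f(u \<mapsto> c)" v d] pop_pop_upd[of "f(v \<mapsto> d)" u c]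
  by (simp add: reveal_def fun_upd_twist)

lemma reveal_other: "f v = None \<Longrightarrow> u \<noteq> v \<Longrightarrow> reveal u c f v = None"
  by (simp add: reveal_def pop_def)

lemma rtrancl_upd_mono: "f u = None \<Longrightarrow> (x, y) \<in> (arcs f)\<^sup>* \<Longrightarrow> (x, y) \<in> (arcs (f(u \<mapsto> c)))\<^sup>*"
  using arcs_upd_mono[of f u] by (metis rtrancl_mono subsetD)

lemma open_end_reveal:
  assumes "open_end f x v" "f u = None" "u \<noteq> v"
  shows "open_end (reveal u c f) x v"
  unfolding open_end_def reveal_def
proof
  let ?g = "f(u \<mapsto> c)"
  show "pop ?g v = None" using assms by (simp add: pop_def open_end_def)
  show "(x, v) \<in> (arcs (pop ?g))\<^sup>*"
  proof (rule rtrancl_pop)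
    show "(x, v) \<in> (arcs ?g)\<^sup>*" using assms rtrancl_upd_mono by (metis open_end_def)
    fix z assume "(z, v) \<in> (arcs ?g)\<^sup>+"
    then have "open_end ?g z v" using assms by (auto simp: open_end_def)
    then show "(z, z) \<notin> (arcs ?g)\<^sup>+" by (rule open_end_not_cyclic)
  qed
qed

text \<open>
  A chain without open end never passes through \<open>u\<close>, so no cycle closed by a card of \<open>u\<close> can meet it.
\<close>

lemma no_open_end_reveal:
  assumes ac: "acyclic_cards f" and no: "\<And>y. \<not> open_end f x y" and u: "f u = None"
  shows "\<not> open_end (reveal u c f) x y"
proof
  let ?g = "f(u \<mapsto> c)"
  assume y: "open_end (reveal u c f) x y"
  have same: "(z, w) \<in> (arcs ?g)\<^sup>* \<Longrightarrow> (x, z) \<in> (arcs f)\<^sup>* \<Longrightarrow> (z, w) \<in> (arcs f)\<^sup>*" for z w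
  proof (induction rule: rtrancl_induct)
    case base then show ?case by simp
  next
    case (step a b)
    then have "(x, a) \<in> (arcs f)\<^sup>*" by (meson rtrancl_trans)
    then have "a \<noteq> u" using no[of u] u by (auto simp: open_end_def)
    then have "(a, b) \<in> arcs f" using step by (auto simp: arcs_def)
    then show ?case using step by (meson rtrancl.rtrancl_into_rtrancl)
  qed
  have "(x, y) \<in> (arcs ?g)\<^sup>*"
    using y by (metis arcs_pop_subset open_end_def reveal_def rtrancl_mono subsetD)
  then have xy: "(x, y) \<in> (arcs f)\<^sup>*" using same by blast
  then have fy: "f y \<noteq> None" using no by (auto simp: open_end_def)
  then have "y \<noteq> u" using u by auto
  then have "(y, y) \<in> (arcs ?g)\<^sup>+"
    using y fy by (auto simp: open_end_def reveal_def pop_def split: if_splits)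
  then obtain w where w: "(y, w) \<in> arcs ?g" "(w, y) \<in> (arcs ?g)\<^sup>*" by (meson tranclD)
  then have yw: "(y, w) \<in> arcs f" using \<open>y \<noteq> u\<close> by (auto simp: arcs_def)
  then have "(w, y) \<in> (arcs f)\<^sup>*" using same w xy by (meson rtrancl.rtrancl_into_rtrancl)
  with yw have "(y, y) \<in> (arcs f)\<^sup>+" by (meson rtrancl_into_trancl2)
  with ac show False by (auto simp: acyclic_cards_def acyclic_def)
qed

text \<open>
  When a path is added to the output, its nodes are settled: every chain that reaches them later ends there, as
  if it had reached the boundary.
\<close>

definition freeze :: "'a set \<Rightarrow> 'a cards \<Rightarrow> 'a cards" where
  "freeze A f = (\<lambda>v. if v \<in> A then Some None else f v)"

lemma arcs_freeze: "arcs (freeze A f) = {(a, b) \<in> arcs f. a \<notin> A}"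
  by (auto simp: arcs_def freeze_def split: if_splits)

lemma open_end_freeze: "open_end (freeze A f) x y \<Longrightarrow> open_end f x y \<and> y \<notin> A"
  using rtrancl_mono[of "arcs (freeze A f)" "arcs f"] arcs_freeze[of A f]
  by (fastforce simp: open_end_def freeze_def split: if_splits)

text \<open>
  Freezing commutes with a reveal unless the new card closes a cycle through a frozen node. In this case the
  chain of \<open>y\<close> runs into that node and is resolved instead of being popped.
\<close>

lemma reveal_freeze:
  assumes ac: "acyclic_cards f" and xy: "open_end (freeze A f) x y"
  shows "reveal y c (freeze A f) = freeze A (reveal y c f) \<or>
    (\<forall>z. \<not> open_end (reveal y c (freeze A f)) x z)"
proof -
  let ?f = "f(y \<mapsto> c)"
  have yA: "y \<notin> A" and fy: "f y = None" using open_end_freeze[OF xy] by (auto simp: open_end_def)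
  have eq: "(freeze A f)(y \<mapsto> c) = freeze A ?f" using yA by (auto simp: freeze_def)
  have sub: "arcs (freeze A ?f) \<subseteq> arcs ?f" by (auto simp: arcs_freeze)
  show ?thesis
  proof (cases "\<exists>a\<in>A. (a, a) \<in> (arcs ?f)\<^sup>+")
    case False
    have "(v, v) \<in> (arcs (freeze A ?f))\<^sup>+" if v: "(v, v) \<in> (arcs ?f)\<^sup>+" for v
    proof -
      have "(v, w) \<in> (arcs (freeze A ?f))\<^sup>+" if "(v, w) \<in> (arcs ?f)\<^sup>+" for w
        using that
      proof (induction rule: trancl_induct)
        case (base w)
        then have "(v, w) \<in> arcs (freeze A ?f)" using False v by (simp add: arcs_freeze del: fun_upd_apply) blast
        then show ?case by (rule r_into_trancl)
      next
        case (step a b)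
        have "(a, a) \<in> (arcs ?f)\<^sup>+" using cyclic_forward[OF v] step by (meson trancl_into_rtrancl)
        then have "(a, b) \<in> arcs (freeze A ?f)" using False step by (auto simp: arcs_freeze)
        then show ?case using step.IH by (meson trancl.trancl_into_trancl)
      qed
      then show ?thesis using v .
    qed
    then have "(v, v) \<in> (arcs (freeze A ?f))\<^sup>+ \<longleftrightarrow> (v, v) \<in> (arcs ?f)\<^sup>+" for v
      using sub by (metis trancl_mono)
    then have "reveal y c (freeze A f) = freeze A (reveal y c f)"
      unfolding reveal_def eq pop_def using False by (intro ext) (simp add: freeze_def)
    then show ?thesis ..
  next
    case True
    then obtain a where a: "a \<in> A" "(a, a) \<in> (arcs ?f)\<^sup>+" by blast
    have through: "(y, a) \<in> (arcs ?f)\<^sup>*"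
    proof (rule ccontr)
      assume n: "(y, a) \<notin> (arcs ?f)\<^sup>*"
      have "(a, w) \<in> (arcs f)\<^sup>+" if "(a, w) \<in> (arcs ?f)\<^sup>+" for w
        using that
      proof (induction rule: trancl_induct)
        case (base w)
        then show ?case using n by (auto simp: arcs_def split: if_splits)
      next
        case (step v b)
        have "v \<noteq> y" using cyclic_forward[OF a(2), of v] step n by (meson trancl_into_rtrancl)
        then have "(v, b) \<in> arcs f" using step by (auto simp: arcs_def)
        then show ?case using step.IH by (meson trancl.trancl_into_trancl)
      qed
      then show False using a ac by (auto simp: acyclic_cards_def acyclic_def)
    qed
    have res: "\<exists>b\<in>A. (y, b) \<in> (arcs (freeze A ?f))\<^sup>*"
    proof -
      have "(y, w) \<in> (arcs ?f)\<^sup>* \<Longrightarrow> (y, w) \<in> (arcs (freeze A ?f))\<^sup>* \<or> (\<exists>b\<in>A. (y, b) \<in> (arcs (freeze A ?f))\<^sup>*)" for w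
      proof (induction rule: rtrancl_induct)
        case base then show ?case by simp
      next
        case (step v w)
        then show ?case
          by (cases "v \<in> A") (blast, auto simp: arcs_freeze simp del: fun_upd_apply intro: rtrancl.rtrancl_into_rtrancl)
      qed
      then show ?thesis using through a by blast
    qed
    then obtain b where b: "b \<in> A" "(y, b) \<in> (arcs (freeze A ?f))\<^sup>*" by blast
    have "(x, y) \<in> (arcs (freeze A ?f))\<^sup>*"
      using xy rtrancl_upd_mono[of "freeze A f" y x y c] by (simp add: open_end_def eq)
    with b have xb: "(x, b) \<in> (arcs (freeze A ?f))\<^sup>*" by simp
    have fb: "freeze A ?f b = Some None" using b by (simp add: freeze_def)
    have "(x, b) \<in> (arcs (pop (freeze A ?f)))\<^sup>*"
    proof (rule rtrancl_pop[OF xb])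
      fix z assume z: "(z, b) \<in> (arcs (freeze A ?f))\<^sup>+"
      show "(z, z) \<notin> (arcs (freeze A ?f))\<^sup>+"
        using cyclic_forward[of z "freeze A ?f" b] z fb arcs_stuck_trancl[of "freeze A ?f" b b] by (auto simp: trancl_into_rtrancl)
    qed
    moreover have "pop (freeze A ?f) b = Some None"
      using fb arcs_stuck_trancl[of "freeze A ?f" b b] by (simp add: pop_def)
    ultimately have "\<not> open_end (reveal y c (freeze A f)) x z" for z
      unfolding reveal_def eq by (rule open_end_resolved)
    then show ?thesis by blast
  qed
qed

section \<open>The expected number of reveals\<close>

text \<open>
  The expected number of reveals of \<open>x\<close> among the first \<open>N\<close> reveals, if one always reveals the open end of the
  chain of \<open>x\<close> and stops when there is none. If the cards are
  acyclic and only finitely many are turned up, the chain of \<open>x\<close> then ends at the boundary or at a settled node, and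
  no later reveal can remove it.
\<close>

primrec visits :: "('a \<Rightarrow> 'a option pmf) \<Rightarrow> 'a \<Rightarrow> nat \<Rightarrow> 'a cards \<Rightarrow> ennreal" where
  "visits P x 0 f = 0"
| "visits P x (Suc N) f =
     (if \<exists>y. open_end f x y
      then let y = (THE y. open_end f x y)
        in of_bool (y = x) + (\<integral>\<^sup>+c. visits P x N (reveal y c f) \<partial>measure_pmf (P y))
      else 0)"

lemma visits_Suc:
  assumes "open_end f x y"
  shows "visits P x (Suc N) f =
    of_bool (y = x) + (\<integral>\<^sup>+c. visits P x N (reveal y c f) \<partial>measure_pmf (P y))"
proof -
  have "(THE y. open_end f x y) = y" using assms by (rule the_equality) (rule open_end_unique[OF _ assms])
  then show ?thesis using assms by (auto simp: Let_def)
qed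

declare visits.simps(2) [simp del]

lemma visits_resolved: "(\<And>y. \<not> open_end f x y) \<Longrightarrow> visits P x N f = 0"
  by (cases N) (auto simp: visits.simps(2))

lemma visits_mono: "visits P x N f \<le> visits P x (Suc N) f"
proof (induction N arbitrary: f)
  case 0 then show ?case by simp
next
  case (Suc N)
  show ?case
  proof (cases "\<exists>y. open_end f x y")
    case True
    then obtain y where "open_end f x y" ..
    then show ?thesis
      unfolding visits_Suc[OF \<open>open_end f x y\<close>] using Suc by (intro add_left_mono nn_integral_mono) auto
  next
    case False
    then show ?thesis by (simp add: visits_resolved)
  qed
qed

lemma nn_integral_pmf_swap:
  fixes g :: "'a \<Rightarrow> 'b \<Rightarrow> ennreal"
  shows "(\<integral>\<^sup>+a. \<integral>\<^sup>+b. g a b \<partial>measure_pmf q \<partial>measure_pmf p) =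
    (\<integral>\<^sup>+b. \<integral>\<^sup>+a. g a b \<partial>measure_pmf p \<partial>measure_pmf q)"
proof -
  have "(\<integral>\<^sup>+a. \<integral>\<^sup>+b. g a b \<partial>measure_pmf q \<partial>measure_pmf p) =
      (\<integral>\<^sup>+z. case_prod g z \<partial>measure_pmf (pair_pmf p q))"
    by (simp add: nn_integral_pair_pmf')
  also have "\<dots> = (\<integral>\<^sup>+b. \<integral>\<^sup>+a. g a b \<partial>measure_pmf p \<partial>measure_pmf q)"
    by (subst pair_commute_pmf) (simp add: nn_integral_pair_pmf' nn_integral_map_pmf)
  finally show ?thesis .
qed

text \<open>
  Revealing some other node \<open>u\<close> first does not help: the strategy would go on at the same open end \<open>v\<close>, and the two
  reveals can be exchanged, so that the induction hypothesis applies after the reveal of \<open>v\<close>. The node \<open>x\<close> itself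
  has no card only if it is the open end.
\<close>

lemma visits_supersolution:
  assumes "acyclic_cards f" and "f u = None"
  shows "of_bool (u = x) + (\<integral>\<^sup>+c. visits P x N (reveal u c f) \<partial>measure_pmf (P u)) \<le> visits P x (Suc N) f"
  using assms
proof (induction N arbitrary: f u)
  case (0 f u)
  show ?case
  proof (cases "u = x")
    case True
    then have "open_end f x u" using 0 by (simp add: open_end_def)
    then show ?thesis by (simp add: visits_Suc[of f x u])
  qed simp
next
  case (Suc N f u)
  show ?case
  proof (cases "\<exists>v. open_end f x v")
    case False
    then have "u \<noteq> x" using Suc.prems by (auto simp: open_end_def)
    moreover have "visits P x (Suc N) (reveal u c f) = 0" for c
      using no_open_end_reveal[OF Suc.prems(1) _ Suc.prems(2)] False by (intro visits_resolved) blast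
    ultimately show ?thesis by simp
  next
    case True
    then obtain v where v: "open_end f x v" ..
    show ?thesis
    proof (cases "u = v")
      case True
      then show ?thesis by (simp only: visits_Suc[OF v])
    next
      case False
      have fv: "f v = None" using v by (simp add: open_end_def)
      have ux: "u \<noteq> x"
      proof
        assume "u = x"
        then have "open_end f x u" using Suc.prems by (simp add: open_end_def)
        then show False using open_end_unique v False by fast
      qed
      have "(\<integral>\<^sup>+c. visits P x (Suc N) (reveal u c f) \<partial>measure_pmf (P u)) =
        (\<integral>\<^sup>+c. of_bool (v = x) + (\<integral>\<^sup>+d. visits P x N (reveal u c (reveal v d f)) \<partial>measure_pmf (P v)) \<partial>measure_pmf (P u))"
        unfolding visits_Suc[OF open_end_reveal[OF v Suc.prems(2) False]]
          reveal_commute[OF Suc.prems(2) fv False] ..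
      also have "\<dots> = of_bool (v = x) +
          (\<integral>\<^sup>+d. \<integral>\<^sup>+c. visits P x N (reveal u c (reveal v d f)) \<partial>measure_pmf (P u) \<partial>measure_pmf (P v))"
        by (subst nn_integral_pmf_swap) (simp add: nn_integral_add)
      also have "\<dots> \<le> of_bool (v = x) + (\<integral>\<^sup>+d. visits P x (Suc N) (reveal v d f) \<partial>measure_pmf (P v))"
      proof (intro add_left_mono nn_integral_mono)
        fix d
        have "reveal v d f u = None" using Suc.prems False by (simp add: reveal_other)
        from Suc.IH[OF acyclic_reveal this]
        show "(\<integral>\<^sup>+c. visits P x N (reveal u c (reveal v d f)) \<partial>measure_pmf (P u)) \<le> visits P x (Suc N) (reveal v d f)"
          using ux by simp
      qed
      also have "\<dots> = visits P x (Suc (Suc N)) f" using v by (simp only: visits_Suc)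
      finally show ?thesis using ux by simp
    qed
  qed
qed

text \<open>
  By \<open>reveal_freeze\<close> frozen and unfrozen cards evolve in the same way until the frozen chain is resolved, after
  which it causes no further visits.
\<close>

lemma visits_freeze:
  assumes "acyclic_cards f"
  shows "visits P x N (freeze A f) \<le> visits P x N f"
  using assms
proof (induction N arbitrary: f)
  case 0 then show ?case by simp
next
  case (Suc N f)
  show ?case
  proof (cases "\<exists>y. open_end (freeze A f) x y")
    case False
    then show ?thesis using visits_resolved[of "freeze A f" x P "Suc N"] by auto
  next
    case True
    then obtain y where y: "open_end (freeze A f) x y" ..
    have "visits P x N (reveal y c (freeze A f)) \<le> visits P x N (reveal y c f)" for c
      using reveal_freeze[OF Suc.prems y, of c]
    proof
      assume "reveal y c (freeze A f) = freeze A (reveal y c f)"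
      then show ?thesis using Suc.IH[OF acyclic_reveal] by simp
    next
      assume "\<forall>z. \<not> open_end (reveal y c (freeze A f)) x z"
      then show ?thesis using visits_resolved[of "reveal y c (freeze A f)" x P N] by auto
    qed
    then show ?thesis
      unfolding visits_Suc[OF y] visits_Suc[OF conjunct1[OF open_end_freeze[OF y]]]
      by (intro add_left_mono nn_integral_mono)
  qed
qed

text \<open>
  The cards that the strategy of \<open>visits\<close> meets when it starts without cards: they are those of a loop-erased
  walk from \<open>x\<close> to \<open>y\<close>.
\<close>

definition pure_chain :: "'a \<Rightarrow> 'a cards \<Rightarrow> 'a \<Rightarrow> bool" where
  "pure_chain x f y \<longleftrightarrow> acyclic_cards f \<and> open_end f x y \<and> (\<forall>z. f z \<noteq> None \<longrightarrow> (x, z) \<in> (arcs f)\<^sup>*)"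

lemma pure_chain_empty: "pure_chain x (\<lambda>_. None) x"
  by (auto simp: pure_chain_def open_end_def acyclic_cards_def arcs_def acyclic_def)

lemma pure_chain_reveal_None:
  assumes "pure_chain x f y"
  shows "\<not> open_end (reveal y None f) x z"
proof -
  let ?g = "f(y \<mapsto> None)"
  have fy: "f y = None" and xy: "(x, y) \<in> (arcs f)\<^sup>*" and ac: "acyclic_cards f"
    using assms by (auto simp: pure_chain_def open_end_def)
  have eq: "arcs ?g = arcs f" using fy by (auto simp: arcs_def split: if_splits)
  have "pop ?g = ?g" using ac by (simp add: pop_acyclic acyclic_cards_def eq)
  then show ?thesis
    using xy eq by (intro open_end_resolved[of x y]) (auto simp: reveal_def)
qed

text \<open>
  One step of loop erasure. If \<open>w\<close> is on the chain, then the cyclic nodes are those from \<open>w\<close> to \<open>y\<close>, and popping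
  them leaves the part up to \<open>w\<close>.
\<close>

lemma pure_chain_reveal_Some:
  assumes ch: "pure_chain x f y"
  shows "pure_chain x (reveal y (Some w) f) w"
proof -
  let ?g = "f(y \<mapsto> Some w)"
  have fy: "f y = None" and xy: "(x, y) \<in> (arcs f)\<^sup>*" and ac: "acyclic (arcs f)"
    and all: "\<And>z. f z \<noteq> None \<Longrightarrow> (x, z) \<in> (arcs f)\<^sup>*"
    using ch by (auto simp: pure_chain_def open_end_def acyclic_cards_def)
  have arcs: "arcs ?g = insert (y, w) (arcs f)" using fy by (auto simp: arcs_def split: if_splits)
  have mono: "(a, b) \<in> (arcs f)\<^sup>* \<Longrightarrow> (a, b) \<in> (arcs ?g)\<^sup>*" for a b
    using rtrancl_mono[of "arcs f" "arcs ?g"] arcs by blast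
  have cyc: "(z, z) \<in> (arcs ?g)\<^sup>+ \<longleftrightarrow> (w, z) \<in> (arcs f)\<^sup>* \<and> (z, y) \<in> (arcs f)\<^sup>*" for z
    unfolding arcs trancl_insert using ac by (auto simp: acyclic_def)
  have reach: "(x, z) \<in> (arcs (pop ?g))\<^sup>*"
    if "(x, z) \<in> (arcs f)\<^sup>*" and nc: "(z, z) \<notin> (arcs ?g)\<^sup>+ \<or> z = w" for z
  proof -
    have "(v, z) \<in> (arcs f)\<^sup>* \<Longrightarrow> (v, z) \<in> (arcs (pop ?g))\<^sup>*" for v
    proof (induction rule: converse_rtrancl_induct)
      case base then show ?case by simp
    next
      case (step a b)
      have "(a, a) \<notin> (arcs ?g)\<^sup>+"
      proof
        assume c: "(a, a) \<in> (arcs ?g)\<^sup>+"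
        have az: "(a, z) \<in> (arcs f)\<^sup>+" using step by (meson rtrancl_into_trancl2)
        then have "(a, z) \<in> (arcs ?g)\<^sup>*" using mono by (simp add: trancl_into_rtrancl)
        with c have "(z, z) \<in> (arcs ?g)\<^sup>+" using cyclic_forward by metis
        with nc have "z = w" by simp
        then have "(a, a) \<in> (arcs f)\<^sup>+" using az c cyc by (meson trancl_rtrancl_trancl)
        then show False using ac by (simp add: acyclic_def)
      qed
      moreover have "(a, b) \<in> arcs ?g" using step arcs by simp
      ultimately have "(a, b) \<in> arcs (pop ?g)" by (simp add: arcs_pop)
      then show ?case using step.IH by (rule converse_rtrancl_into_rtrancl)
    qed
    then show ?thesis using that by simp
  qed
  show ?thesis unfolding pure_chain_def open_end_def reveal_def
  proof (intro conjI allI impI)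
    show "acyclic_cards (pop ?g)" by (rule acyclic_pop)
    show "pop ?g w = None"
    proof (cases "(w, y) \<in> (arcs f)\<^sup>*")
      case True
      then show ?thesis using cyc[of w] by (simp add: pop_def del: fun_upd_apply)
    next
      case False
      then have "w \<noteq> y" by auto
      have "f w = None"
      proof (rule ccontr)
        assume "f w \<noteq> None"
        then have "(x, w) \<in> (arcs f)\<^sup>*" by (rule all)
        then have "(y, w) \<in> (arcs f)\<^sup>*" using xy False arcs_comparable by metis
        then show False using \<open>w \<noteq> y\<close> fy by (simp add: arcs_stuck)
      qed
      then show ?thesis using \<open>w \<noteq> y\<close> by (simp add: pop_def)
    qed
    show "(x, w) \<in> (arcs (pop ?g))\<^sup>*"
    proof (cases "(w, y) \<in> (arcs f)\<^sup>*")
      case True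
      have "(x, w) \<in> (arcs f)\<^sup>*"
        using True xy fy all[of w] by (cases "w = y") (auto simp: arcs_def elim: converse_rtranclE)
      then show ?thesis by (rule reach) simp
    next
      case False
      then have "(y, y) \<notin> (arcs ?g)\<^sup>+" using cyc[of y] by simp
      then have "(y, w) \<in> arcs (pop ?g)" using arcs by (simp add: arcs_pop del: fun_upd_apply)
      moreover have "(x, y) \<in> (arcs (pop ?g))\<^sup>*" using xy \<open>(y, y) \<notin> (arcs ?g)\<^sup>+\<close> by (intro reach) auto
      ultimately show ?thesis by (meson rtrancl.rtrancl_into_rtrancl)
    qed
    fix z assume "pop ?g z \<noteq> None"
    then have nc: "(z, z) \<notin> (arcs ?g)\<^sup>+" and "?g z \<noteq> None" by (auto simp: pop_def split: if_splits)
    then have "(x, z) \<in> (arcs f)\<^sup>*" using all[of z] xy by (cases "z = y") auto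
    then show "(x, z) \<in> (arcs (pop ?g))\<^sup>*" using nc by (intro reach) auto
  qed
qed

text \<open>
  The end of a pure chain moves like the plain random walk, whatever was erased before. Hence the Green function of
  this walk bounds the visits, and so does every supersolution \<open>G\<close> of its equation.
\<close>

lemma visits_pure_chain_le:
  assumes G: "\<And>y. of_bool (y = x) + (\<integral>\<^sup>+c. (case c of None \<Rightarrow> 0 | Some w \<Rightarrow> G w) \<partial>measure_pmf (P y)) \<le> G y"
    and "pure_chain x f y"
  shows "visits P x N f \<le> G y"
  using assms(2)
proof (induction N arbitrary: f y)
  case 0 then show ?case by simp
next
  case (Suc N f y)
  have "visits P x N (reveal y c f) \<le> (case c of None \<Rightarrow> 0 | Some w \<Rightarrow> G w)" for c
  proof (cases c)
    case None
    then show ?thesis using pure_chain_reveal_None[OF Suc.prems] visits_resolved[of "reveal y None f" x P N] by simp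
  next
    case (Some w)
    then show ?thesis using Suc.IH pure_chain_reveal_Some[OF Suc.prems] by simp
  qed
  then have "visits P x (Suc N) f \<le> of_bool (y = x) + (\<integral>\<^sup>+c. (case c of None \<Rightarrow> 0 | Some w \<Rightarrow> G w) \<partial>measure_pmf (P y))"
    using Suc.prems visits_Suc[of f x y P N] by (auto simp: pure_chain_def intro!: add_left_mono nn_integral_mono)
  also have "\<dots> \<le> G y" by (rule G)
  finally show ?case .
qed

text \<open>
  The terms of this sum belong to different strategies, one for each \<open>x\<close>. Nevertheless it bounds the expected number
  of reveals of a single strategy, whichever it is.
\<close>

definition remaining_reveals :: "('a \<Rightarrow> 'a option pmf) \<Rightarrow> 'a set \<Rightarrow> 'a cards \<Rightarrow> ennreal" where
  "remaining_reveals P V f = (\<Sum>x\<in>V. SUP N. visits P x N f)"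

lemma remaining_reveals_supersolution:
  assumes V: "finite V" "u \<in> V" and f: "acyclic_cards f" "f u = None"
  shows "1 + (\<integral>\<^sup>+c. remaining_reveals P V (reveal u c f) \<partial>measure_pmf (P u)) \<le> remaining_reveals P V f"
proof -
  have "(\<integral>\<^sup>+c. remaining_reveals P V (reveal u c f) \<partial>measure_pmf (P u)) =
      (\<Sum>x\<in>V. SUP N. \<integral>\<^sup>+c. visits P x N (reveal u c f) \<partial>measure_pmf (P u))"
    unfolding remaining_reveals_def
    by (subst nn_integral_sum)
      (auto intro!: sum.cong nn_integral_monotone_convergence_SUP simp: incseq_Suc_iff le_fun_def visits_mono)
  moreover have "1 = (\<Sum>x\<in>V. of_bool (u = x) :: ennreal)"
    using V by (simp add: of_bool_def if_distrib)
  ultimately have "1 + (\<integral>\<^sup>+c. remaining_reveals P V (reveal u c f) \<partial>measure_pmf (P u)) =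
      (\<Sum>x\<in>V. of_bool (u = x) + (SUP N. \<integral>\<^sup>+c. visits P x N (reveal u c f) \<partial>measure_pmf (P u)))"
    by (simp add: sum.distrib)
  also have "\<dots> = (\<Sum>x\<in>V. SUP N. of_bool (u = x) + (\<integral>\<^sup>+c. visits P x N (reveal u c f) \<partial>measure_pmf (P u)))"
    by (intro sum.cong refl) (simp add: ennreal_SUP_add_right)
  also have "\<dots> \<le> remaining_reveals P V f"
    unfolding remaining_reveals_def
    using visits_supersolution[OF f] by (intro sum_mono SUP_least) (meson SUP_upper2 UNIV_I)
  finally show ?thesis .
qed

lemma remaining_reveals_freeze:
  "acyclic_cards f \<Longrightarrow> remaining_reveals P V (freeze A f) \<le> remaining_reveals P V f"
  unfolding remaining_reveals_def by (intro sum_mono SUP_mono) (metis visits_freeze UNIV_I)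

lemma remaining_reveals_empty:
  assumes "\<And>x y. x \<in> V \<Longrightarrow>
    of_bool (y = x) + (\<integral>\<^sup>+c. (case c of None \<Rightarrow> 0 | Some w \<Rightarrow> G w x) \<partial>measure_pmf (P y)) \<le> G y x"
  shows "remaining_reveals P V (\<lambda>_. None) \<le> (\<Sum>x\<in>V. G x x)"
  unfolding remaining_reveals_def
proof (intro sum_mono SUP_least)
  fix x N assume "x \<in> V"
  then show "visits P x N (\<lambda>_. None) \<le> G x x"
    using visits_pure_chain_le[where G = "\<lambda>y. G y x", OF assms pure_chain_empty] by blast
qed

section \<open>Loops over subprobability distributions\<close>

text \<open>
  Admissibility for inductions over \<^const>\<open>while_spmf\<close>, where only one loop is fixed and its state varies.
\<close>

lemma admissible_below_spmf:
  "spmf.admissible (\<lambda>w. \<forall>i. J i \<longrightarrow> ord_spmf (=) (map_spmf h (curry (curry w) b f (k i))) (q i))"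
proof (rule ccpo.admissibleI)
  fix Y assume Y: "Complete_Partial_Order.chain spmf.le_fun Y" "Y \<noteq> {}"
    and below: "\<forall>w\<in>Y. \<forall>i. J i \<longrightarrow> ord_spmf (=) (map_spmf h (curry (curry w) b f (k i))) (q i)"
  show "\<forall>i. J i \<longrightarrow> ord_spmf (=) (map_spmf h (curry (curry (spmf.lub_fun Y)) b f (k i))) (q i)"
  proof (intro allI impI)
    fix i assume "J i"
    let ?Z = "{v. \<exists>w\<in>Y. v = w ((b, f), k i)}"
    have chain: "Complete_Partial_Order.chain (ord_spmf (=)) ?Z"
      using Y(1) unfolding chain_def fun_ord_def by blast
    have "map_spmf h (lub_spmf ?Z) = lub_spmf (map_spmf h ` ?Z)"
      using chain by (rule map_lub_spmf)
    moreover have "ord_spmf (=) (lub_spmf (map_spmf h ` ?Z)) (q i)"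
      using below \<open>J i\<close> Y(2)
      by (intro lub_spmf_least chain_imageI[OF chain]) (auto simp: ord_spmf_map_spmf intro: ord_spmf_mono)
    ultimately show "ord_spmf (=) (map_spmf h (curry (curry (spmf.lub_fun Y)) b f (k i))) (q i)"
      by (simp add: fun_lub_def)
  qed
qed

lemma rel_spmf_functionalI:
  assumes "\<And>x. x \<in> set_spmf p \<Longrightarrow> R x (h x)" and "map_spmf h p = q"
  shows "rel_spmf R p q"
  using assms by (auto simp: spmf_rel_map intro!: rel_spmf_reflI)

lemma rel_spmf_functionalD:
  assumes "rel_spmf R p q" and "\<And>x y. R x y \<Longrightarrow> y = h x"
  shows "map_spmf h p = q"
proof -
  have "rel_spmf (=) (map_spmf h p) q"
    using assms by (auto simp: spmf_rel_map elim!: rel_spmf_mono)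
  then show ?thesis by (simp add: spmf_rel_eq)
qed

lemma rel_spmf_domainD: "rel_spmf R p q \<Longrightarrow> x \<in> set_spmf p \<Longrightarrow> \<exists>y. R x y"
  by (force elim!: rel_spmfE)

lemma while_spmf_invariant:
  assumes inv: "\<And>s s'. J s \<Longrightarrow> b s \<Longrightarrow> s' \<in> set_spmf (f s) \<Longrightarrow> J s'"
  shows "J s \<Longrightarrow> s' \<in> set_spmf (while_spmf b f s) \<Longrightarrow> J s' \<and> \<not> b s'"
proof -
  have "\<forall>s. J s \<longrightarrow> set_spmf (while_spmf b f s) \<subseteq> {s'. J s' \<and> \<not> b s'}"
  proof (rule while_spmf.fixp_induct)
    show "spmf.admissible (\<lambda>w. \<forall>s. J s \<longrightarrow> set_spmf (curry (curry w) b f s) \<subseteq> {s'. J s' \<and> \<not> b s'})"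
    proof (rule ccpo.admissibleI)
      fix Y assume Y: "Complete_Partial_Order.chain spmf.le_fun Y" "Y \<noteq> {}"
        and sub: "\<forall>w\<in>Y. \<forall>s. J s \<longrightarrow> set_spmf (curry (curry w) b f s) \<subseteq> {s'. J s' \<and> \<not> b s'}"
      have chain: "Complete_Partial_Order.chain (ord_spmf (=)) {v. \<exists>w\<in>Y. v = w ((b, f), s)}" for s
        using Y(1) unfolding chain_def fun_ord_def by blast
      show "\<forall>s. J s \<longrightarrow> set_spmf (curry (curry (spmf.lub_fun Y)) b f s) \<subseteq> {s'. J s' \<and> \<not> b s'}"
        using sub by (fastforce simp: fun_lub_def set_lub_spmf[OF chain])
    qed
    fix w :: "('a \<Rightarrow> bool) \<Rightarrow> ('a \<Rightarrow> 'a spmf) \<Rightarrow> 'a \<Rightarrow> 'a spmf"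
    assume "\<forall>s. J s \<longrightarrow> set_spmf (w b f s) \<subseteq> {s'. J s' \<and> \<not> b s'}"
    then show "\<forall>s. J s \<longrightarrow> set_spmf (if b s then f s \<bind> w b f else return_spmf s) \<subseteq> {s'. J s' \<and> \<not> b s'}"
      using inv by (auto simp: set_bind_spmf split: if_splits) blast+
  qed simp
  then show "J s \<Longrightarrow> s' \<in> set_spmf (while_spmf b f s) \<Longrightarrow> J s' \<and> \<not> b s'" by blast
qed

text \<open>
  As \<open>R\<close> determines the abstract state from the concrete one, the claim amounts to an equation between two least
  fixed points. Each side is shown to be below the other by induction on the smaller side.
\<close>

lemma rel_spmf_while:
  assumes func: "\<And>s a. R s a \<Longrightarrow> a = h s"
    and guard: "\<And>s a. R s a \<Longrightarrow> b s \<longleftrightarrow> b' a"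
    and body: "\<And>s a. R s a \<Longrightarrow> b s \<Longrightarrow> rel_spmf R (f s) (f' a)"
    and init: "R s a"
  shows "rel_spmf (\<lambda>s a. R s a \<and> \<not> b s) (while_spmf b f s) (while_spmf b' f' a)"
proof -
  let ?J = "\<lambda>s. R s (h s)"
  have guard': "b s \<longleftrightarrow> b' (h s)" if "?J s" for s using guard that .
  have step: "map_spmf h (f s) = f' (h s)" if "?J s" "b s" for s
    using rel_spmf_functionalD[OF body[OF that]] func by blast
  have inv: "?J s'" if "?J s" "b s" "s' \<in> set_spmf (f s)" for s s'
    using rel_spmf_domainD[OF body[OF that(1,2)] that(3)] func by blast
  have le: "\<forall>s. ?J s \<longrightarrow> ord_spmf (=) (map_spmf h (while_spmf b f s)) (while_spmf b' f' (h s))"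
  proof (rule while_spmf.fixp_induct, rule admissible_below_spmf[where k = "\<lambda>s. s"], simp, intro allI impI)
    fix w s assume IH: "\<forall>s. ?J s \<longrightarrow> ord_spmf (=) (map_spmf h (w b f s)) (while_spmf b' f' (h s))"
      and s: "?J s"
    show "ord_spmf (=) (map_spmf h (if b s then f s \<bind> w b f else return_spmf s)) (while_spmf b' f' (h s))"
    proof (cases "b s")
      case True
      have "ord_spmf (=) (f s \<bind> (\<lambda>x. map_spmf h (w b f x))) (f s \<bind> (\<lambda>x. while_spmf b' f' (h x)))"
        using IH inv[OF s True] by (intro ord_spmf_bind_reflI) auto
      also have "f s \<bind> (\<lambda>x. while_spmf b' f' (h x)) = while_spmf b' f' (h s)"
        using True guard'[OF s] step[OF s True, symmetric]
        by (subst (2) while_spmf.simps) (simp add: bind_map_spmf o_def)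
      finally show ?thesis using True by (simp add: map_spmf_bind_spmf o_def)
    next
      case False
      then show ?thesis using guard'[OF s] by (simp add: while_spmf.simps)
    qed
  qed
  \<comment> \<open>The induction is now over the abstract loop, at the states that are images of concrete ones.\<close>
  have ge: "\<forall>s. ?J s \<longrightarrow> ord_spmf (=) (map_spmf id (while_spmf b' f' (h s))) (map_spmf h (while_spmf b f s))"
  proof (rule while_spmf.fixp_induct, rule admissible_below_spmf, simp, intro allI impI)
    fix w s assume IH: "\<forall>s. ?J s \<longrightarrow> ord_spmf (=) (map_spmf id (w b' f' (h s))) (map_spmf h (while_spmf b f s))"
      and s: "?J s"
    show "ord_spmf (=) (map_spmf id (if b' (h s) then f' (h s) \<bind> w b' f' else return_spmf (h s)))
      (map_spmf h (while_spmf b f s))"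
    proof (cases "b s")
      case True
      have "f' (h s) \<bind> w b' f' = f s \<bind> (\<lambda>x. w b' f' (h x))"
        using step[OF s True, symmetric] by (simp add: bind_map_spmf o_def)
      also have "ord_spmf (=) \<dots> (f s \<bind> (\<lambda>x. map_spmf h (while_spmf b f x)))"
        using IH inv[OF s True] by (intro ord_spmf_bind_reflI) auto
      also have "\<dots> = map_spmf h (while_spmf b f s)"
        using True by (subst (2) while_spmf.simps) (simp add: map_spmf_bind_spmf o_def)
      finally show ?thesis using True guard'[OF s] by simp
    next
      case False
      then show ?thesis using guard'[OF s] by (simp add: while_spmf.simps)
    qed
  qed
  have J: "?J s" and a: "a = h s" using init func by blast+
  show ?thesis
  proof (rule rel_spmf_functionalI)
    show "map_spmf h (while_spmf b f s) = while_spmf b' f' a"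
      using le ge J unfolding a by (intro spmf.leq_antisym) auto
    fix x assume "x \<in> set_spmf (while_spmf b f s)"
    with inv J show "R x (h x) \<and> \<not> b x" by (rule while_spmf_invariant[where J = ?J])
  qed
qed

text \<open>
  The weakest pre-expectation in the sense of total correctness: nontermination counts as \<open>\<infinity>\<close>.
\<close>

definition wp :: "('a \<Rightarrow> ennreal) \<Rightarrow> 'a spmf \<Rightarrow> ennreal" where
  "wp g p = (\<integral>\<^sup>+x. (case x of None \<Rightarrow> \<infinity> | Some r \<Rightarrow> g r) \<partial>measure_pmf p)"

lemma expected_count_wp: "expected_count f p = wp (\<lambda>r. of_nat (f r)) p"
  by (simp add: expected_count_def wp_def)

lemma wp_return [simp]: "wp g (return_spmf x) = g x"
  by (simp add: wp_def)

lemma wp_bind: "wp g (bind_spmf p f) = wp (\<lambda>x. wp g (f x)) p"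
  by (auto simp: wp_def bind_spmf_def intro!: nn_integral_cong split: option.split)

lemma wp_spmf_of_pmf: "wp g (spmf_of_pmf p) = (\<integral>\<^sup>+x. g x \<partial>measure_pmf p)"
  by (simp add: wp_def spmf_of_pmf_def)

lemma wp_map: "wp g (map_spmf f p) = wp (\<lambda>x. g (f x)) p"
  by (auto simp: wp_def intro!: nn_integral_cong split: option.split)

lemma wp_mono:
  assumes "\<And>x. x \<in> set_spmf p \<Longrightarrow> g x \<le> h x"
  shows "wp g p \<le> wp h p"
  unfolding wp_def using assms
  by (intro nn_integral_mono_AE) (auto simp: AE_measure_pmf_iff in_set_spmf split: option.split)

lemma wp_add_const: "wp (\<lambda>x. c + g x) p = c + wp g p"
proof -
  have "wp (\<lambda>x. c + g x) p = (\<integral>\<^sup>+x. c + (case x of None \<Rightarrow> \<infinity> | Some r \<Rightarrow> g r) \<partial>measure_pmf p)"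
    unfolding wp_def by (intro nn_integral_cong) (auto split: option.split)
  then show ?thesis by (simp add: wp_def nn_integral_add)
qed

text \<open>
  With a cap the expectation is finite, whether the computation terminates or not.
\<close>

definition capped_wp :: "ennreal \<Rightarrow> ('a \<Rightarrow> ennreal) \<Rightarrow> 'a spmf \<Rightarrow> ennreal" where
  "capped_wp k g p = (\<integral>\<^sup>+x. min k (case x of None \<Rightarrow> \<infinity> | Some r \<Rightarrow> g r) \<partial>measure_pmf p)"

lemma capped_wp_bind:
  "capped_wp k g (bind_spmf p f) =
     (\<integral>\<^sup>+x. (case x of None \<Rightarrow> k | Some r \<Rightarrow> capped_wp k g (f r)) \<partial>measure_pmf p)"
  by (auto simp: capped_wp_def bind_spmf_def intro!: nn_integral_cong split: option.split)

lemma capped_wp_le: "capped_wp k g p \<le> k"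
proof -
  have "capped_wp k g p \<le> (\<integral>\<^sup>+x. k \<partial>measure_pmf p)"
    unfolding capped_wp_def by (intro nn_integral_mono) simp
  then show ?thesis by simp
qed

lemma wp_capped: "wp g p = (SUP k. capped_wp (of_nat k) g p)"
proof -
  have "x = (SUP k. min (of_nat k) x)" for x :: ennreal
    by (simp add: inf_min[symmetric] SUP_inf[symmetric] ennreal_SUP_of_nat_eq_top)
  then have eq: "(SUP k. min (of_nat k) x) = x" for x :: ennreal by simp
  then have "wp g p = (\<integral>\<^sup>+x. (SUP k. min (of_nat k) (case x of None \<Rightarrow> \<infinity> | Some r \<Rightarrow> g r)) \<partial>measure_pmf p)"
    unfolding wp_def by (subst eq) simp
  also have "\<dots> = (SUP k. capped_wp (of_nat k) g p)"
    unfolding capped_wp_def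
    by (rule nn_integral_monotone_convergence_SUP) (auto simp: incseq_def le_fun_def min.coboundedI1 intro!: min.mono)
  finally show ?thesis .
qed

text \<open>
  The function \<open>\<Phi>\<close> bounds the expected outcome and \<open>\<Psi>\<close> the expected number of iterations. Let \<open>h\<close> be the expected
  outcome capped at \<open>k\<close>, where nontermination counts as \<open>k\<close>. Then \<open>N h \<le> N \<Phi> + k \<Psi>\<close> by induction on \<open>N\<close>: in each
  unrolling the decrease of \<open>k \<Psi>\<close> by \<open>k\<close> pays for one more copy of \<open>h \<le> k\<close>. Division by \<open>N\<close> and \<open>N \<rightarrow> \<infinity>\<close> give
  \<open>h \<le> \<Phi>\<close>, and then \<open>k\<close> tends to \<open>\<infinity>\<close>. Termination needs no separate argument.
\<close>

lemma wp_while_le: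
  fixes \<Phi> \<Psi> g :: "'s \<Rightarrow> ennreal"
  assumes inv: "I s" "\<And>s s'. I s \<Longrightarrow> b s \<Longrightarrow> s' \<in> set_spmf (f s) \<Longrightarrow> I s'"
    and \<Phi>: "\<And>s. I s \<Longrightarrow> b s \<Longrightarrow> wp \<Phi> (f s) \<le> \<Phi> s"
    and \<Psi>: "\<And>s. I s \<Longrightarrow> b s \<Longrightarrow> 1 + wp \<Psi> (f s) \<le> \<Psi> s"
    and post: "\<And>s. I s \<Longrightarrow> \<not> b s \<Longrightarrow> g s \<le> \<Phi> s"
    and fin: "\<Phi> s < \<infinity> \<Longrightarrow> \<Psi> s < \<infinity>"
  shows "wp g (while_spmf b f s) \<le> \<Phi> s"
proof -
  \<comment> \<open>The cap is at least 1 because \<open>k \<Psi>\<close> has to be infinite whenever \<open>\<Psi>\<close> is.\<close>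
  have main: "of_nat N * capped_wp (of_nat (Suc k)) g (while_spmf b f s) \<le> of_nat N * \<Phi> s + of_nat (Suc k) * \<Psi> s"
    if "I s" for N k s
    using that
  proof (induction N arbitrary: s)
    case 0 then show ?case by simp
  next
    case (Suc N)
    let ?h = "\<lambda>s. capped_wp (of_nat (Suc k)) g (while_spmf b f s)"
    show ?case
    proof (cases "b s")
      case False
      then have "?h s \<le> \<Phi> s"
        using post[OF Suc.prems] by (simp add: while_spmf.simps capped_wp_def min.coboundedI2)
      then show ?thesis by (simp add: add_increasing2 mult_left_mono)
    next
      case True
      have "of_nat N * ?h s =
          (\<integral>\<^sup>+x. of_nat N * (case x of None \<Rightarrow> of_nat (Suc k) | Some r \<Rightarrow> ?h r) \<partial>measure_pmf (f s))"
        using True by (subst while_spmf.simps) (simp add: capped_wp_bind nn_integral_cmult del: of_nat_Suc)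
      also have "\<dots> \<le> wp (\<lambda>r. of_nat N * \<Phi> r + of_nat (Suc k) * \<Psi> r) (f s)"
        unfolding wp_def using Suc.IH inv(2)[OF Suc.prems True]
        by (intro nn_integral_mono_AE) (auto simp: AE_measure_pmf_iff in_set_spmf split: option.split)
      also have "\<dots> = (\<integral>\<^sup>+x. of_nat N * (case x of None \<Rightarrow> \<infinity> | Some r \<Rightarrow> \<Phi> r) +
          of_nat (Suc k) * (case x of None \<Rightarrow> \<infinity> | Some r \<Rightarrow> \<Psi> r) \<partial>measure_pmf (f s))"
        unfolding wp_def by (intro nn_integral_cong) (auto simp: ennreal_mult_eq_top_iff split: option.split)
      also have "\<dots> = of_nat N * wp \<Phi> (f s) + of_nat (Suc k) * wp \<Psi> (f s)"
        unfolding wp_def by (simp add: nn_integral_add nn_integral_cmult del: of_nat_Suc infinity_ennreal_def)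
      finally have "of_nat N * ?h s \<le> of_nat N * wp \<Phi> (f s) + of_nat (Suc k) * wp \<Psi> (f s)" .
      then have "of_nat (Suc N) * ?h s \<le> of_nat (Suc k) + (of_nat N * wp \<Phi> (f s) + of_nat (Suc k) * wp \<Psi> (f s))"
        using capped_wp_le[of "of_nat (Suc k)" g "while_spmf b f s"] by (simp add: distrib_right add_mono)
      also have "\<dots> = of_nat N * wp \<Phi> (f s) + of_nat (Suc k) * (1 + wp \<Psi> (f s))"
        by (simp add: distrib_left ac_simps)
      also have "\<dots> \<le> of_nat N * \<Phi> s + of_nat (Suc k) * \<Psi> s"
        using \<Phi>[OF Suc.prems True] \<Psi>[OF Suc.prems True] by (intro add_mono mult_left_mono) auto
      also have "\<dots> \<le> of_nat (Suc N) * \<Phi> s + of_nat (Suc k) * \<Psi> s"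
        by (simp add: distrib_right add_increasing)
      finally show ?thesis .
    qed
  qed
  show ?thesis
  proof (cases "\<Phi> s < \<infinity>")
    case False then show ?thesis by (simp add: less_top[symmetric])
  next
    case True
    have "capped_wp (of_nat (Suc k)) g (while_spmf b f s) \<le> \<Phi> s" for k
    proof (rule ccontr)
      let ?h = "capped_wp (of_nat (Suc k)) g (while_spmf b f s)"
      assume "\<not> ?h \<le> \<Phi> s"
      have "?h \<le> of_nat (Suc k)" by (rule capped_wp_le)
      then obtain h where h: "?h = ennreal h" "0 \<le> h" by (cases ?h) (auto simp: top_unique)
      obtain x where x: "\<Phi> s = ennreal x" "0 \<le> x" using True by (cases "\<Phi> s") auto
      obtain y where y: "\<Psi> s = ennreal y" "0 \<le> y" using fin[OF True] by (cases "\<Psi> s") auto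
      have "x < h" using \<open>\<not> ?h \<le> \<Phi> s\<close> h x by (auto simp: ennreal_le_iff)
      then obtain N :: nat where "real (Suc k) * y < real N * (h - x)"
        using reals_Archimedean3[of "h - x"] by auto
      moreover have "real N * h \<le> real N * x + real (Suc k) * y"
        using main[OF inv(1), of N k] h x y
        by (simp add: ennreal_of_nat_eq_real_of_nat ennreal_mult[symmetric] ennreal_plus[symmetric] del: ennreal_plus of_nat_Suc)
      ultimately show False by (simp add: algebra_simps)
    qed
    moreover have "capped_wp (of_nat k) g (while_spmf b f s) \<le> capped_wp (of_nat (Suc k)) g (while_spmf b f s)" for k
      unfolding capped_wp_def by (intro nn_integral_mono min.mono) auto
    ultimately show ?thesis unfolding wp_capped by (meson SUP_least order_trans)
  qed
qed

section \<open>Walks as sequences of reveals\<close>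

primrec is_path :: "nat \<Rightarrow> (nat \<times> nat) list \<Rightarrow> nat \<Rightarrow> bool" where
  "is_path i [] w \<longleftrightarrow> i = w"
| "is_path i (e # p) w \<longleftrightarrow> fst e = i \<and> is_path (snd e) p w"

lemma is_path_append: "is_path i (p @ r) w \<longleftrightarrow> (\<exists>v. is_path i p v \<and> is_path v r w)"
  by (induction p arbitrary: i) auto

lemma is_path_last: "is_path i p w \<Longrightarrow> p \<noteq> [] \<Longrightarrow> snd (last p) = w"
  by (induction p arbitrary: i) (auto split: if_splits)

lemma is_path_nth_consecutive: "is_path i p w \<Longrightarrow> Suc k < length p \<Longrightarrow> snd (p ! k) = fst (p ! Suc k)"
proof (induction p arbitrary: i k)
  case (Cons e p)
  then show ?case by (cases k; cases p) auto
qed simp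

lemma is_path_targets: "is_path i p w \<Longrightarrow> insert i (snd ` set p) = insert w (fst ` set p)"
  by (induction p arbitrary: i) auto

lemma is_path_takeWhile:
  "is_path i p w \<Longrightarrow> w \<in> fst ` set p \<Longrightarrow> is_path i (takeWhile (\<lambda>e. fst e \<noteq> w) p) w"
  by (induction p arbitrary: i) auto

lemma is_path_dropWhile:
  "is_path i p w \<Longrightarrow> w \<in> fst ` set p \<Longrightarrow> is_path w (dropWhile (\<lambda>e. fst e \<noteq> w) p) w"
  by (induction p arbitrary: i) auto

lemma is_path_reach:
  "is_path i p w \<Longrightarrow> v \<in> fst ` set p \<Longrightarrow> (i, v) \<in> (set p)\<^sup>* \<and> (v, w) \<in> (set p)\<^sup>+"
proof (induction p arbitrary: i v)
  case (Cons e p)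
  obtain a b where e: "e = (a, b)" by (cases e)
  have p: "is_path b p w" "a = i" using Cons.prems e by auto
  have mono: "(set p)\<^sup>* \<subseteq> (set (e # p))\<^sup>*" "(set p)\<^sup>+ \<subseteq> (set (e # p))\<^sup>+"
    by (auto intro: rtrancl_mono[THEN subsetD] trancl_mono)
  have ab: "(i, b) \<in> set (e # p)" using e p by simp
  have bw: "(b, w) \<in> (set (e # p))\<^sup>*"
  proof (cases "p = []")
    case False
    then have "b \<in> fst ` set p" using p by (cases p) auto
    then show ?thesis using Cons.IH[OF p(1)] mono by (auto intro: trancl_into_rtrancl)
  qed (use p in simp)
  show ?case
  proof (cases "v = i")
    case True
    then show ?thesis using ab bw by (auto intro: rtrancl_into_trancl2)
  next
    case False
    then have "v \<in> fst ` set p" using Cons.prems e p by auto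
    then show ?thesis using Cons.IH[OF p(1)] mono ab by (meson converse_rtrancl_into_rtrancl subsetD)
  qed
qed simp

text \<open>
  The sources of the edges are distinct, so a cyclic part of the path must be a final segment of it.
\<close>

lemma contains_cycle_iff:
  assumes p: "is_path i p w" and d: "distinct (map fst p)"
  shows "contains_cycle p \<longleftrightarrow> w \<in> fst ` set p"
proof
  assume "contains_cycle p"
  then obtain C xs ys where C: "is_cycle C" "p = xs @ C @ ys"
    by (auto simp: contains_cycle_def sublist_def)
  then have ne: "C \<noteq> []" and closed: "snd (last C) = fst (hd C)" by (auto simp: is_cycle_def)
  obtain v v' where v: "is_path v C v'" "is_path v' ys w" using p C by (auto simp: is_path_append)
  then have v': "v' = fst (hd C)" using is_path_last ne closed by metis
  then have "v' \<in> fst ` set C" using ne by simp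
  then have "ys = []" using v(2) d C by (cases ys) auto
  then show "w \<in> fst ` set p" using v \<open>v' \<in> fst ` set C\<close> C by auto
next
  assume w: "w \<in> fst ` set p"
  let ?C = "dropWhile (\<lambda>e. fst e \<noteq> w) p"
  have path: "is_path w ?C w" using is_path_dropWhile[OF p w] .
  have ne: "?C \<noteq> []" using w by auto
  then have "fst (hd ?C) = w" using path by (cases ?C) auto
  moreover have "suffix ?C p" by (rule suffix_dropWhile)
  moreover have "distinct (map fst ?C)" using d by (metis distinct_append map_append takeWhile_dropWhile_id)
  ultimately have "is_cycle ?C"
    using ne is_path_nth_consecutive[OF path] is_path_last[OF path] by (auto simp: is_cycle_def)
  then show "contains_cycle p" using \<open>suffix ?C p\<close> unfolding contains_cycle_def by blast
qed

lemma path_parts: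
  assumes "is_path i p w" "w \<in> fst ` set p"
  shows "open_part p = takeWhile (\<lambda>e. fst e \<noteq> w) p" "closed_part p = dropWhile (\<lambda>e. fst e \<noteq> w) p"
proof -
  have "snd (last p) = w" using assms is_path_last by fastforce
  then show "open_part p = takeWhile (\<lambda>e. fst e \<noteq> w) p" "closed_part p = dropWhile (\<lambda>e. fst e \<noteq> w) p"
    by (simp_all add: open_part_def closed_part_def)
qed

text \<open>
  Nodes spanned by the output are settled, since a walk that reaches one of them stops.
\<close>

definition cards_of :: "element set \<Rightarrow> (nat \<times> nat) list \<Rightarrow> nat cards" where
  "cards_of \<phi> p = (\<lambda>v. if spanned \<phi> v then Some None else map_option Some (map_of p v))"

lemma arcs_cards_of:
  assumes "distinct (map fst p)" and "\<forall>v\<in>fst ` set p. \<not> spanned \<phi> v"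
  shows "arcs (cards_of \<phi> p) = set p"
proof -
  have "(a, b) \<in> arcs (cards_of \<phi> p) \<longleftrightarrow> \<not> spanned \<phi> a \<and> (a, b) \<in> set p" for a b
    unfolding map_of_eq_Some_iff[OF assms(1), symmetric] by (auto simp: arcs_def cards_of_def)
  then show ?thesis using assms(2) by force
qed

text \<open>
  Cutting the closed part off a path is popping.
\<close>

lemma pop_cards_of:
  assumes "is_path i p w" "distinct (map fst p)" "\<forall>v\<in>fst ` set p. \<not> spanned \<phi> v"
  shows "pop (cards_of \<phi> p) = cards_of \<phi> (takeWhile (\<lambda>e. fst e \<noteq> w) p)"
  using assms
proof (induction p arbitrary: i)
  case Nil
  have "arcs (cards_of \<phi> []) = {}" by (simp add: arcs_cards_of)
  then show ?case by (simp add: pop_def)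
next
  case (Cons e r)
  obtain b where e: "e = (i, b)" using Cons.prems by (cases e) auto
  let ?p = "e # r"
  have arcs: "arcs (cards_of \<phi> ?p) = set ?p" "arcs (cards_of \<phi> r) = set r"
    using Cons.prems by (intro arcs_cards_of; simp)+
  show ?case
  proof (cases "i = w")
    case True
    have cyc: "(v, v) \<in> (set ?p)\<^sup>+ \<longleftrightarrow> v \<in> fst ` set ?p" for v
    proof
      assume "(v, v) \<in> (set ?p)\<^sup>+"
      then obtain y where "(v, y) \<in> set ?p" by (blast dest: tranclD)
      then show "v \<in> fst ` set ?p" by force
    next
      assume "v \<in> fst ` set ?p"
      then have "(i, v) \<in> (set ?p)\<^sup>*" "(v, w) \<in> (set ?p)\<^sup>+"
        using is_path_reach[OF Cons.prems(1)] by blast+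
      then show "(v, v) \<in> (set ?p)\<^sup>+" using True by (metis trancl_rtrancl_trancl)
    qed
    show ?thesis
    proof
      fix x
      show "pop (cards_of \<phi> ?p) x = cards_of \<phi> (takeWhile (\<lambda>e. fst e \<noteq> w) ?p) x"
      proof (cases "x \<in> fst ` set ?p")
        case True
        then have "\<not> spanned \<phi> x" using Cons.prems(3) by blast
        then show ?thesis using \<open>i = w\<close> cyc True unfolding pop_def arcs by (simp add: cards_of_def e)
      next
        case False
        then have "map_of ?p x = None" unfolding map_of_eq_None_iff .
        then show ?thesis using \<open>i = w\<close> cyc False unfolding pop_def arcs by (simp add: cards_of_def e)
      qed
    qed
  next
    case False
    have r: "is_path b r w" using Cons.prems e by simp
    have i: "i \<noteq> b" "i \<notin> snd ` set r" "i \<notin> fst ` set r"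
      using is_path_targets[OF r] False Cons.prems e by auto
    have nr: "v = i" if "(v, i) \<in> (set r)\<^sup>*" for v
      using that
    proof (cases rule: rtranclE)
      case (step y)
      then show ?thesis using i(2) by force
    qed
    have cyc: "(v, v) \<in> (set ?p)\<^sup>+ \<longleftrightarrow> (v, v) \<in> (set r)\<^sup>+" for v
      using nr[of b] nr[of v] i(1) unfolding list.set e trancl_insert by blast
    have ii: "(i, i) \<notin> (set r)\<^sup>+"
    proof
      assume "(i, i) \<in> (set r)\<^sup>+"
      then obtain y where "(i, y) \<in> set r" by (blast dest: tranclD)
      then show False using i(3) by force
    qed
    have IH: "pop (cards_of \<phi> r) x = cards_of \<phi> (takeWhile (\<lambda>e. fst e \<noteq> w) r) x" for x
      using Cons r by simp
    have "\<not> spanned \<phi> i" using Cons.prems(3) e by simp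
    show ?thesis
    proof
      fix x
      show "pop (cards_of \<phi> ?p) x = cards_of \<phi> (takeWhile (\<lambda>e. fst e \<noteq> w) ?p) x"
      proof (cases "x = i")
        case True
        then show ?thesis using ii False \<open>\<not> spanned \<phi> i\<close> unfolding pop_def arcs cyc by (simp add: cards_of_def e)
      next
        case neq: False
        then show ?thesis using IH[of x] False unfolding pop_def arcs cyc
          by (cases "(x, x) \<in> (set r)\<^sup>+") (auto simp: cards_of_def e split: if_splits)
      qed
    qed
  qed
qed

lemma acyclic_cards_of:
  assumes "is_path i p w" "distinct (map fst p)" "\<forall>v\<in>fst ` set p. \<not> spanned \<phi> v" "w \<notin> fst ` set p"
  shows "acyclic_cards (cards_of \<phi> p)"
proof -
  have "takeWhile (\<lambda>e. fst e \<noteq> w) p = p" using assms(4) by (subst takeWhile_eq_all_conv) auto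
  then show ?thesis using pop_cards_of[OF assms(1-3)] acyclic_pop by metis
qed

text \<open>
  The new output when a walk ends with path \<open>p\<close>, current node \<open>u\<close> and previous node \<open>u'\<close>.
\<close>

definition commit :: "element set \<Rightarrow> (nat \<times> nat) list \<Rightarrow> nat option \<Rightarrow> nat \<Rightarrow> element set" where
  "commit \<phi> p u u' = \<phi> \<union> {Edge {a, b} | a b. (a, b) \<in> set p} \<union> (if u = None then {Node u'} else {})"

lemma spanned_commit:
  "spanned (commit \<phi> p u u') v \<longleftrightarrow>
     spanned \<phi> v \<or> v \<in> fst ` set p \<union> snd ` set p \<or> (u = None \<and> v = u')"
proof -
  have "(\<exists>e. Edge e \<in> {Edge {a, b} | a b. (a, b) \<in> set p} \<and> v \<in> e) \<longleftrightarrow> v \<in> fst ` set p \<union> snd ` set p"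
  proof
    assume "v \<in> fst ` set p \<union> snd ` set p"
    then obtain a b where "(a, b) \<in> set p" "v = a \<or> v = b" by auto
    then have "Edge {a, b} \<in> {Edge {a, b} | a b. (a, b) \<in> set p} \<and> v \<in> {a, b}" by blast
    then show "\<exists>e. Edge e \<in> {Edge {a, b} | a b. (a, b) \<in> set p} \<and> v \<in> e" by blast
  next
    assume "\<exists>e. Edge e \<in> {Edge {a, b} | a b. (a, b) \<in> set p} \<and> v \<in> e"
    then obtain a b where "(a, b) \<in> set p" "v = a \<or> v = b" by auto
    then show "v \<in> fst ` set p \<union> snd ` set p" by force
  qed
  then show ?thesis unfolding spanned_def commit_def by (cases "u = None") auto
qed

text \<open>
  Adding a path to the output is freezing, no matter why the walk has ended. Popping does no harm here, since the
  popped nodes are frozen as well.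
\<close>

lemma cards_of_commit:
  assumes "insert v (fst ` set p) \<subseteq> {x. spanned \<phi>' x}" and "\<And>x. spanned \<phi> x \<Longrightarrow> spanned \<phi>' x"
  shows "cards_of \<phi>' [] = freeze {x. spanned \<phi>' x} (reveal v c (cards_of \<phi> p))"
proof
  fix x
  show "cards_of \<phi>' [] x = freeze {x. spanned \<phi>' x} (reveal v c (cards_of \<phi> p)) x"
  proof (cases "spanned \<phi>' x")
    case False
    then have "x \<noteq> v" "x \<notin> fst ` set p" "\<not> spanned \<phi> x" using assms by auto
    then have "((cards_of \<phi> p)(v \<mapsto> c)) x = None" by (simp add: cards_of_def map_of_eq_None_iff)
    then show ?thesis using False by (simp add: cards_of_def freeze_def reveal_def pop_def)
  qed (simp add: cards_of_def freeze_def)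
qed

lemma commit_le:
  assumes "insert v (fst ` set p) \<subseteq> {x. spanned \<phi>' x}" and "\<And>x. spanned \<phi> x \<Longrightarrow> spanned \<phi>' x"
  shows "remaining_reveals P V (cards_of \<phi>' []) \<le> remaining_reveals P V (reveal v c (cards_of \<phi> p))"
proof -
  have "cards_of \<phi>' [] = freeze {x. spanned \<phi>' x} (reveal v c (cards_of \<phi> p))"
    using assms by (rule cards_of_commit)
  then show ?thesis by (simp add: remaining_reveals_freeze acyclic_reveal)
qed

text \<open>
  The invariant of the inner loop at the tests that succeed.
\<close>

definition active :: "element set \<Rightarrow> nat \<Rightarrow> walk \<Rightarrow> bool" where
  "active \<phi> n = (\<lambda>(p, u, _, _). \<exists>i w. u = Some w \<and> w < n \<and> is_path i p w \<and> distinct (map fst p) \<and>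
     w \<notin> fst ` set p \<and> (\<forall>v\<in>insert w (fst ` set p). \<not> spanned \<phi> v))"

lemma set_random_successor:
  assumes "simple_graph n E" "0 < q"
  shows "set_pmf (random_successor E q u) = insert None (Some ` neighbours E u)"
proof (rule Set.set_eqI)
  fix x
  show "x \<in> set_pmf (random_successor E q u) \<longleftrightarrow> x \<in> insert None (Some ` neighbours E u)"
    using assms by (cases x) (auto simp: set_pmf_iff pmf_random_successor adj_def neighbours_def add_nonneg_eq_0_iff)
qed

lemma neighbours_lt: "simple_graph n E \<Longrightarrow> v \<in> neighbours E u \<Longrightarrow> u < n \<and> v < n \<and> u \<noteq> v"
  by (auto simp: simple_graph_def neighbours_def doubleton_eq_iff)

text \<open>
  The path of a walk that has ended counts as added to the output.
\<close>

definition walk_potential :: "(nat \<Rightarrow> nat option pmf) \<Rightarrow> nat \<Rightarrow> element set \<Rightarrow> walk \<Rightarrow> ennreal" where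
  "walk_potential P n \<phi> = (\<lambda>(p, u, u', l). remaining_reveals P {..<n}
     (if walk_continues \<phi> (p, u, u', l) then cards_of \<phi> p else cards_of (commit \<phi> p u u') []))"

lemma active_continues:
  assumes "active \<phi> n s"
  shows "walk_continues \<phi> s"
proof -
  obtain p u u' l where s: "s = (p, u, u', l)" by (cases s)
  then obtain i w where a: "u = Some w" "is_path i p w" "distinct (map fst p)"
     "w \<notin> fst ` set p" "\<forall>v\<in>insert w (fst ` set p). \<not> spanned \<phi> v"
    using assms by (auto simp: active_def)
  have "\<forall>v\<in>insert i (snd ` set p). \<not> spanned \<phi> v" unfolding is_path_targets[OF a(2)] using a(5) .
  then have "\<not> intersects p \<phi>" using a(5) by (force simp: intersects_def)
  then show ?thesis using a contains_cycle_iff[OF a(2,3)] by (simp add: walk_continues_def s)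
qed

text \<open>
  A call is a reveal. If it ends the walk, a freezing follows; otherwise the potential is that of the revealed
  cards, with the cycle popped if there is one.
\<close>

lemma walk_step_outcome:
  fixes P :: "nat \<Rightarrow> nat option pmf" and n :: nat
  assumes act: "active \<phi> n (p, Some v, u, l)" and c: "\<And>w. c = Some w \<Longrightarrow> w < n"
  defines "p' \<equiv> (case c of None \<Rightarrow> p | Some w \<Rightarrow> p @ [(v, w)])"
  defines "R \<equiv> remaining_reveals P {..<n} (reveal v c (cards_of \<phi> p))"
  shows "\<not> walk_continues \<phi> (p', c, v, l') \<Longrightarrow> walk_potential P n \<phi> (p', c, v, l') \<le> R"
    and "c \<noteq> None \<Longrightarrow> walk_continues \<phi> (p', c, v, l') \<Longrightarrow>
      active \<phi> n (p', c, v, l') \<and> walk_potential P n \<phi> (p', c, v, l') = R"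
    and "c \<noteq> None \<Longrightarrow> contains_cycle p' \<Longrightarrow>
      active \<phi> n (open_part p', c, v, l') \<and> walk_potential P n \<phi> (open_part p', c, v, l') = R"
proof -
  assume nc: "\<not> walk_continues \<phi> (p', c, v, l')"
  have "insert v (fst ` set p) \<subseteq> {x. spanned (commit \<phi> p' c v) x}"
    by (auto simp: spanned_commit p'_def split: option.split)
  then show "walk_potential P n \<phi> (p', c, v, l') \<le> R"
    using nc by (simp add: walk_potential_def R_def commit_le spanned_commit)
next
  obtain i where path: "is_path i p v" and d: "distinct (map fst p)" and v: "v \<notin> fst ` set p"
    and un: "\<forall>x\<in>insert v (fst ` set p). \<not> spanned \<phi> x"
    using act by (auto simp: active_def)
  have *: "\<exists>w. c = Some w \<and> is_path i p' w \<and> distinct (map fst p') \<and>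
      (\<forall>x\<in>fst ` set p'. \<not> spanned \<phi> x) \<and> p' = p @ [(v, w)] \<and>
      R = remaining_reveals P {..<n} (cards_of \<phi> (takeWhile (\<lambda>e. fst e \<noteq> w) p')) \<and>
      (contains_cycle p' \<longleftrightarrow> w \<in> fst ` set p')" if "c \<noteq> None"
  proof -
    from that obtain w where w: "c = Some w" by auto
    have p': "p' = p @ [(v, w)]" by (simp add: p'_def w)
    have path': "is_path i p' w" and d': "distinct (map fst p')"
      and un': "\<forall>x\<in>fst ` set p'. \<not> spanned \<phi> x"
      using path d v un by (auto simp: p' is_path_append)
    have "map_of p v = None" using v by (simp add: map_of_eq_None_iff)
    then have "cards_of \<phi> p' = (cards_of \<phi> p)(v \<mapsto> c)"
      using un w by (auto simp: p' cards_of_def map_add_def fun_eq_iff split: option.split)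
    then have R: "R = remaining_reveals P {..<n} (cards_of \<phi> (takeWhile (\<lambda>e. fst e \<noteq> w) p'))"
      unfolding R_def reveal_def using pop_cards_of[OF path' d' un'] by simp
    show ?thesis using path' d' un' R w p' contains_cycle_iff[OF path' d'] by blast
  qed
  { assume c': "c \<noteq> None" and cont: "walk_continues \<phi> (p', c, v, l')"
    from *[OF c'] obtain w where **: "c = Some w" "is_path i p' w" "distinct (map fst p')"
      "\<forall>x\<in>fst ` set p'. \<not> spanned \<phi> x" "p' = p @ [(v, w)]"
      "R = remaining_reveals P {..<n} (cards_of \<phi> (takeWhile (\<lambda>e. fst e \<noteq> w) p'))" 
      "contains_cycle p' \<longleftrightarrow> w \<in> fst ` set p'" by blast
    have "w \<notin> fst ` set p'" using cont **(7) by (simp add: walk_continues_def)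
    moreover from this have "takeWhile (\<lambda>e. fst e \<noteq> w) p' = p'" by (subst takeWhile_eq_all_conv) auto
    moreover have "\<not> spanned \<phi> w" using cont **(5) by (auto simp: walk_continues_def intersects_def)
    ultimately show "active \<phi> n (p', c, v, l') \<and> walk_potential P n \<phi> (p', c, v, l') = R"
      using ** cont c by (auto simp: active_def walk_potential_def) }
  { assume c': "c \<noteq> None" and cyc: "contains_cycle p'"
    from *[OF c'] obtain w where **: "c = Some w" "is_path i p' w" "distinct (map fst p')"
      "\<forall>x\<in>fst ` set p'. \<not> spanned \<phi> x" "p' = p @ [(v, w)]"
      "R = remaining_reveals P {..<n} (cards_of \<phi> (takeWhile (\<lambda>e. fst e \<noteq> w) p'))" 
      "contains_cycle p' \<longleftrightarrow> w \<in> fst ` set p'" by blast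
    have w: "w \<in> fst ` set p'" using cyc **(7) by simp
    let ?o = "takeWhile (\<lambda>e. fst e \<noteq> w) p'"
    have "set ?o \<subseteq> set p'" by (auto dest: set_takeWhileD)
    then have "\<forall>x\<in>insert w (fst ` set ?o). \<not> spanned \<phi> x" using **(4) w by auto
    moreover have "w \<notin> fst ` set ?o" by (auto dest: set_takeWhileD)
    moreover have "distinct (map fst ?o)" using **(3) by (metis map_append distinct_append takeWhile_dropWhile_id)
    ultimately have "active \<phi> n (?o, c, v, l')"
      using is_path_takeWhile[OF **(2) w] **(1) c unfolding active_def by auto
    then show "active \<phi> n (open_part p', c, v, l') \<and> walk_potential P n \<phi> (open_part p', c, v, l') = R"
      using active_continues[OF \<open>active \<phi> n (?o, c, v, l')\<close>] path_parts[OF **(2) w] **(6) by (simp add: walk_potential_def) }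
qed

section \<open>The expected number of calls\<close>

definition log_length :: "walk \<Rightarrow> ennreal" where
  "log_length = (\<lambda>(_, _, _, l). of_nat (length l))"

text \<open>
  The part of a step that follows the call with result \<open>c\<close> at the node \<open>v\<close>.
\<close>

definition after_call :: "(nat \<Rightarrow> nat \<Rightarrow> real) \<Rightarrow> (nat \<times> nat) list \<Rightarrow> nat \<Rightarrow> call_log \<Rightarrow> nat option \<Rightarrow> walk spmf" where
  "after_call \<theta> p v l c = (case c of
       None \<Rightarrow> return_spmf (p, c, v, l @ [(v, c)])
     | Some w \<Rightarrow>
         let p' = p @ [(v, w)] in
         if contains_cycle p'
         then bind_spmf (spmf_of_pmf (bernoulli_pmf (cos (angle_sum \<theta> (closed_part p')))))
                (\<lambda>b. return_spmf (if b then open_part p' else p', c, v, l @ [(v, c)]))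
         else return_spmf (p', c, v, l @ [(v, c)]))"

lemma walk_step_alt:
  "walk_step E \<theta> q (p, Some v, u, l) =
     bind_spmf (spmf_of_pmf (random_successor E q v)) (after_call \<theta> p v l)"
  unfolding walk_step_def after_call_def Let_def prod.case option.sel by (rule refl)

context
  fixes n :: nat and E :: "nat set set" and \<theta> :: "nat \<Rightarrow> nat \<Rightarrow> real" and q :: real and queue :: "nat list"
  assumes inst: "mtsf_instance n E \<theta> q queue"
begin

abbreviation "step_law \<equiv> random_successor E q"

abbreviation "remaining f \<equiv> remaining_reveals step_law {..<n} f"

lemma inst_graph: "simple_graph n E" and inst_q: "0 < q" and inst_queue: "set queue = {..<n}" "distinct queue"
  using inst by (auto simp: mtsf_instance_def)

lemma walk_step_support:
  assumes act: "active \<phi> n (p, Some v, u, l)"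
    and s': "s' \<in> set_spmf (walk_step E \<theta> q (p, Some v, u, l))"
  shows "walk_continues \<phi> s' \<longrightarrow> active \<phi> n s'"
proof -
  from s' obtain c where c: "c \<in> set_pmf (step_law v)" and s': "s' \<in> set_spmf (after_call \<theta> p v l c)"
    by (auto simp: walk_step_alt set_bind_spmf simp del: bind_spmf_of_pmf)
  show ?thesis
  proof (cases c)
    case None
    then show ?thesis using s' by (simp add: after_call_def walk_continues_def)
  next
    case (Some w)
    have w: "w < n" using c Some neighbours_lt[OF inst_graph] set_random_successor[OF inst_graph inst_q] by auto
    let ?l = "l @ [(v, c)]"
    have s': "if contains_cycle (p @ [(v, w)])
       then s' = (open_part (p @ [(v, w)]), c, v, ?l) \<or> s' = (p @ [(v, w)], c, v, ?l)
       else s' = (p @ [(v, w)], c, v, ?l)"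
      using s' Some by (auto simp: after_call_def Let_def set_bind_spmf simp del: bind_spmf_of_pmf split: if_splits)
    show ?thesis
      using s' walk_step_outcome(2,3)[OF act, where c = c and l' = ?l and P = step_law] w Some by (auto split: if_splits)
  qed
qed

text \<open>
  For \<open>k = 1\<close> this makes the log length plus the potential a supermartingale, for \<open>k = 0\<close> it makes the potential a
  ranking function.
\<close>

lemma walk_step_potential:
  assumes act: "active \<phi> n (p, Some v, u, l)"
  shows "wp (\<lambda>s. of_nat k * log_length s + walk_potential step_law n \<phi> s) (walk_step E \<theta> q (p, Some v, u, l)) \<le>
    of_nat (k * length l + k) + (\<integral>\<^sup>+c. remaining (reveal v c (cards_of \<phi> p)) \<partial>measure_pmf (step_law v))"
proof -
  let ?g = "\<lambda>s. of_nat k * log_length s + walk_potential step_law n \<phi> s"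
  let ?l = "\<lambda>c. l @ [(v, c)]"
  let ?B = "\<lambda>c. of_nat (k * length l + k) + remaining (reveal v c (cards_of \<phi> p))"
  have "wp ?g (walk_step E \<theta> q (p, Some v, u, l)) \<le> wp ?B (spmf_of_pmf (step_law v))"
    unfolding walk_step_alt wp_bind
  proof (rule wp_mono)
    fix c assume "c \<in> set_spmf (spmf_of_pmf (step_law v))"
    then have c: "\<And>w. c = Some w \<Longrightarrow> w < n"
      using neighbours_lt[OF inst_graph] set_random_successor[OF inst_graph inst_q] by auto
    note out = walk_step_outcome[where c = c and l' = "?l c" and P = step_law, OF act c]
    show "wp ?g (after_call \<theta> p v l c) \<le> ?B c"
    proof (cases c)
      case None
      then show ?thesis using out(1)
        by (simp add: after_call_def walk_continues_def log_length_def distrib_left add_left_mono)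
    next
      case (Some w)
      let ?p = "p @ [(v, w)]"
      show ?thesis
      proof (cases "contains_cycle ?p")
        case True
        then have "\<not> walk_continues \<phi> (?p, c, v, ?l c)" by (simp add: walk_continues_def)
        then have "?g (if b then open_part ?p else ?p, c, v, ?l c) \<le> ?B c" for b
          using out(1,3) Some True by (cases b) (simp_all add: log_length_def distrib_left add_left_mono)
        then have "wp (\<lambda>b. ?g (if b then open_part ?p else ?p, c, v, ?l c)) (spmf_of_pmf B) \<le> wp (\<lambda>_. ?B c) (spmf_of_pmf B)" for B
          by (intro wp_mono) 
        also have "wp (\<lambda>_. ?B c) (spmf_of_pmf B) = ?B c" for B :: "bool pmf" by (simp add: wp_spmf_of_pmf)
        finally show ?thesis using True Some by (simp add: after_call_def Let_def wp_bind del: bind_spmf_of_pmf)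
      next
        case False
        have "walk_potential step_law n \<phi> (?p, c, v, ?l c) \<le> remaining (reveal v c (cards_of \<phi> p))"
          using out(1,2) Some by (cases "walk_continues \<phi> (?p, c, v, ?l c)") auto
        then show ?thesis using False Some by (simp add: after_call_def Let_def log_length_def distrib_left add_left_mono)
      qed
    qed
  qed
  also have "\<dots> = of_nat (k * length l + k) + (\<integral>\<^sup>+c. remaining (reveal v c (cards_of \<phi> p)) \<partial>measure_pmf (step_law v))"
    unfolding wp_spmf_of_pmf by (subst nn_integral_add) simp_all
  finally show ?thesis .
qed

lemma active_potential:
  assumes act: "active \<phi> n (p, Some v, u, l)"
  shows "1 + (\<integral>\<^sup>+c. remaining (reveal v c (cards_of \<phi> p)) \<partial>measure_pmf (step_law v)) \<le>
    walk_potential step_law n \<phi> (p, Some v, u, l)"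
proof -
  obtain i where a: "v < n" "is_path i p v" "distinct (map fst p)" "v \<notin> fst ` set p"
     "\<forall>x\<in>insert v (fst ` set p). \<not> spanned \<phi> x"
    using act by (auto simp: active_def)
  have "acyclic_cards (cards_of \<phi> p)" using a by (intro acyclic_cards_of) auto
  moreover have "cards_of \<phi> p v = None" using a by (simp add: cards_of_def map_of_eq_None_iff)
  ultimately show ?thesis
    using remaining_reveals_supersolution[of "{..<n}" v] a(1) active_continues[OF act]
    by (simp add: walk_potential_def)
qed

lemma walk_step_potential':
  assumes "active \<phi> n s"
  shows "wp (\<lambda>s. log_length s + walk_potential step_law n \<phi> s) (walk_step E \<theta> q s) \<le> log_length s + walk_potential step_law n \<phi> s"
    and "1 + wp (walk_potential step_law n \<phi>) (walk_step E \<theta> q s) \<le> walk_potential step_law n \<phi> s"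
proof -
  obtain p v u l where s: "s = (p, Some v, u, l)"
    using assms by (cases s) (auto simp: active_def)
  note act = assms[unfolded s]
  let ?R = "\<integral>\<^sup>+c. remaining (reveal v c (cards_of \<phi> p)) \<partial>measure_pmf (step_law v)"
  have "wp (\<lambda>s. log_length s + walk_potential step_law n \<phi> s) (walk_step E \<theta> q s) \<le> of_nat (length l) + (1 + ?R)"
    using walk_step_potential[OF act, of 1] by (simp add: s ac_simps)
  also have "\<dots> \<le> log_length s + walk_potential step_law n \<phi> s"
    using active_potential[OF act] by (simp add: s log_length_def add_left_mono)
  finally show "wp (\<lambda>s. log_length s + walk_potential step_law n \<phi> s) (walk_step E \<theta> q s) \<le> log_length s + walk_potential step_law n \<phi> s" .
  have "1 + wp (walk_potential step_law n \<phi>) (walk_step E \<theta> q s) \<le> 1 + ?R"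
    using walk_step_potential[OF act, of 0] by (simp add: s add_left_mono)
  also have "\<dots> \<le> walk_potential step_law n \<phi> s" using active_potential[OF act] by (simp add: s)
  finally show "1 + wp (walk_potential step_law n \<phi>) (walk_step E \<theta> q s) \<le> walk_potential step_law n \<phi> s" .
qed

lemma walk_while:
  assumes "walk_continues \<phi> s \<longrightarrow> active \<phi> n s"
  shows "wp (\<lambda>s. log_length s + walk_potential step_law n \<phi> s) (while_spmf (walk_continues \<phi>) (walk_step E \<theta> q) s)
      \<le> log_length s + walk_potential step_law n \<phi> s"
    and "wp (walk_potential step_law n \<phi>) (while_spmf (walk_continues \<phi>) (walk_step E \<theta> q) s) \<le> walk_potential step_law n \<phi> s"
proof -
  have inv: "walk_continues \<phi> s' \<longrightarrow> active \<phi> n s'"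
    if "walk_continues \<phi> s \<longrightarrow> active \<phi> n s" "walk_continues \<phi> s" "s' \<in> set_spmf (walk_step E \<theta> q s)" for s s'
  proof -
    from that have "active \<phi> n s" by simp
    moreover then obtain p v u l where "s = (p, Some v, u, l)" by (cases s) (auto simp: active_def)
    ultimately show ?thesis using walk_step_support that(3) by blast
  qed
  have fin: "walk_potential step_law n \<phi> s < \<infinity>" if "log_length s + walk_potential step_law n \<phi> s < \<infinity>"
    using that by (simp add: less_top[symmetric])
  have dec: "wp (walk_potential step_law n \<phi>) (walk_step E \<theta> q s) \<le> walk_potential step_law n \<phi> s" if "active \<phi> n s" for s
    using walk_step_potential'(2)[OF that] by (rule order_trans[rotated]) (simp add: add_increasing)
  show "wp (\<lambda>s. log_length s + walk_potential step_law n \<phi> s) (while_spmf (walk_continues \<phi>) (walk_step E \<theta> q) s)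
      \<le> log_length s + walk_potential step_law n \<phi> s"
    using assms inv by (rule wp_while_le[where \<Psi> = "walk_potential step_law n \<phi>"])
      (auto simp: walk_step_potential' intro: fin)
  show "wp (walk_potential step_law n \<phi>) (while_spmf (walk_continues \<phi>) (walk_step E \<theta> q) s) \<le> walk_potential step_law n \<phi> s"
    using assms inv by (rule wp_while_le[where \<Psi> = "walk_potential step_law n \<phi>"])
      (auto simp: walk_step_potential' dec)
qed

lemma not_walk_continues:
  assumes "walk_continues \<phi> s \<longrightarrow> active \<phi> n s"
    and "(p, u, u', l) \<in> set_spmf (while_spmf (walk_continues \<phi>) (walk_step E \<theta> q) s)"
  shows "walk_potential step_law n \<phi> (p, u, u', l) = remaining (cards_of (commit \<phi> p u u') [])"
  using while_spmf_invariant[where J = "\<lambda>_. True", OF _ _ assms(2)] by (simp add: walk_potential_def)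

definition mtsf_potential :: "element set \<times> call_log \<Rightarrow> ennreal" where
  "mtsf_potential = (\<lambda>(\<phi>, l). remaining (cards_of \<phi> []))"

definition total_log_length :: "element set \<times> call_log \<Rightarrow> ennreal" where
  "total_log_length = (\<lambda>(\<phi>, l). of_nat (length l))"

lemma first_unspanned:
  assumes "\<exists>v<n. \<not> spanned \<phi> v"
  defines "i \<equiv> hd (filter (\<lambda>v. \<not> spanned \<phi> v) queue)"
  shows "active \<phi> n ([], Some i, i, l)"
proof -
  have "filter (\<lambda>v. \<not> spanned \<phi> v) queue \<noteq> []"
    using assms inst_queue by (auto simp: filter_empty_conv)
  then have "i \<in> set (filter (\<lambda>v. \<not> spanned \<phi> v) queue)"
    unfolding i_def by (rule hd_in_set)
  then show ?thesis using inst_queue by (auto simp: active_def)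
qed

lemma grow_alt:
  "grow E \<theta> q queue (\<phi>, l) = bind_spmf
     (while_spmf (walk_continues \<phi>) (walk_step E \<theta> q)
       ([], Some (hd (filter (\<lambda>v. \<not> spanned \<phi> v) queue)), hd (filter (\<lambda>v. \<not> spanned \<phi> v) queue), l))
     (\<lambda>(p, u, u', l'). return_spmf (commit \<phi> p u u', l'))"
  by (simp add: grow_def commit_def Let_def)

text \<open>
  The strict decrease is due to the first call, which always takes place.
\<close>

lemma grow_potential:
  assumes un: "\<exists>v<n. \<not> spanned \<phi> v"
  shows "wp (\<lambda>s. total_log_length s + mtsf_potential s) (grow E \<theta> q queue (\<phi>, l)) \<le>
      total_log_length (\<phi>, l) + mtsf_potential (\<phi>, l)"
    and "1 + wp mtsf_potential (grow E \<theta> q queue (\<phi>, l)) \<le> mtsf_potential (\<phi>, l)"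
proof -
  let ?i = "hd (filter (\<lambda>v. \<not> spanned \<phi> v) queue)"
  let ?s = "([], Some ?i, ?i, l)"
  let ?w = "while_spmf (walk_continues \<phi>) (walk_step E \<theta> q)"
  have act: "active \<phi> n ?s" by (rule first_unspanned[OF un])
  have pot: "walk_potential step_law n \<phi> ?s = mtsf_potential (\<phi>, l)"
    using active_continues[OF act] by (simp add: walk_potential_def mtsf_potential_def)
  have "wp (\<lambda>s. total_log_length s + mtsf_potential s) (grow E \<theta> q queue (\<phi>, l)) \<le>
      wp (\<lambda>s. log_length s + walk_potential step_law n \<phi> s) (?w ?s)"
    unfolding grow_alt wp_bind
    using not_walk_continues[of \<phi> ?s] act
    by (intro wp_mono) (auto simp: log_length_def total_log_length_def mtsf_potential_def)
  also have "\<dots> \<le> total_log_length (\<phi>, l) + mtsf_potential (\<phi>, l)"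
    using walk_while(1)[of \<phi> ?s] act pot by (simp add: log_length_def total_log_length_def)
  finally show "wp (\<lambda>s. total_log_length s + mtsf_potential s) (grow E \<theta> q queue (\<phi>, l)) \<le>
      total_log_length (\<phi>, l) + mtsf_potential (\<phi>, l)" .
  have "wp mtsf_potential (grow E \<theta> q queue (\<phi>, l)) \<le> wp (walk_potential step_law n \<phi>) (?w ?s)"
    unfolding grow_alt wp_bind
    using not_walk_continues[of \<phi> ?s] act
    by (intro wp_mono) (auto simp: mtsf_potential_def)
  also have "?w ?s = bind_spmf (walk_step E \<theta> q ?s) ?w"
    using active_continues[OF act] by (subst while_spmf.simps) simp
  also have "wp (walk_potential step_law n \<phi>) \<dots> \<le> wp (walk_potential step_law n \<phi>) (walk_step E \<theta> q ?s)"
    unfolding wp_bind using walk_step_support[OF act] by (intro wp_mono walk_while(2))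
  finally have "1 + wp mtsf_potential (grow E \<theta> q queue (\<phi>, l)) \<le> 1 + wp (walk_potential step_law n \<phi>) (walk_step E \<theta> q ?s)"
    by (rule add_left_mono)
  also have "\<dots> \<le> mtsf_potential (\<phi>, l)" using walk_step_potential'(2)[OF act] pot by simp
  finally show "1 + wp mtsf_potential (grow E \<theta> q queue (\<phi>, l)) \<le> mtsf_potential (\<phi>, l)" .
qed

lemma expected_calls_le_remaining: "expected_calls n E \<theta> q queue \<le> remaining (\<lambda>_. None)"
proof -
  have "expected_calls n E \<theta> q queue = wp total_log_length (mtsf_sampling n E \<theta> q queue)"
    by (simp add: expected_calls_def expected_count_wp total_log_length_def case_prod_unfold)
  also have "\<dots> \<le> total_log_length ({}, []) + mtsf_potential ({}, [])"
    unfolding mtsf_sampling_def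
  proof (rule wp_while_le[where \<Phi> = "\<lambda>s. total_log_length s + mtsf_potential s" and \<Psi> = mtsf_potential and I = "\<lambda>_. True"])
    show "mtsf_potential ({}, []) < \<infinity>" if "total_log_length ({}, []) + mtsf_potential ({}, []) < \<infinity>"
      using that by (simp add: less_top[symmetric])
  qed (auto intro: grow_potential)
  also have "\<dots> = remaining (\<lambda>_. None)"
    by (simp add: total_log_length_def mtsf_potential_def cards_of_def spanned_def cong: if_cong)
  finally show ?thesis .
qed

end

section \<open>The Green function of the killed walk\<close>

lemma deg_eq_sum:
  assumes "simple_graph n E"
  shows "real (deg E u) = (\<Sum>k<n. adj E u k)"
proof -
  have "neighbours E u \<subseteq> {..<n}" using neighbours_lt[OF assms] by auto
  then have "(\<Sum>k<n. adj E u k) = (\<Sum>k\<in>neighbours E u. adj E u k)"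
    by (intro sum.mono_neutral_right) (auto simp: adj_def neighbours_def)
  also have "\<dots> = real (deg E u)" by (simp add: adj_def neighbours_def deg_def)
  finally show ?thesis ..
qed

text \<open>
  At a minimum \<open>z\<close> of \<open>v\<close> the neighbours contribute at least \<open>d\<^sub>z v(z)\<close>, which leaves \<open>0 \<le> q v(z)\<close>.
\<close>

lemma minimum_principle:
  assumes g: "simple_graph n E" and q: "0 < q"
    and v: "\<And>y. y < n \<Longrightarrow> 0 \<le> (real (deg E y) + q) * v y - (\<Sum>k<n. adj E y k * v k)"
    and y: "y < n"
  shows "0 \<le> (v y :: real)"
proof -
  obtain z where "is_arg_min v (\<lambda>x. x \<in> {..<n}) z"
    using ex_is_arg_min_if_finite[of "{..<n}" v] y by auto
  then have z: "z < n" and min: "\<And>k. k < n \<Longrightarrow> v z \<le> v k"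
    by (auto simp: is_arg_min_linorder)
  have "real (deg E z) * v z = (\<Sum>k<n. adj E z k * v z)" by (simp add: deg_eq_sum[OF g] sum_distrib_right)
  also have "\<dots> \<le> (\<Sum>k<n. adj E z k * v k)" using min by (intro sum_mono mult_left_mono) (auto simp: adj_def)
  finally have "0 \<le> q * v z" using v[OF z] by (simp add: algebra_simps)
  then show ?thesis using q min[OF y] by (simp add: zero_le_mult_iff)
qed

definition killed_laplacian :: "nat \<Rightarrow> nat set set \<Rightarrow> real \<Rightarrow> real mat" where
  "killed_laplacian n E q = laplacian n E + q \<cdot>\<^sub>m 1\<^sub>m n"

definition green_matrix :: "nat \<Rightarrow> nat set set \<Rightarrow> real \<Rightarrow> real mat" where
  "green_matrix n E q = the (mat_inverse (killed_laplacian n E q))"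

context
  fixes n :: nat and E :: "nat set set" and q :: real
  assumes g: "simple_graph n E" and q: "0 < q"
begin

abbreviation "L\<^sub>q \<equiv> killed_laplacian n E q"

lemma killed_laplacian_carrier: "L\<^sub>q \<in> carrier_mat n n"
  by (rule carrier_matI) (simp_all add: killed_laplacian_def)

lemma laplacian_index:
  "i < n \<Longrightarrow> j < n \<Longrightarrow> laplacian n E $$ (i, j) = (if i = j then real (deg E i) else 0) - adj E i j"
  by (simp add: laplacian_def degree_matrix_def adjacency_matrix_def)

lemma killed_laplacian_index:
  "i < n \<Longrightarrow> j < n \<Longrightarrow> L\<^sub>q $$ (i, j) = (if i = j then real (deg E i) + q else 0) - adj E i j"
  by (simp add: killed_laplacian_def laplacian_index)

lemma killed_laplacian_row_sum:
  assumes "y < n"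
  shows "(\<Sum>k<n. L\<^sub>q $$ (y, k) * v k) = (real (deg E y) + q) * v y - (\<Sum>k<n. adj E y k * v k)"
proof -
  have "(\<Sum>k<n. L\<^sub>q $$ (y, k) * v k) =
      (\<Sum>k<n. (if y = k then (real (deg E y) + q) * v k else 0) - adj E y k * v k)"
    using assms by (intro sum.cong) (simp_all add: killed_laplacian_index left_diff_distrib)
  also have "\<dots> = (real (deg E y) + q) * v y - (\<Sum>k<n. adj E y k * v k)"
    using assms by (simp add: sum_subtractf)
  finally show ?thesis .
qed

lemma killed_laplacian_nonneg:
  assumes "\<And>y. y < n \<Longrightarrow> 0 \<le> (\<Sum>k<n. L\<^sub>q $$ (y, k) * v k)" and "y < n"
  shows "0 \<le> v y"
  using assms minimum_principle[OF g q, of v y] by (simp add: killed_laplacian_row_sum)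

abbreviation "G\<^sub>q \<equiv> green_matrix n E q"

text \<open>
  If the matrix annihilates a vector, then the minimum principle applies to the vector and to its negative.
\<close>

lemma green_matrix_inverse: "L\<^sub>q * G\<^sub>q = 1\<^sub>m n" "G\<^sub>q \<in> carrier_mat n n"
proof -
  have "Determinant.det L\<^sub>q \<noteq> 0"
  proof
    assume "Determinant.det L\<^sub>q = 0"
    then obtain v where v: "v \<in> carrier_vec n" "v \<noteq> 0\<^sub>v n" "L\<^sub>q *\<^sub>v v = 0\<^sub>v n"
      using det_0_iff_vec_prod_zero_field[OF killed_laplacian_carrier] by blast
    have row: "(\<Sum>k<n. L\<^sub>q $$ (y, k) * (v $ k)) = 0" if "y < n" for y
    proof -
      have "(L\<^sub>q *\<^sub>v v) $ y = (\<Sum>k<n. L\<^sub>q $$ (y, k) * (v $ k))"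
        using that v(1) killed_laplacian_carrier by (simp add: scalar_prod_def atLeast0LessThan)
      then show ?thesis using v(3) that by simp
    qed
    have "v $ y = 0" if "y < n" for y
      using killed_laplacian_nonneg[of "\<lambda>k. v $ k" y] killed_laplacian_nonneg[of "\<lambda>k. - v $ k" y] that row
      by (simp add: sum_negf)
    then have "v = 0\<^sub>v n" using v(1) by (intro eq_vecI) simp_all
    then show False using v(2) by simp
  qed
  then have "L\<^sub>q \<in> Units (ring_mat TYPE(real) n ())" by (rule det_non_zero_imp_unit[OF killed_laplacian_carrier])
  then have "mat_inverse L\<^sub>q \<noteq> None" using mat_inverse(1)[OF killed_laplacian_carrier] by metis
  then obtain B where B: "mat_inverse L\<^sub>q = Some B" by blast
  show "L\<^sub>q * G\<^sub>q = 1\<^sub>m n" "G\<^sub>q \<in> carrier_mat n n" using mat_inverse(2)[OF killed_laplacian_carrier B] by (simp_all add: green_matrix_def B)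
qed

lemma killed_laplacian_green:
  assumes "y < n" "x < n"
  shows "(\<Sum>k<n. L\<^sub>q $$ (y, k) * G\<^sub>q $$ (k, x)) = of_bool (y = x)"
proof -
  have "(L\<^sub>q * G\<^sub>q) $$ (y, x) = (\<Sum>k<n. L\<^sub>q $$ (y, k) * G\<^sub>q $$ (k, x))"
    using assms killed_laplacian_carrier green_matrix_inverse(2) by (simp add: scalar_prod_def atLeast0LessThan)
  moreover have "(L\<^sub>q * G\<^sub>q) $$ (y, x) = of_bool (y = x)" using green_matrix_inverse(1) assms by simp
  ultimately show ?thesis by (rule trans[OF sym])
qed

lemma green_matrix_nonneg: "y < n \<Longrightarrow> x < n \<Longrightarrow> 0 \<le> G\<^sub>q $$ (y, x)"
  using killed_laplacian_nonneg[of "\<lambda>k. G\<^sub>q $$ (k, x)" y] killed_laplacian_green by simp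

text \<open>
  The rows of \<open>L + q\<close> sum up to \<open>q\<close>. Hence \<open>L + q\<close> maps the difference of the constant \<open>1 / q\<close> and a column of the
  inverse to a nonnegative vector.
\<close>

lemma green_matrix_le:
  assumes "y < n" "x < n"
  shows "G\<^sub>q $$ (y, x) \<le> 1 / q"
proof -
  have "0 \<le> (\<Sum>k<n. L\<^sub>q $$ (y, k) * (1 / q - G\<^sub>q $$ (k, x)))" if "y < n" for y
  proof -
    have "(\<Sum>k<n. L\<^sub>q $$ (y, k) * (1 / q)) = 1"
      using killed_laplacian_row_sum[OF that, of "\<lambda>_. 1 / q"] deg_eq_sum[OF g, of y] q
      by (simp add: sum_divide_distrib[symmetric] field_simps)
    then show ?thesis using killed_laplacian_green[OF that assms(2)] by (simp add: right_diff_distrib sum_subtractf)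
  qed
  from killed_laplacian_nonneg[OF this assms(1)] show ?thesis by simp
qed

lemma trace_green_eq:
  "mat_trace (G\<^sub>q * (degree_matrix n E + q \<cdot>\<^sub>m 1\<^sub>m n)) = (\<Sum>x<n. G\<^sub>q $$ (x, x) * (real (deg E x) + q))"
proof -
  let ?D = "degree_matrix n E + q \<cdot>\<^sub>m 1\<^sub>m n"
  have D: "?D \<in> carrier_mat n n" by (simp add: degree_matrix_def)
  have "(G\<^sub>q * ?D) $$ (x, x) = G\<^sub>q $$ (x, x) * (real (deg E x) + q)" if x: "x < n" for x
  proof -
    have "(G\<^sub>q * ?D) $$ (x, x) = (\<Sum>k<n. G\<^sub>q $$ (x, k) * ?D $$ (k, x))"
      using x D green_matrix_inverse(2) by (simp add: scalar_prod_def atLeast0LessThan)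
    also have "\<dots> = (\<Sum>k<n. if k = x then G\<^sub>q $$ (x, x) * (real (deg E x) + q) else 0)"
      using x by (intro sum.cong) (auto simp: degree_matrix_def)
    finally show ?thesis using x by simp
  qed
  then show ?thesis using green_matrix_inverse(2) by (simp add: mat_trace_def)
qed

text \<open>
  Expected visits to \<open>x\<close> of the walk started at \<open>y\<close> and killed at the boundary.
\<close>

definition green :: "nat \<Rightarrow> nat \<Rightarrow> ennreal" where
  "green y x = (if y < n then ennreal (G\<^sub>q $$ (y, x) * (real (deg E x) + q)) else 0)"

text \<open>
  Row \<open>y\<close> of \<open>(L + q) (L + q)\<^sup>-\<^sup>1 = 1\<close>, multiplied by \<open>(d\<^sub>x + q) / (d\<^sub>y + q)\<close>, is the equation for the Green function:
  the factors \<open>1 / (d\<^sub>y + q)\<close> become the transition probabilities.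
\<close>

lemma green_supersolution:
  assumes x: "x < n"
  shows "of_bool (y = x) + (\<integral>\<^sup>+c. (case c of None \<Rightarrow> 0 | Some w \<Rightarrow> green w x)
    \<partial>measure_pmf (random_successor E q y)) \<le> green y x"
proof -
  let ?N = "neighbours E y" and ?d = "\<lambda>x. real (deg E x) + q"
  have fin: "finite ?N" by (rule finite_neighbours[OF g])
  have set: "set_pmf (random_successor E q y) = insert None (Some ` ?N)" by (rule set_random_successor[OF g q])
  have dpos: "0 < ?d x" for x using q by (simp add: add_nonneg_pos)
  have "(\<integral>\<^sup>+c. (case c of None \<Rightarrow> 0 | Some w \<Rightarrow> green w x) \<partial>measure_pmf (random_successor E q y)) =
     (\<Sum>c\<in>insert None (Some ` ?N). (case c of None \<Rightarrow> 0 | Some w \<Rightarrow> green w x) * ennreal (pmf (random_successor E q y) c))"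
    using fin by (subst nn_integral_measure_pmf_finite) (simp_all add: set)
  also have "\<dots> = (\<Sum>w\<in>?N. green w x * ennreal (1 / ?d y))"
    using fin by (subst sum.insert) (auto simp: sum.reindex pmf_random_successor[OF g q] adj_def neighbours_def intro!: sum.cong)
  also have "\<dots> = (\<Sum>w\<in>?N. ennreal (G\<^sub>q $$ (w, x) * ?d x / ?d y))"
    using neighbours_lt[OF g] x dpos green_matrix_nonneg
    by (intro sum.cong) (auto simp: green_def ennreal_mult''[symmetric] less_imp_le)
  also have "\<dots> = ennreal (\<Sum>w\<in>?N. G\<^sub>q $$ (w, x) * ?d x / ?d y)"
    using neighbours_lt[OF g] x dpos green_matrix_nonneg by (intro sum_ennreal) (auto intro!: divide_nonneg_pos mult_nonneg_nonneg simp: less_imp_le)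
  finally have int: "(\<integral>\<^sup>+c. (case c of None \<Rightarrow> 0 | Some w \<Rightarrow> green w x) \<partial>measure_pmf (random_successor E q y)) =
    ennreal (\<Sum>w\<in>?N. G\<^sub>q $$ (w, x) * ?d x / ?d y)" .
  show ?thesis
  proof (cases "y < n")
    case False
    then have "?N = {}" using neighbours_lt[OF g] by blast
    then show ?thesis using int False x by (simp add: green_def)
  next
    case True
    have sub: "?N \<subseteq> {..<n}" using neighbours_lt[OF g] by auto
    have "(\<Sum>k<n. adj E y k * G\<^sub>q $$ (k, x)) = (\<Sum>w\<in>?N. adj E y w * G\<^sub>q $$ (w, x))"
      using sub by (intro sum.mono_neutral_right) (auto simp: adj_def neighbours_def)
    also have "\<dots> = (\<Sum>w\<in>?N. G\<^sub>q $$ (w, x))" by (intro sum.cong) (auto simp: adj_def neighbours_def)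
    finally have *: "?d y * G\<^sub>q $$ (y, x) = of_bool (y = x) + (\<Sum>w\<in>?N. G\<^sub>q $$ (w, x))"
      using killed_laplacian_green[OF True x] killed_laplacian_row_sum[OF True, of "\<lambda>k. G\<^sub>q $$ (k, x)"] by simp
    have "(\<Sum>w\<in>?N. G\<^sub>q $$ (w, x) * ?d x / ?d y) = (\<Sum>w\<in>?N. G\<^sub>q $$ (w, x)) * (?d x / ?d y)"
      unfolding sum_distrib_right by (simp add: mult.assoc)
    also have "of_bool (y = x) + \<dots> = G\<^sub>q $$ (y, x) * ?d x"
    proof (cases "y = x")
      case True
      then show ?thesis using * dpos[of x] by (simp add: mult.commute)
    next
      case False
      then show ?thesis using * dpos[of y] by (simp add: field_simps)
    qed
    finally have "of_bool (y = x) + (\<Sum>w\<in>?N. G\<^sub>q $$ (w, x) * ?d x / ?d y) = G\<^sub>q $$ (y, x) * ?d x" .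
    moreover have "0 \<le> (\<Sum>w\<in>?N. G\<^sub>q $$ (w, x) * ?d x / ?d y)"
      using neighbours_lt[OF g] x dpos green_matrix_nonneg by (intro sum_nonneg) (auto intro!: divide_nonneg_pos mult_nonneg_nonneg simp: less_imp_le)
    ultimately show ?thesis unfolding int using True
      by (auto simp: green_def simp flip: ennreal_plus ennreal_1)
  qed
qed

lemma remaining_le_trace:
  "remaining_reveals (random_successor E q) {..<n} (\<lambda>_. None) \<le>
     ennreal (mat_trace (G\<^sub>q * (degree_matrix n E + q \<cdot>\<^sub>m 1\<^sub>m n)))"
proof -
  have "remaining_reveals (random_successor E q) {..<n} (\<lambda>_. None) \<le> (\<Sum>x<n. green x x)"
    by (rule remaining_reveals_empty) (simp add: green_supersolution)
  also have "\<dots> = (\<Sum>x<n. ennreal (G\<^sub>q $$ (x, x) * (real (deg E x) + q)))"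
    by (simp add: green_def)
  also have "\<dots> = ennreal (mat_trace (G\<^sub>q * (degree_matrix n E + q \<cdot>\<^sub>m 1\<^sub>m n)))"
    unfolding trace_green_eq using green_matrix_nonneg q by (intro sum_ennreal) auto
  finally show ?thesis .
qed

lemma sum_deg: "(\<Sum>u<n. deg E u) \<le> 2 * card E"
proof -
  have edge: "\<exists>a b. e = {a, b} \<and> a < n \<and> b < n" if "e \<in> E" for e
  proof -
    have "E \<subseteq> {{u, v} | u v. u < n \<and> v < n \<and> u \<noteq> v}" using g by (simp add: simple_graph_def)
    from subsetD[OF this that] show ?thesis by auto
  qed
  have E: "finite E"
  proof (rule finite_subset)
    show "E \<subseteq> Pow {..<n}"
    proof
      fix e assume "e \<in> E"
      from edge[OF this] obtain a b where "e = {a, b}" "a < n" "b < n" by metis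
      then show "e \<in> Pow {..<n}" by simp
    qed
  qed simp
  let ?S = "\<lambda>e. {x. {fst x, snd x} = e}"
  have fibre: "finite (?S e) \<and> card (?S e) \<le> 2" if e: "e \<in> E" for e
  proof -
    from edge[OF e] obtain a b where ab: "e = {a, b}" by metis
    have sub: "?S e \<subseteq> {(a, b), (b, a)}"
    proof
      fix x assume "x \<in> ?S e"
      then have "{fst x, snd x} = {a, b}" by (simp add: ab)
      then have "fst x = a \<and> snd x = b \<or> fst x = b \<and> snd x = a" by (simp only: doubleton_eq_iff)
      then show "x \<in> {(a, b), (b, a)}" by (cases x) simp
    qed
    have "card (?S e) \<le> card {(a, b), (b, a)}" using sub by (rule card_mono[rotated]) simp
    also have "\<dots> \<le> 2" by (intro card_insert_le_m1) simp_all
    finally show ?thesis using finite_subset[OF sub] by simp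
  qed
  have "(\<Sum>u<n. deg E u) = card (SIGMA u:{..<n}. neighbours E u)"
    using finite_neighbours[OF g] by (simp add: deg_def)
  also have "\<dots> \<le> card (\<Union>e\<in>E. ?S e)"
  proof (rule card_mono)
    show "finite (\<Union>e\<in>E. ?S e)" using E fibre by simp
    show "(SIGMA u:{..<n}. neighbours E u) \<subseteq> (\<Union>e\<in>E. ?S e)"
    proof
      fix x assume "x \<in> (SIGMA u:{..<n}. neighbours E u)"
      then have "{fst x, snd x} \<in> E" by (cases x) (simp add: neighbours_def)
      then show "x \<in> (\<Union>e\<in>E. ?S e)" by simp
    qed
  qed
  also have "\<dots> \<le> (\<Sum>e\<in>E. card (?S e))" by (rule card_UN_le[OF E])
  also have "\<dots> \<le> (\<Sum>e\<in>E. 2)" using fibre by (intro sum_mono) simp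
  finally show ?thesis by simp
qed

lemma trace_green_le:
  "mat_trace (G\<^sub>q * (degree_matrix n E + q \<cdot>\<^sub>m 1\<^sub>m n)) \<le> 2 * (real (card E) / q) + real n"
proof -
  have "(\<Sum>x<n. G\<^sub>q $$ (x, x) * (real (deg E x) + q)) \<le> (\<Sum>x<n. real (deg E x) / q + 1)"
  proof (rule sum_mono)
    fix x assume "x \<in> {..<n}"
    then have "G\<^sub>q $$ (x, x) * (real (deg E x) + q) \<le> 1 / q * (real (deg E x) + q)"
      using green_matrix_le q by (intro mult_right_mono) auto
    also have "1 / q * (real (deg E x) + q) = real (deg E x) / q + 1" using q by (simp add: field_simps)
    finally show "G\<^sub>q $$ (x, x) * (real (deg E x) + q) \<le> real (deg E x) / q + 1" .
  qed
  moreover have "(\<Sum>x<n. real (deg E x) / q + 1) = real (\<Sum>x<n. deg E x) / q + real n"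
    by (simp add: sum.distrib sum_divide_distrib)
  moreover have "real (\<Sum>x<n. deg E x) / q \<le> real (2 * card E) / q"
  proof (rule divide_right_mono)
    show "real (\<Sum>x<n. deg E x) \<le> real (2 * card E)"
      using of_nat_le_iff[where 'a = real, THEN iffD2, OF sum_deg] .
    show "0 \<le> q" using q by simp
  qed
  ultimately show ?thesis unfolding trace_green_eq by simp
qed

end

section \<open>A program with steps of bounded cost\<close>

abbreviation cell :: "nat \<Rightarrow> nexp" where "cell b \<equiv> NCell b (NConst 0)"

abbreviation Eq :: "nexp \<Rightarrow> nexp \<Rightarrow> bexp" where
  "Eq x y \<equiv> BAnd (BNot (Less x y)) (BNot (Less y x))"

text \<open>
  Banks 6 and 7 form the table of entries (node, successor), where the successor \<open>n\<close> marks a root. Bank 5 holds the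
  number of entries, bank 11 the number of those that belong to the output, and bank 12 the position of a node in the
  table. The current and the previous node of the walk are in banks 18 and 13, the position in the queue in
  bank 14, and the flag in bank 15 tells that the walk goes on. Banks 16 and 17 are for coins and drawn indices, banks 8
  to 10 for the log. Real bank 2 holds prefix sums of the angles along the table.

  A node is in the table iff the position stored for it is in use and the entry at this position belongs to it.
  Positions of entries that have been removed do not deceive this test, so nothing has to be cleaned up.
\<close>

definition visited :: "nexp \<Rightarrow> bexp" where
  "visited x = BAnd (Less (NCell 12 x) (cell 5)) (Eq (NCell 6 (NCell 12 x)) x)"

definition draw_prog :: com where
  "draw_prog =
     Seq (NAssign 13 (NConst 0) (cell 18))
    (Seq (Flip 16 (NConst 0) (RDivide (RCell 0 (NConst 0)) (RPlus (OfNat (NCell 2 (cell 13))) (RCell 0 (NConst 0)))))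
    (If (Less (NConst 0) (cell 16))
       (NAssign 18 (NConst 0) (cell 0))
       (Seq (Uniform 17 (NConst 0) (NMinus (NCell 2 (cell 13)) (NConst 1)))
       (Seq (NAssign 17 (NConst 0) (NPlus (NCell 3 (cell 13)) (cell 17)))
       (Seq (NAssign 18 (NConst 0) (NCell 4 (cell 17)))
            (RAssign 2 (NPlus (cell 5) (NConst 1)) (RPlus (RCell 2 (cell 5)) (RCell 1 (cell 17)))))))))"

definition record_prog :: com where
  "record_prog =
     Seq (NAssign 9 (cell 8) (cell 13))
    (Seq (NAssign 10 (cell 8) (cell 18))
    (Seq (NAssign 8 (NConst 0) (NPlus (cell 8) (NConst 1)))
    (Seq (NAssign 6 (cell 5) (cell 13))
    (Seq (NAssign 7 (cell 5) (cell 18))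
    (Seq (NAssign 12 (cell 13) (cell 5))
         (NAssign 5 (NConst 0) (NPlus (cell 5) (NConst 1))))))))"

text \<open>
  A cycle is removed by resetting the number of entries to the position of the node at which it was closed.
\<close>

definition control_prog :: com where
  "control_prog =
     If (Less (cell 18) (cell 0))
       (If (visited (cell 18))
          (If (Less (NCell 12 (cell 18)) (cell 11))
             (NAssign 15 (NConst 0) (NConst 0))
             (Seq (Flip 16 (NConst 0) (Cos (RMinus (RCell 2 (cell 5)) (RCell 2 (NCell 12 (cell 18))))))
                  (If (Less (NConst 0) (cell 16))
                     (NAssign 5 (NConst 0) (NCell 12 (cell 18)))
                     (NAssign 15 (NConst 0) (NConst 0)))))
          Skip)
       (NAssign 15 (NConst 0) (NConst 0))"

definition skip_prog :: com where
  "skip_prog = While (visited (NCell 1 (cell 14))) (NAssign 14 (NConst 0) (NPlus (cell 14) (NConst 1)))"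

definition walk_prog :: com where
  "walk_prog = While (Less (NConst 0) (cell 15)) (Seq draw_prog (Seq record_prog control_prog))"

definition mtsf_prog :: com where
  "mtsf_prog = While (Less (cell 11) (cell 0))
    (Seq skip_prog
    (Seq (NAssign 18 (NConst 0) (NCell 1 (cell 14)))
    (Seq (NAssign 13 (NConst 0) (cell 18))
    (Seq (NAssign 15 (NConst 0) (NConst 1))
    (Seq walk_prog
         (NAssign 11 (NConst 0) (cell 5)))))))"

lemma nats_write_nat [simp]:
  "nats (write_nat b i x m) c = (if c = b then (nats m c)(i := x) else nats m c)"
  by (simp add: write_nat_def)

lemma reals_write_nat [simp]: "reals (write_nat b i x m) = reals m"
  by (simp add: write_nat_def)

lemma nats_write_real [simp]: "nats (write_real b i x m) = nats m"
  by (simp add: write_real_def)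

lemma reals_write_real [simp]:
  "reals (write_real b i x m) c = (if c = b then (reals m c)(i := x) else reals m c)"
  by (simp add: write_real_def)

lemma exec_Flip:
  "exec (Flip b i x) (m, t) = bind_spmf (spmf_of_pmf (bernoulli_pmf (rval x m)))
     (\<lambda>c. return_spmf (write_nat b (nval i m) (of_bool c) m, Suc t))"
  by (simp only: exec.simps prod.case map_spmf_conv_bind_spmf o_def)

lemma exec_Uniform:
  "exec (Uniform b i x) (m, t) = bind_spmf (spmf_of_pmf (pmf_of_set {..nval x m}))
     (\<lambda>k. return_spmf (write_nat b (nval i m) k m, Suc t))"
  by (simp only: exec.simps prod.case map_spmf_conv_bind_spmf o_def)

declare exec.simps(4,5) [simp del] exec_Flip [simp] exec_Uniform [simp]
declare bind_spmf_of_pmf [simp del] spmf_of_pmf_pmf_of_set [simp del]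

text \<open>
  The machine decides about the boundary by a coin and then draws an index into the adjacency list. On an
  isolated node the coin shows the boundary almost surely.
\<close>

lemma random_successor_two_stage:
  assumes g: "simple_graph n E" and q: "0 < q" and bij: "bij_betw g {..<deg E v} (neighbours E v)"
  shows "random_successor E q v = bind_pmf (bernoulli_pmf (q / (real (deg E v) + q)))
    (\<lambda>b. if b then return_pmf None else map_pmf (\<lambda>j. Some (g j)) (pmf_of_set {..deg E v - 1}))"
proof (rule pmf_eqI)
  fix x
  let ?d = "deg E v" and ?p = "q / (real (deg E v) + q)"
  have p: "0 \<le> ?p" "?p \<le> 1" using q by (simp_all add: add_nonneg_pos)
  have "pmf (bind_pmf (bernoulli_pmf ?p)
      (\<lambda>b. if b then return_pmf None else map_pmf (\<lambda>j. Some (g j)) (pmf_of_set {..?d - 1}))) x =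
    ?p * pmf (return_pmf None) x + (1 - ?p) * pmf (map_pmf (\<lambda>j. Some (g j)) (pmf_of_set {..?d - 1})) x"
    using p by (simp add: pmf_bind)
  also have "\<dots> = pmf (random_successor E q v) x"
  proof (cases "?d = 0")
    case True
    then have "neighbours E v = {}" using finite_neighbours[OF g] by (simp add: deg_def)
    then show ?thesis using True q
      by (cases x) (auto simp: pmf_random_successor[OF g q] adj_def neighbours_def)
  next
    case False
    then have set: "{..?d - 1} = {..<?d}" by auto
    have "map_pmf (\<lambda>j. Some (g j)) (pmf_of_set {..<?d}) = pmf_of_set ((\<lambda>j. Some (g j)) ` {..<?d})"
      using bij False by (intro map_pmf_of_set_inj) (auto simp: bij_betw_def inj_on_def)
    also have "(\<lambda>j. Some (g j)) ` {..<?d} = Some ` neighbours E v"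
      using bij by (auto simp: bij_betw_def)
    finally have "map_pmf (\<lambda>j. Some (g j)) (pmf_of_set {..?d - 1}) = pmf_of_set (Some ` neighbours E v)"
      by (simp only: set)
    moreover have "finite (neighbours E v)" by (rule finite_neighbours[OF g])
    moreover have "neighbours E v \<noteq> {}" using False by (auto simp: deg_def)
    moreover have "card (Some ` neighbours E v) = ?d" by (simp add: card_image deg_def)
    moreover have "1 - ?p = real ?d / (real ?d + q)" using q by (simp add: field_simps add_nonneg_eq_0_iff)
    ultimately show ?thesis using False
      by (cases x) (simp_all add: pmf_random_successor[OF g q] adj_def neighbours_def indicator_def image_iff)
  qed
  finally show "pmf (random_successor E q v) x = pmf (bind_pmf (bernoulli_pmf ?p)
      (\<lambda>b. if b then return_pmf None else map_pmf (\<lambda>j. Some (g j)) (pmf_of_set {..?d - 1}))) x" ..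
qed

definition input_ok :: "nat \<Rightarrow> nat set set \<Rightarrow> (nat \<Rightarrow> nat \<Rightarrow> real) \<Rightarrow> real \<Rightarrow> nat list \<Rightarrow> memory \<Rightarrow> bool" where
  "input_ok n E \<theta> q queue m \<longleftrightarrow>
     nats m 0 0 = n \<and> reals m 0 0 = q \<and> (\<forall>k<n. nats m 1 k = queue ! k) \<and>
     (\<forall>u<n. nats m 2 u = deg E u \<and>
        bij_betw (\<lambda>j. nats m 4 (nats m 3 u + j)) {..<deg E u} (neighbours E u) \<and>
        (\<forall>j<deg E u. reals m 1 (nats m 3 u + j) = \<theta> u (nats m 4 (nats m 3 u + j))))"

abbreviation encode :: "nat \<Rightarrow> nat option \<Rightarrow> nat" where
  "encode n c \<equiv> (case c of None \<Rightarrow> n | Some w \<Rightarrow> w)"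

text \<open>
  The effect of a draw with result \<open>c\<close>. The angle of the new edge is added to the prefix sums one place beyond the
  current end of the table, where the next entry will end.
\<close>

definition drawn :: "nat \<Rightarrow> (nat \<Rightarrow> nat \<Rightarrow> real) \<Rightarrow> memory \<Rightarrow> nat option \<Rightarrow> memory \<Rightarrow> bool" where
  "drawn n \<theta> m c m' \<longleftrightarrow>
     nats m' 13 0 = nats m 18 0 \<and> nats m' 18 0 = encode n c \<and>
     (\<forall>b. b \<notin> {13, 16, 17, 18} \<longrightarrow> nats m' b = nats m b) \<and>
     reals m' 0 = reals m 0 \<and> reals m' 1 = reals m 1 \<and>
     (\<forall>k \<le> nats m 5 0. reals m' 2 k = reals m 2 k) \<and>
     (\<forall>w. c = Some w \<longrightarrow>
        reals m' 2 (Suc (nats m 5 0)) = reals m 2 (nats m 5 0) + \<theta> (nats m 18 0) w)"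

lemma exec_draw:
  assumes g: "simple_graph n E" and q: "0 < q" and inp: "input_ok n E \<theta> q queue m"
    and v: "nats m 18 0 = v" "v < n"
  shows "rel_spmf (\<lambda>(m', t') c. drawn n \<theta> m c m' \<and> t' \<le> t + 7 \<and> c \<in> insert None (Some ` neighbours E v))
    (exec draw_prog (m, t)) (spmf_of_pmf (random_successor E q v))"
proof -
  let ?g = "\<lambda>j. nats m 4 (nats m 3 v + j)" and ?d = "deg E v"
  have deg: "nats m 2 v = ?d" and bij: "bij_betw ?g {..<?d} (neighbours E v)"
    and ang: "\<And>j. j < ?d \<Longrightarrow> reals m 1 (nats m 3 v + j) = \<theta> v (?g j)"
    and nq: "nats m 0 0 = n" "reals m 0 0 = q"
    using inp v by (auto simp: input_ok_def)
  let ?B = "bernoulli_pmf (q / (real ?d + q))"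
  have rs: "spmf_of_pmf (random_successor E q v) = bind_spmf (spmf_of_pmf ?B) (\<lambda>b. spmf_of_pmf
     (if b then return_pmf None else map_pmf (\<lambda>j. Some (?g j)) (pmf_of_set {..?d - 1})))"
    by (simp only: random_successor_two_stage[OF g q bij] spmf_of_pmf_bind bind_spmf_of_pmf)
  let ?m = "\<lambda>k. write_nat 16 0 k (write_nat 13 0 v m)"
  have ex: "exec draw_prog (m, t) = bind_spmf (spmf_of_pmf ?B) (\<lambda>b.
      if b then return_spmf (write_nat 18 0 n (?m 1), Suc (Suc (Suc (Suc t))))
      else bind_spmf (spmf_of_pmf (pmf_of_set {..?d - 1})) (\<lambda>j.
        return_spmf (write_real 2 (Suc (nats m 5 0)) (reals m 2 (nats m 5 0) + reals m 1 (nats m 3 v + j))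
          (write_nat 18 0 (?g j) (write_nat 17 0 (nats m 3 v + j) (write_nat 17 0 j (?m 0)))), Suc (Suc (Suc (Suc (Suc (Suc (Suc t)))))))))"
    using v deg nq unfolding draw_prog_def
    by (simp cong: if_cong)
  show ?thesis unfolding ex rs
  proof (rule rel_spmf_bind_reflI)
    fix b assume b: "b \<in> set_spmf (spmf_of_pmf ?B)"
    show "rel_spmf (\<lambda>(m', t') c. drawn n \<theta> m c m' \<and> t' \<le> t + 7 \<and> c \<in> insert None (Some ` neighbours E v))
      (if b then return_spmf (write_nat 18 0 n (?m 1), Suc (Suc (Suc (Suc t))))
      else bind_spmf (spmf_of_pmf (pmf_of_set {..?d - 1})) (\<lambda>j.
        return_spmf (write_real 2 (Suc (nats m 5 0)) (reals m 2 (nats m 5 0) + reals m 1 (nats m 3 v + j))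
          (write_nat 18 0 (?g j) (write_nat 17 0 (nats m 3 v + j) (write_nat 17 0 j (?m 0)))), Suc (Suc (Suc (Suc (Suc (Suc (Suc t)))))))))
      (spmf_of_pmf (if b then return_pmf None else map_pmf (\<lambda>j. Some (?g j)) (pmf_of_set {..?d - 1})))"
    proof (cases b)
      case True
      then show ?thesis using v by (simp add: drawn_def)
    next
      case False
      have "?d \<noteq> 0"
      proof
        assume "?d = 0"
        then have "pmf ?B False = 0" using q by simp
        then show False using b False by (simp add: set_pmf_iff)
      qed
      then have j: "j < ?d" if "j \<in> set_pmf (pmf_of_set {..?d - 1})" for j using that by auto
      have map: "spmf_of_pmf (map_pmf (\<lambda>j. Some (?g j)) (pmf_of_set {..?d - 1})) =
          bind_spmf (spmf_of_pmf (pmf_of_set {..?d - 1})) (\<lambda>j. return_spmf (Some (?g j)))"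
        by (simp only: map_pmf_def spmf_of_pmf_bind bind_spmf_of_pmf spmf_of_pmf_return_pmf)
      have "rel_spmf (\<lambda>(m', t') c. drawn n \<theta> m c m' \<and> t' \<le> t + 7 \<and> c \<in> insert None (Some ` neighbours E v))
       (bind_spmf (spmf_of_pmf (pmf_of_set {..?d - 1})) (\<lambda>j.
        return_spmf (write_real 2 (Suc (nats m 5 0)) (reals m 2 (nats m 5 0) + reals m 1 (nats m 3 v + j))
          (write_nat 18 0 (?g j) (write_nat 17 0 (nats m 3 v + j) (write_nat 17 0 j (?m 0)))), Suc (Suc (Suc (Suc (Suc (Suc (Suc t)))))))))
       (bind_spmf (spmf_of_pmf (pmf_of_set {..?d - 1})) (\<lambda>j. return_spmf (Some (?g j))))"
      proof (rule rel_spmf_bind_reflI)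
        fix j assume "j \<in> set_spmf (spmf_of_pmf (pmf_of_set {..?d - 1}))"
        then have "j < ?d" using j by simp
        moreover then have "?g j \<in> neighbours E v" using bij by (auto simp: bij_betw_def)
        ultimately show "rel_spmf (\<lambda>(m', t') c. drawn n \<theta> m c m' \<and> t' \<le> t + 7 \<and> c \<in> insert None (Some ` neighbours E v))
          (return_spmf (write_real 2 (Suc (nats m 5 0)) (reals m 2 (nats m 5 0) + reals m 1 (nats m 3 v + j))
          (write_nat 18 0 (?g j) (write_nat 17 0 (nats m 3 v + j) (write_nat 17 0 j (?m 0)))), Suc (Suc (Suc (Suc (Suc (Suc (Suc t))))))))
          (return_spmf (Some (?g j)))"
          using v ang by (simp add: drawn_def)
      qed
      then show ?thesis using False by (simp only: map if_False)
    qed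
  qed
qed

section \<open>Simulation of one step\<close>

definition entries :: "memory \<Rightarrow> nat \<Rightarrow> nat \<Rightarrow> (nat \<times> nat) list" where
  "entries m i j = map (\<lambda>k. (nats m 6 k, nats m 7 k)) [i..<j]"

definition element_of :: "nat \<Rightarrow> nat \<times> nat \<Rightarrow> element" where
  "element_of n e = (if snd e = n then Node (fst e) else Edge {fst e, snd e})"

definition logged :: "nat \<Rightarrow> memory \<Rightarrow> call_log" where
  "logged n m = map (\<lambda>k. (nats m 9 k, if nats m 10 k = n then None else Some (nats m 10 k))) [0..<nats m 8 0]"

abbreviation "cnt m \<equiv> nats m 5 0"
abbreviation "base m \<equiv> nats m 11 0"

abbreviation "firsts m j \<equiv> nats m 6 ` {..<j}"

lemma decode_output_alt: "decode_output n m = (element_of n ` set (entries m 0 (cnt m)), logged n m)"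
  by (simp only: decode_output_def entries_def logged_def element_of_def image_image atLeast0LessThan
      set_map set_upt fst_conv snd_conv)

lemma entries_append: "i \<le> j \<Longrightarrow> j \<le> k \<Longrightarrow> entries m i k = entries m i j @ entries m j k"
  using upt_add_eq_append[of i j "k - j"] by (simp add: entries_def)

lemma fst_entries: "fst ` set (entries m i j) = nats m 6 ` {i..<j}"
  by (force simp: entries_def)

text \<open>
  Bank 12 inverts bank 6, so no node has two entries. The output can be read off the committed entries, and these are
  closed under successors; therefore the spanned nodes are exactly the sources of committed entries.
\<close>

definition table_ok where
  "table_ok n E \<theta> q queue \<phi> m \<longleftrightarrow> input_ok n E \<theta> q queue m \<and> base m \<le> cnt m \<and>
     (\<forall>k<cnt m. nats m 12 (nats m 6 k) = k \<and> nats m 6 k < n) \<and>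
     \<phi> = element_of n ` set (entries m 0 (base m)) \<and>
     (\<forall>k<base m. nats m 7 k = n \<or> nats m 7 k \<in> firsts m (base m)) \<and>
     nats m 14 0 \<le> n \<and> (\<forall>k<nats m 14 0. spanned \<phi> (queue ! k))"

lemma spanned_table:
  assumes "table_ok n E \<theta> q queue \<phi> m"
  shows "spanned \<phi> v \<longleftrightarrow> v \<in> firsts m (base m)"
proof
  assume "spanned \<phi> v"
  then obtain e where e: "e \<in> set (entries m 0 (base m))" and "element_of n e = Node v \<or> (\<exists>x. element_of n e = Edge x \<and> v \<in> x)"
    using assms by (fastforce simp: spanned_def table_ok_def)
  then have "v = fst e \<or> (snd e \<noteq> n \<and> v = snd e)" by (auto simp: element_of_def split: if_splits)
  then show "v \<in> firsts m (base m)" using e assms by (auto simp: entries_def table_ok_def)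
next
  assume "v \<in> firsts m (base m)"
  then obtain k where k: "k < base m" "v = nats m 6 k" by auto
  then have "element_of n (nats m 6 k, nats m 7 k) \<in> \<phi>" using assms by (auto simp: table_ok_def entries_def)
  then show "spanned \<phi> v" using k by (auto simp: spanned_def element_of_def split: if_splits)
qed

lemma bval_visited:
  assumes "\<forall>k<cnt m. nats m 12 (nats m 6 k) = k"
  shows "bval (visited x) m \<longleftrightarrow> nval x m \<in> firsts m (cnt m)"
proof
  assume "bval (visited x) m"
  then have "nats m 12 (nval x m) \<in> {..<cnt m}" "nval x m = nats m 6 (nats m 12 (nval x m))"
    by (auto simp: visited_def)
  then show "nval x m \<in> firsts m (cnt m)" by (rule rev_image_eqI)
next
  assume "nval x m \<in> firsts m (cnt m)"
  then show "bval (visited x) m" using assms by (auto simp: visited_def)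
qed

text \<open>
  Only differences are used, so the value at the beginning of the path is arbitrary.
\<close>

definition prefix_sums :: "(nat \<Rightarrow> nat \<Rightarrow> real) \<Rightarrow> memory \<Rightarrow> bool" where
  "prefix_sums \<theta> m \<longleftrightarrow> (\<forall>k. base m \<le> k \<longrightarrow> k < cnt m \<longrightarrow>
     reals m 2 (Suc k) = reals m 2 k + \<theta> (nats m 6 k) (nats m 7 k))"

lemma angle_sum_entries:
  assumes "prefix_sums \<theta> m" and "base m \<le> i" and "i \<le> j" and "j \<le> cnt m"
  shows "angle_sum \<theta> (entries m i j) = reals m 2 j - reals m 2 i"
  using assms(3,4)
proof (induction j rule: dec_induct)
  case base
  then show ?case by (simp add: angle_sum_def entries_def)
next
  case (step k)
  then show ?case using assms(1,2) by (simp add: angle_sum_def entries_def prefix_sums_def)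
qed

text \<open>
  What has to hold for the whole table when a walk ends with the output \<open>\<phi>'\<close>, in order that all of its entries can be
  declared committed.
\<close>

definition final_entries :: "nat \<Rightarrow> memory \<Rightarrow> element set \<Rightarrow> bool" where
  "final_entries n m \<phi>' \<longleftrightarrow> base m < cnt m \<and>
     (\<forall>k<cnt m. nats m 7 k = n \<or> nats m 7 k \<in> firsts m (cnt m)) \<and>
     \<phi>' = element_of n ` set (entries m 0 (cnt m))"

text \<open>
  If the walk has reached the boundary, then its last entry is the one of the root and not an edge of the path.
\<close>

definition walk_rel where
  "walk_rel n E \<theta> q queue \<phi> m = (\<lambda>(p, u, u', l).
     table_ok n E \<theta> q queue \<phi> m \<and> logged n m = l \<and> nats m 13 0 = u' \<and>
     u = (if nats m 18 0 = n then None else Some (nats m 18 0)) \<and>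
     p = entries m (base m) (if nats m 18 0 = n then cnt m - 1 else cnt m) \<and>
     (nats m 15 0 \<noteq> 0 \<longrightarrow> active \<phi> n (p, u, u', l) \<and> prefix_sums \<theta> m) \<and>
     (nats m 15 0 = 0 \<longrightarrow> \<not> walk_continues \<phi> (p, u, u', l) \<and> final_entries n m (commit \<phi> p u u')))"

text \<open>
  The state between the call with result \<open>c\<close> at \<open>v\<close> and the decision whether the walk goes on.
\<close>

definition recorded where
  "recorded n E \<theta> q queue \<phi> p v l c m \<longleftrightarrow>
     table_ok n E \<theta> q queue \<phi> m \<and> logged n m = l @ [(v, c)] \<and> base m < cnt m \<and>
     entries m (base m) (cnt m) = p @ [(v, encode n c)] \<and>
     nats m 13 0 = v \<and> nats m 18 0 = encode n c \<and> nats m 15 0 \<noteq> 0 \<and>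
     (c \<noteq> None \<longrightarrow> prefix_sums \<theta> m)"

lemma input_ok_cong:
  assumes "\<And>b. b \<le> 4 \<Longrightarrow> nats m' b = nats m b" and "reals m' 0 = reals m 0" "reals m' 1 = reals m 1"
  shows "input_ok n E \<theta> q queue m' \<longleftrightarrow> input_ok n E \<theta> q queue m"
  using assms by (simp add: input_ok_def)

lemma logged_cong:
  "nats m' 8 = nats m 8 \<Longrightarrow> nats m' 9 = nats m 9 \<Longrightarrow> nats m' 10 = nats m 10 \<Longrightarrow> logged n m' = logged n m"
  by (simp add: logged_def cong: if_cong)

lemma entries_cong: "nats m' 6 = nats m 6 \<Longrightarrow> nats m' 7 = nats m 7 \<Longrightarrow> entries m' i j = entries m i j"
  by (simp add: entries_def)

lemma table_ok_truncate:
  assumes "table_ok n E \<theta> q queue \<phi> m" and "base m \<le> cnt m'" and "cnt m' \<le> cnt m"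
    and same: "\<And>b. b \<le> 4 \<or> b \<in> {6, 7, 11, 12, 14} \<Longrightarrow> nats m' b = nats m b"
    and "reals m' 0 = reals m 0" "reals m' 1 = reals m 1"
  shows "table_ok n E \<theta> q queue \<phi> m'"
proof -
  have "input_ok n E \<theta> q queue m'"
    using assms(1,5,6) same input_ok_cong[of m' m] by (simp add: table_ok_def)
  moreover have bank: "nats m' 6 = nats m 6" "nats m' 7 = nats m 7" "nats m' 11 = nats m 11"
    "nats m' 12 = nats m 12" "nats m' 14 = nats m 14" using same by simp_all
  ultimately show ?thesis
    using assms(1-3) unfolding table_ok_def entries_def bank by (elim conjE) (intro conjI; (assumption | force))
qed

lemma exec_record:
  assumes rel: "walk_rel n E \<theta> q queue \<phi> m (p, Some v, u, l)" and flag: "nats m 15 0 \<noteq> 0"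
    and drawn: "drawn n \<theta> m c m'" and c: "\<And>w. c = Some w \<Longrightarrow> w < n"
  shows "\<exists>m''. exec record_prog (m', t) = return_spmf (m'', t + 7) \<and>
    recorded n E \<theta> q queue \<phi> p v l c m''"
proof -
  let ?k = "cnt m" and ?x = "encode n c"
  have v: "nats m 18 0 = v" "v < n" and tab: "table_ok n E \<theta> q queue \<phi> m" and lg: "logged n m = l"
    and p: "p = entries m (base m) ?k" and act: "active \<phi> n (p, Some v, u, l)" and pre: "prefix_sums \<theta> m"
    using rel flag by (auto simp: walk_rel_def active_def split: if_splits)
  have same: "nats m' b = nats m b" if "b \<notin> {13, 16, 17, 18}" for b using drawn that by (simp add: drawn_def)
  have new: "nats m' 13 0 = v" "nats m' 18 0 = ?x" using drawn v by (simp_all add: drawn_def)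
  define m'' where "m'' = write_nat 5 0 (Suc ?k) (write_nat 12 v ?k (write_nat 7 ?k ?x (write_nat 6 ?k v
    (write_nat 8 0 (Suc (nats m 8 0)) (write_nat 10 (nats m 8 0) ?x (write_nat 9 (nats m 8 0) v m'))))))"
  have ex: "exec record_prog (m', t) = return_spmf (m'', t + 7)"
    by (simp add: record_prog_def m''_def new same)
  have bank: "nats m'' 5 0 = Suc ?k" "nats m'' 6 = (nats m 6)(?k := v)" "nats m'' 7 = (nats m 7)(?k := ?x)"
    "nats m'' 12 = (nats m 12)(v := ?k)" "nats m'' 8 0 = Suc (nats m 8 0)"
    "nats m'' 9 = (nats m 9)(nats m 8 0 := v)" "nats m'' 10 = (nats m 10)(nats m 8 0 := ?x)"
    "nats m'' 11 = nats m 11" "nats m'' 13 0 = v" "nats m'' 14 = nats m 14" "nats m'' 15 = nats m 15" "nats m'' 18 0 = ?x"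
    by (simp_all add: m''_def same new)
  have low: "nats m'' b = nats m b" if "b \<le> 4" for b using that by (simp add: m''_def same)
  have rl: "reals m'' = reals m'" by (simp add: m''_def)
  have ent: "entries m'' i j = entries m i j" if "j \<le> ?k" for i j
    using that by (simp add: entries_def bank)
  have bk: "base m \<le> ?k" and pos: "\<And>k. k < ?k \<Longrightarrow> nats m 12 (nats m 6 k) = k \<and> nats m 6 k < n"
    using tab by (auto simp: table_ok_def)
  have firsts: "firsts m ?k = firsts m (base m) \<union> fst ` set p"
    using bk unfolding p fst_entries by (metis image_Un ivl_disj_un_one(2) lessThan_atLeast0 less_eq_nat.simps(1) ivl_disj_un_two(3))
  have vnew: "v \<notin> firsts m ?k"
    using act spanned_table[OF tab] by (auto simp: firsts active_def)
  have tab'': "table_ok n E \<theta> q queue \<phi> m''"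
    unfolding table_ok_def
  proof (intro conjI allI impI)
    show "input_ok n E \<theta> q queue m''"
      using tab input_ok_cong[of m'' m] low rl drawn by (simp add: table_ok_def drawn_def)
    show "base m'' \<le> cnt m''" using bk by (simp add: bank)
    fix k assume k: "k < cnt m''"
    show "nats m'' 12 (nats m'' 6 k) = k"
    proof (cases "k = ?k")
      case False
      then have "k < ?k" using k by (simp add: bank)
      then have "nats m 6 k \<noteq> v" using vnew by blast
      then show ?thesis using False pos \<open>k < ?k\<close> by (simp add: bank)
    qed (simp add: bank)
    show "nats m'' 6 k < n" using k pos v by (cases "k = ?k") (simp_all add: bank)
  next
    show "\<phi> = element_of n ` set (entries m'' 0 (base m''))"
      using tab bk by (simp add: table_ok_def bank ent)
    fix k assume k: "k < base m''"
    have "firsts m'' (base m'') = firsts m (base m)" using bk by (auto simp: bank)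
    then show "nats m'' 7 k = n \<or> nats m'' 7 k \<in> firsts m'' (base m'')"
      using k bk tab by (simp add: table_ok_def bank)
  next
    show "nats m'' 14 0 \<le> n" using tab by (simp add: table_ok_def bank)
    fix k assume "k < nats m'' 14 0"
    then show "spanned \<phi> (queue ! k)" using tab unfolding table_ok_def bank by blast
  qed
  have "logged n m'' = l @ [(v, c)]"
    using lg c by (auto simp: logged_def bank split: option.split)
  moreover have "entries m'' (base m'') (cnt m'') = p @ [(v, ?x)]"
    using bk ent[of ?k "base m"] by (simp add: bank p) (simp add: entries_def bank)
  moreover have "prefix_sums \<theta> m''" if cn: "c \<noteq> None"
  proof -
    from cn obtain w where w: "c = Some w" by auto
    show ?thesis unfolding prefix_sums_def
    proof (intro allI impI)
      fix k assume k: "base m'' \<le> k" "k < cnt m''"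
      show "reals m'' 2 (Suc k) = reals m'' 2 k + \<theta> (nats m'' 6 k) (nats m'' 7 k)"
      proof (cases "k = ?k")
        case True
        then show ?thesis using drawn w v by (simp add: drawn_def rl bank)
      next
        case False
        then have "k < ?k" using k by (simp add: bank)
        then show ?thesis using pre k drawn by (simp add: prefix_sums_def drawn_def rl bank)
      qed
    qed
  qed
  ultimately show ?thesis
    using ex tab'' bk flag by (auto simp: recorded_def bank)
qed

text \<open>
  The new node is either the boundary or already in the table, so the table is closed under successors.
\<close>

lemma recorded_final:
  assumes rec: "recorded n E \<theta> q queue \<phi> p v l c m" and act: "active \<phi> n (p, Some v, u, l)"
    and c: "\<And>w. c = Some w \<Longrightarrow> w < n \<and> w \<in> firsts m (cnt m)"
  shows "final_entries n m (commit \<phi> (case c of None \<Rightarrow> p | Some w \<Rightarrow> p @ [(v, w)]) c v)"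
proof -
  have tab: "table_ok n E \<theta> q queue \<phi> m" and bk: "base m < cnt m"
    and ent: "entries m (base m) (cnt m) = p @ [(v, encode n c)]"
    using rec by (simp_all add: recorded_def)
  obtain i where path: "is_path i p v" using act by (auto simp: active_def)
  have fst: "insert v (fst ` set p) \<subseteq> firsts m (cnt m)"
    using fst_entries[of m "base m" "cnt m"] unfolding ent by auto
  have less: "x < n" if "x \<in> firsts m (cnt m)" for x using tab that by (auto simp: table_ok_def)
  have tgt: "snd e \<in> firsts m (cnt m)" if "e \<in> set p" for e
    using is_path_targets[OF path] fst that by blast
  have tgt': "nats m 7 k = n \<or> nats m 7 k \<in> firsts m (cnt m)" if "k < cnt m" for k
  proof (cases "k < base m")
    case True
    then have "nats m 7 k = n \<or> nats m 7 k \<in> firsts m (base m)" using tab by (simp add: table_ok_def)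
    moreover have "firsts m (base m) \<subseteq> firsts m (cnt m)" using bk by auto
    ultimately show ?thesis by blast
  next
    case False
    then have "(nats m 6 k, nats m 7 k) \<in> set (entries m (base m) (cnt m))" using that by (simp add: entries_def)
    then have "(nats m 6 k, nats m 7 k) \<in> set p \<or> nats m 7 k = encode n c" by (auto simp: ent)
    then show ?thesis
    proof
      assume "(nats m 6 k, nats m 7 k) \<in> set p"
      from tgt[OF this] show ?thesis by simp
    next
      assume "nats m 7 k = encode n c"
      then show ?thesis using c by (cases c) auto
    qed
  qed
  have "element_of n ` set p = {Edge {a, b} |a b. (a, b) \<in> set p}"
  proof -
    have "element_of n e = Edge {fst e, snd e}" if "e \<in> set p" for e
      using less[OF tgt[OF that]] by (simp add: element_of_def)
    then have "element_of n ` set p = (\<lambda>e. Edge {fst e, snd e}) ` set p" by (intro image_cong) simp_all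
    also have "(\<lambda>e. f (fst e) (snd e)) ` set p = {f a b |a b. (a, b) \<in> set p}" for f :: "nat \<Rightarrow> nat \<Rightarrow> element"
      by force
    finally show ?thesis .
  qed
  moreover have "commit \<phi> (case c of None \<Rightarrow> p | Some w \<Rightarrow> p @ [(v, w)]) c v =
      insert (element_of n (v, encode n c)) (\<phi> \<union> {Edge {a, b} |a b. (a, b) \<in> set p})"
    using c by (cases c) (auto simp: commit_def element_of_def)
  moreover have "element_of n ` set (entries m 0 (cnt m)) = insert (element_of n (v, encode n c)) (\<phi> \<union> element_of n ` set p)"
    using tab bk entries_append[of 0 "base m" "cnt m" m] by (auto simp: table_ok_def ent)
  ultimately show ?thesis using bk tgt' by (simp add: final_entries_def)
qed

lemma exec_control_boundary:
  assumes "\<not> nats m 18 0 < nats m 0 0"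
  shows "exec control_prog (m, t) = return_spmf (write_nat 15 0 0 m, t + 2)"
  using assms by (simp add: control_prog_def)

lemma exec_control_new:
  assumes "nats m 18 0 < nats m 0 0" "\<not> bval (visited (cell 18)) m"
  shows "exec control_prog (m, t) = return_spmf (m, t + 3)"
  using assms by (simp add: control_prog_def)

lemma exec_control_spanned:
  assumes "nats m 18 0 = w" "w < nats m 0 0" "bval (visited (cell 18)) m" "nats m 12 w < base m"
  shows "exec control_prog (m, t) = return_spmf (write_nat 15 0 0 m, t + 4)"
  using assms by (simp add: control_prog_def)

lemma exec_control_cycle:
  assumes "nats m 18 0 = w" "w < nats m 0 0" "bval (visited (cell 18)) m" "nats m 12 w = k" "base m \<le> k"
  shows "exec control_prog (m, t) =
    bind_spmf (spmf_of_pmf (bernoulli_pmf (cos (reals m 2 (cnt m) - reals m 2 k)))) (\<lambda>b.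
      return_spmf (if b then write_nat 5 0 k (write_nat 16 0 1 m)
                   else write_nat 15 0 0 (write_nat 16 0 0 m), t + 6))"
  using assms by (simp add: control_prog_def) (rule arg_cong[where f = "bind_spmf _"], rule ext, simp)

lemma exec_control:
  assumes rec: "recorded n E \<theta> q queue \<phi> p v l c m" and act: "active \<phi> n (p, Some v, u, l)"
    and c: "\<And>w. c = Some w \<Longrightarrow> w < n"
  shows "rel_spmf (\<lambda>(m', t') s. walk_rel n E \<theta> q queue \<phi> m' s \<and> t' \<le> t + 6)
    (exec control_prog (m, t)) (after_call \<theta> p v l c)"
proof -
  have tab: "table_ok n E \<theta> q queue \<phi> m" and bk: "base m < cnt m" and lg: "logged n m = l @ [(v, c)]"
    and ent: "entries m (base m) (cnt m) = p @ [(v, encode n c)]"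
    and m: "nats m 13 0 = v" "nats m 18 0 = encode n c" "nats m 15 0 \<noteq> 0"
    using rec by (simp_all add: recorded_def)
  then have nq: "nats m 0 0 = n" by (simp add: table_ok_def input_ok_def)
  have pos: "\<forall>k<cnt m. nats m 12 (nats m 6 k) = k" using tab by (simp add: table_ok_def)
  let ?stop = "write_nat 15 0 0 m"
  have stop: "table_ok n E \<theta> q queue \<phi> (write_nat 15 0 0 m')" "logged n (write_nat 15 0 0 m') = l @ [(v, c)]"
    "final_entries n (write_nat 15 0 0 m') \<phi>' \<longleftrightarrow> final_entries n m \<phi>'"
    "entries (write_nat 15 0 0 m') (base m) k = entries m (base m) k"
    if "m' = m \<or> m' = write_nat 16 0 x m" for m' \<phi>' k x
  proof -
    show "table_ok n E \<theta> q queue \<phi> (write_nat 15 0 0 m')"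
      using that bk by (intro table_ok_truncate[OF tab]) auto
    show "logged n (write_nat 15 0 0 m') = l @ [(v, c)]"
      using that unfolding lg[symmetric] by (intro logged_cong) auto
    show "final_entries n (write_nat 15 0 0 m') \<phi>' \<longleftrightarrow> final_entries n m \<phi>'"
    proof -
      have "nats (write_nat 15 0 0 m') 5 = nats m 5" "nats (write_nat 15 0 0 m') 6 = nats m 6"
        "nats (write_nat 15 0 0 m') 7 = nats m 7" "nats (write_nat 15 0 0 m') 11 = nats m 11"
        using that by auto
      then show ?thesis unfolding final_entries_def entries_def by (simp only:)
    qed
    show "entries (write_nat 15 0 0 m') (base m) k = entries m (base m) k"
      using that by (intro entries_cong) auto
  qed
  show ?thesis
  proof (cases c)
    case None
    have "walk_rel n E \<theta> q queue \<phi> ?stop (p, None, v, l @ [(v, None)])"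
    proof -
      have "entries m (base m) (cnt m) = entries m (base m) (cnt m - 1) @ entries m (cnt m - 1) (cnt m)"
        using bk by (intro entries_append) auto
      moreover have "length (entries m (cnt m - 1) (cnt m)) = 1" using bk by (simp add: entries_def)
      ultimately have "p = entries m (base m) (cnt m - 1)" using ent by (simp add: length_Suc_conv) auto
      then show ?thesis
        using None m stop[of m] recorded_final[OF rec act] by (simp add: walk_rel_def walk_continues_def)
    qed
    moreover have "exec control_prog (m, t) = return_spmf (?stop, t + 2)"
      using None m(2) nq by (intro exec_control_boundary) simp
    ultimately show ?thesis using None by (simp add: after_call_def)
  next
    case (Some w)
    have w: "w < n" using c Some by simp
    let ?p = "p @ [(v, w)]"
    have ent': "entries m (base m) (cnt m) = ?p" using ent Some by simp
    have pre: "prefix_sums \<theta> m" using rec Some by (simp add: recorded_def)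
    obtain i where path: "is_path i p v" and d: "distinct (map fst p)" "v \<notin> fst ` set p"
      and un: "\<forall>x\<in>insert v (fst ` set p). \<not> spanned \<phi> x"
      using act by (auto simp: active_def)
    have path': "is_path i ?p w" and d': "distinct (map fst ?p)" and un': "\<forall>x\<in>fst ` set ?p. \<not> spanned \<phi> x"
      using path d un by (auto simp: is_path_append)
    have fstp: "fst ` set ?p = nats m 6 ` {base m..<cnt m}" using fst_entries[of m "base m" "cnt m"] by (simp add: ent')
    have cyc: "contains_cycle ?p \<longleftrightarrow> w \<in> fst ` set ?p" by (rule contains_cycle_iff[OF path' d'])
    have sp: "spanned \<phi> w \<longleftrightarrow> w \<in> firsts m (base m)" by (rule spanned_table[OF tab])
    have "{0..<cnt m} = {0..<base m} \<union> {base m..<cnt m}" using bk by auto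
    then have vis: "w \<in> firsts m (cnt m) \<longleftrightarrow> spanned \<phi> w \<or> w \<in> fst ` set ?p"
      unfolding sp fstp by (simp add: atLeast0LessThan image_Un)
    note out = walk_step_outcome[OF act, where c = c and l' = "l @ [(v, c)]"]
    have stop_rel: "walk_rel n E \<theta> q queue \<phi> (write_nat 15 0 0 m') (?p, Some w, v, l @ [(v, Some w)])"
      if "w \<in> firsts m (cnt m)" "m' = m \<or> m' = write_nat 16 0 x m" for m' x
    proof -
      have "\<not> walk_continues \<phi> (?p, Some w, v, l @ [(v, Some w)])"
        using that(1) cyc by (auto simp: vis walk_continues_def intersects_def)
      moreover have "nats m' 13 0 = v" "nats m' 18 0 = w" "base m' = base m" "cnt m' = cnt m"
        using that(2) m Some by auto
      ultimately show ?thesis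
        using stop[of m'] that recorded_final[OF rec act] w Some ent' by (auto simp: walk_rel_def)
    qed
    show ?thesis
    proof (cases "w \<in> firsts m (cnt m)")
      case False
      then have nc: "\<not> contains_cycle ?p" "\<not> spanned \<phi> w" "w \<notin> fst ` set ?p" using vis cyc by auto
      have "active \<phi> n (?p, Some w, v, l @ [(v, Some w)])"
        unfolding active_def using path' d' un' nc w by auto
      then have "walk_rel n E \<theta> q queue \<phi> m (?p, Some w, v, l @ [(v, Some w)])"
        using tab lg m w pre ent' Some by (simp add: walk_rel_def)
      moreover have "\<not> bval (visited (cell 18)) m"
        unfolding bval_visited[OF pos] using False m Some by (simp only: nval.simps option.case simp_thms)
      then have "exec control_prog (m, t) = return_spmf (m, t + 3)"
        using m(2) Some w nq by (intro exec_control_new) simp_all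
      ultimately show ?thesis using nc Some by (simp add: after_call_def)
    next
      case True
      have vb: "bval (visited (cell 18)) m"
        unfolding bval_visited[OF pos] using True m Some by (simp only: nval.simps option.case simp_thms)
      show ?thesis
      proof (cases "spanned \<phi> w")
        case sw: True
        then obtain k where k: "k < base m" "w = nats m 6 k" using sp by auto
        then have "nats m 12 w < base m" using pos bk by simp
        then have "exec control_prog (m, t) = return_spmf (?stop, t + 4)"
          using m(2) Some w nq by (intro exec_control_spanned[OF _ _ vb]) simp_all
        moreover have "\<not> contains_cycle ?p" using sw un' cyc by blast
        ultimately show ?thesis using stop_rel[OF True, of m] Some by (simp add: after_call_def)
      next
        case sw: False
        then have wp: "w \<in> fst ` set ?p" using True vis by simp
        then obtain k where k: "base m \<le> k" "k < cnt m" "w = nats m 6 k" unfolding fstp by auto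
        then have pw: "nats m 12 w = k" using pos by simp
        let ?a = "reals m 2 (cnt m) - reals m 2 k"
        let ?B = "bernoulli_pmf (cos ?a)"
        have split: "?p = entries m (base m) k @ entries m k (cnt m)"
          using entries_append[of "base m" k "cnt m" m] k by (simp add: ent')
        have notw: "\<forall>e\<in>set (entries m (base m) k). fst e \<noteq> w"
        proof
          fix e assume "e \<in> set (entries m (base m) k)"
          then obtain j where j: "j < k" "fst e = nats m 6 j" by (auto simp: entries_def)
          then have "nats m 12 (fst e) = j" using pos k by simp
          then show "fst e \<noteq> w" using pw j by auto
        qed
        have hd: "entries m k (cnt m) = (w, nats m 7 k) # entries m (Suc k) (cnt m)"
          using k by (simp add: entries_def upt_conv_Cons)
        have "takeWhile (\<lambda>e. fst e \<noteq> w) ?p = entries m (base m) k" "dropWhile (\<lambda>e. fst e \<noteq> w) ?p = entries m k (cnt m)"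
          unfolding split using notw by (simp_all add: hd)
        then have parts: "open_part ?p = entries m (base m) k" "closed_part ?p = entries m k (cnt m)"
          by (simp_all only: path_parts[OF path' wp])
        have ang: "angle_sum \<theta> (closed_part ?p) = ?a"
          unfolding parts using k by (intro angle_sum_entries[OF pre]) simp_all
        have cycle: "contains_cycle ?p" using cyc wp by simp
        let ?m = "\<lambda>b. if b then write_nat 5 0 k (write_nat 16 0 1 m) else write_nat 15 0 0 (write_nat 16 0 0 m)"
        have ex: "exec control_prog (m, t) = bind_spmf (spmf_of_pmf ?B) (\<lambda>b. return_spmf (?m b, t + 6))"
          using m(2) Some w nq exec_control_cycle[OF _ _ vb pw k(1)] by simp
        have af: "after_call \<theta> p v l c = bind_spmf (spmf_of_pmf ?B) (\<lambda>b. return_spmf (if b then open_part ?p else ?p, Some w, v, l @ [(v, Some w)]))"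
          using cycle Some ang by (simp add: after_call_def Let_def)
        have go: "walk_rel n E \<theta> q queue \<phi> (?m True) (open_part ?p, Some w, v, l @ [(v, Some w)])"
        proof -
          have "active \<phi> n (open_part ?p, Some w, v, l @ [(v, Some w)])"
            using out(3) Some cycle c by simp
          moreover have "table_ok n E \<theta> q queue \<phi> (?m True)"
            using k by (intro table_ok_truncate[OF tab]) auto
          moreover have "logged n (?m True) = l @ [(v, Some w)]"
            using lg Some by (subst logged_cong[of _ m]) auto
          moreover have "prefix_sums \<theta> (?m True)" using pre k by (auto simp: prefix_sums_def)
          moreover have "entries (?m True) (base m) k = open_part ?p" unfolding parts by (rule entries_cong) simp_all
          ultimately show ?thesis using m Some w by (simp add: walk_rel_def)
        qed
        show ?thesis unfolding ex af
        proof (rule rel_spmf_bind_reflI)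
          fix b
          show "rel_spmf (\<lambda>(m', t') s. walk_rel n E \<theta> q queue \<phi> m' s \<and> t' \<le> t + 6)
            (return_spmf (?m b, t + 6))
            (return_spmf (if b then open_part ?p else ?p, Some w, v, l @ [(v, Some w)]))"
            using go stop_rel[OF True, of "write_nat 16 0 0 m" 0] by (cases b) simp_all
        qed
      qed
    qed
  qed
qed

section \<open>The running time\<close>

text \<open>
  The banks of natural numbers that a program can change.
\<close>

primrec writes :: "com \<Rightarrow> nat set" where
  "writes Skip = {}"
| "writes (NAssign b i x) = {b}"
| "writes (RAssign b i x) = {}"
| "writes (Flip b i x) = {b}"
| "writes (Uniform b i x) = {b}"
| "writes (Seq c d) = writes c \<union> writes d"
| "writes (If b c d) = writes c \<union> writes d"
| "writes (While b c) = writes c"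

lemma exec_preserves:
  assumes "b \<notin> writes c" and "s' \<in> set_spmf (exec c s)"
  shows "nats (fst s') b = nats (fst s) b"
  using assms
proof (induction c arbitrary: s s')
  case (Seq c d)
  from Seq.prems(2) obtain s1 where "s1 \<in> set_spmf (exec c s)" "s' \<in> set_spmf (exec d s1)"
    by (auto simp: set_bind_spmf)
  then show ?case using Seq.IH(1)[of s1 s] Seq.IH(2)[of s' s1] Seq.prems(1) by simp
next
  case (If g c d)
  obtain m t where s: "s = (m, t)" by (cases s)
  show ?case
    using If.IH(1)[of s' "(m, Suc t)"] If.IH(2)[of s' "(m, Suc t)"] If.prems
    by (cases "bval g m") (simp_all add: s)
next
  case (While g c)
  obtain m t where s: "s = (m, t)" by (cases s)
  let ?J = "\<lambda>s'. nats (fst s') b = nats (fst s) b"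
  from While.prems(2) have "s' \<in> set_spmf (while_spmf (\<lambda>(m, _). bval g m)
      (\<lambda>(m, t). bind_spmf (exec c (m, t)) (\<lambda>(m, t). return_spmf (m, Suc t))) (m, Suc t))"
    by (simp add: s)
  then have "?J s' \<and> \<not> (case s' of (m, _) \<Rightarrow> bval g m)"
  proof (rule while_spmf_invariant[rotated 2])
    show "?J (m, Suc t)" by (simp add: s)
    fix s1 s2
    assume "?J s1" and "s2 \<in> set_spmf ((\<lambda>(m, t). bind_spmf (exec c (m, t)) (\<lambda>(m, t). return_spmf (m, Suc t))) s1)"
    then obtain s3 where "s3 \<in> set_spmf (exec c s1)" "fst s2 = fst s3"
      by (auto simp: set_bind_spmf)
    then show "?J s2" using While.IH[of s3 s1] While.prems(1) \<open>?J s1\<close> by simp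
  qed
  then show ?case by simp
next
  case (Flip x i r)
  then show ?case by (cases s) (auto simp: set_bind_spmf)
next
  case (Uniform x i r)
  then show ?case by (cases s) (auto simp: set_bind_spmf)
qed (auto simp: split_beta)

lemma after_call_log: "s \<in> set_spmf (after_call \<theta> p v l c) \<Longrightarrow> snd (snd (snd s)) = l @ [(v, c)]"
  by (auto simp: after_call_def Let_def set_bind_spmf split: option.splits if_splits)

lemma exec_walk_step:
  assumes inst: "mtsf_instance n E \<theta> q queue"
    and rel: "walk_rel n E \<theta> q queue \<phi> m (p, u, u', l)" and flag: "nats m 15 0 \<noteq> 0"
  shows "rel_spmf (\<lambda>(m', t') s. walk_rel n E \<theta> q queue \<phi> m' s \<and> t' \<le> t + 20 \<and>
      length (snd (snd (snd s))) = Suc (length l) \<and> nats m' 11 = nats m 11 \<and> nats m' 14 = nats m 14)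
    (exec (Seq draw_prog (Seq record_prog control_prog)) (m, t)) (walk_step E \<theta> q (p, u, u', l))"
proof -
  obtain v where u: "u = Some v" and act: "active \<phi> n (p, Some v, u', l)"
    using rel flag by (auto simp: walk_rel_def active_def)
  have v: "nats m 18 0 = v" "v < n" and inp: "input_ok n E \<theta> q queue m"
    using rel flag u act by (auto simp: walk_rel_def active_def table_ok_def split: if_splits)
  have g: "simple_graph n E" and q: "0 < q" using inst by (auto simp: mtsf_instance_def)
  let ?prog = "Seq draw_prog (Seq record_prog control_prog)"
  have "rel_spmf (\<lambda>(m', t') s. (walk_rel n E \<theta> q queue \<phi> m' s \<and> t' \<le> t + 20) \<and>
      length (snd (snd (snd s))) = Suc (length l))
    (bind_spmf (exec draw_prog (m, t)) (exec (Seq record_prog control_prog)))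
    (bind_spmf (spmf_of_pmf (random_successor E q v)) (after_call \<theta> p v l))"
  proof (rule rel_spmf_bindI[OF exec_draw[OF g q inp v]])
    fix s c assume "(\<lambda>(m', t') c. drawn n \<theta> m c m' \<and> t' \<le> t + 7 \<and> c \<in> insert None (Some ` neighbours E v)) s c"
    then obtain m' t' where s: "s = (m', t')" and d: "drawn n \<theta> m c m'" "t' \<le> t + 7"
      and c: "c \<in> insert None (Some ` neighbours E v)" by (cases s) auto
    have cn: "w < n" if "c = Some w" for w using c that neighbours_lt[OF g] by auto
    obtain m'' where r: "exec record_prog (m', t') = return_spmf (m'', t' + 7)"
      "recorded n E \<theta> q queue \<phi> p v l c m''"
      using exec_record[OF rel[unfolded u] flag d(1) cn] by blast
    have "rel_spmf (\<lambda>(m', t') s. (walk_rel n E \<theta> q queue \<phi> m' s \<and> t' \<le> t + 20) \<and>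
        length (snd (snd (snd s))) = Suc (length l)) (exec control_prog (m'', t' + 7)) (after_call \<theta> p v l c)"
      using exec_control[OF r(2) act cn, where t = "t' + 7"]
    proof (rule rel_spmf_mono_strong)
      fix x y assume y: "y \<in> set_spmf (after_call \<theta> p v l c)"
        and "(\<lambda>(m', t'') s. walk_rel n E \<theta> q queue \<phi> m' s \<and> t'' \<le> t' + 7 + 6) x y"
      then show "(\<lambda>(m', t') s. (walk_rel n E \<theta> q queue \<phi> m' s \<and> t' \<le> t + 20) \<and>
          length (snd (snd (snd s))) = Suc (length l)) x y"
        using after_call_log[OF y] d(2) by (cases x) simp
    qed
    then show "rel_spmf (\<lambda>(m', t') s. (walk_rel n E \<theta> q queue \<phi> m' s \<and> t' \<le> t + 20) \<and>
        length (snd (snd (snd s))) = Suc (length l)) (exec (Seq record_prog control_prog) s) (after_call \<theta> p v l c)"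
      by (simp add: s r(1))
  qed
  then have "rel_spmf (\<lambda>(m', t') s. (walk_rel n E \<theta> q queue \<phi> m' s \<and> t' \<le> t + 20) \<and>
      length (snd (snd (snd s))) = Suc (length l)) (exec ?prog (m, t)) (walk_step E \<theta> q (p, u, u', l))"
    by (simp add: walk_step_alt u)
  then show ?thesis
  proof (rule rel_spmf_mono_strong)
    fix x y assume x: "x \<in> set_spmf (exec ?prog (m, t))"
      and R: "(\<lambda>(m', t') s. (walk_rel n E \<theta> q queue \<phi> m' s \<and> t' \<le> t + 20) \<and>
        length (snd (snd (snd s))) = Suc (length l)) x y"
    have "nats (fst x) b = nats m b" if "b = 11 \<or> b = 14" for b
      using exec_preserves[OF _ x, of b] that by (auto simp: draw_prog_def record_prog_def control_prog_def)
    then show "(\<lambda>(m', t') s. walk_rel n E \<theta> q queue \<phi> m' s \<and> t' \<le> t + 20 \<and>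
      length (snd (snd (snd s))) = Suc (length l) \<and> nats m' 11 = nats m 11 \<and> nats m' 14 = nats m 14) x y"
      using R by (cases x) simp
  qed
qed

lemma exec_walk:
  assumes inst: "mtsf_instance n E \<theta> q queue"
    and rel: "walk_rel n E \<theta> q queue \<phi> m (p, u, u', l)"
  shows "rel_spmf (\<lambda>(m', t') s. (walk_rel n E \<theta> q queue \<phi> m' s \<and>
      t' + 21 * length l \<le> Suc t + 21 * length (snd (snd (snd s))) \<and> nats m' 11 = nats m 11 \<and> nats m' 14 = nats m 14) \<and>
      nats m' 15 0 = 0)
    (exec walk_prog (m, t)) (while_spmf (walk_continues \<phi>) (walk_step E \<theta> q) (p, u, u', l))"
proof -
  let ?R = "\<lambda>(m', t') s. walk_rel n E \<theta> q queue \<phi> m' s \<and>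
      t' + 21 * length l \<le> Suc t + 21 * length (snd (snd (snd s))) \<and> nats m' 11 = nats m 11 \<and> nats m' 14 = nats m 14"
  let ?g = "\<lambda>(m, _). bval (Less (NConst 0) (cell 15)) m"
  let ?f = "\<lambda>(m, t). bind_spmf (exec (Seq draw_prog (Seq record_prog control_prog)) (m, t))
       (\<lambda>(m, t). return_spmf (m, Suc t))"
  let ?h = "\<lambda>(m', t' :: nat). (entries m' (base m') (if nats m' 18 0 = n then cnt m' - 1 else cnt m'),
      if nats m' 18 0 = n then None else Some (nats m' 18 0), nats m' 13 0, logged n m')"
  have "rel_spmf (\<lambda>s a. ?R s a \<and> \<not> ?g s) (while_spmf ?g ?f (m, Suc t))
      (while_spmf (walk_continues \<phi>) (walk_step E \<theta> q) (p, u, u', l))"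
  proof (rule rel_spmf_while[where h = ?h])
    fix s a assume R: "?R s a"
    obtain m' t' where s: "s = (m', t')" by (cases s)
    obtain p' v v' l' where a: "a = (p', v, v', l')" by (cases a)
    from R show "a = ?h s" by (simp add: s a walk_rel_def)
    show "?g s \<longleftrightarrow> walk_continues \<phi> a"
      using R active_continues[of \<phi> n a] by (auto simp: s a walk_rel_def)
    assume "?g s"
    then have flag: "nats m' 15 0 \<noteq> 0" by (simp add: s)
    have "rel_spmf ?R (bind_spmf (exec (Seq draw_prog (Seq record_prog control_prog)) (m', t'))
       (\<lambda>(m, t). return_spmf (m, Suc t))) (bind_spmf (walk_step E \<theta> q a) return_spmf)"
    proof (rule rel_spmf_bindI)
      show "rel_spmf (\<lambda>(m'', t'') s. walk_rel n E \<theta> q queue \<phi> m'' s \<and> t'' \<le> t' + 20 \<and>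
          length (snd (snd (snd s))) = Suc (length l') \<and> nats m'' 11 = nats m' 11 \<and> nats m'' 14 = nats m' 14)
        (exec (Seq draw_prog (Seq record_prog control_prog)) (m', t')) (walk_step E \<theta> q a)"
        using exec_walk_step[OF inst _ flag] R unfolding s a by simp
    next
      fix x y assume "(\<lambda>(m'', t'') s. walk_rel n E \<theta> q queue \<phi> m'' s \<and> t'' \<le> t' + 20 \<and>
          length (snd (snd (snd s))) = Suc (length l') \<and> nats m'' 11 = nats m' 11 \<and> nats m'' 14 = nats m' 14) x y"
      then show "rel_spmf ?R ((\<lambda>(m, t). return_spmf (m, Suc t)) x) (return_spmf y)"
        using R by (cases x) (simp add: s a)
    qed
    then show "rel_spmf ?R (?f s) (walk_step E \<theta> q a)" by (simp add: s)
  next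
    show "?R (m, Suc t) (p, u, u', l)" using rel by simp
  qed
  then show ?thesis unfolding walk_prog_def exec.simps prod.case
    by (rule rel_spmf_mono) auto
qed

text \<open>
  A call is charged 20 commands and one unit for the loop. Each step of the queue position costs 2. The remaining cost of
  an iteration of the outer loop is below 10 and is charged to the entries committed by it, of which there is at
  least one.
\<close>

definition loop_rel where
  "loop_rel n E \<theta> q queue = (\<lambda>(m, t) (\<phi>, l). table_ok n E \<theta> q queue \<phi> m \<and> cnt m = base m \<and>
     logged n m = l \<and> t \<le> 21 * length l + 2 * nats m 14 0 + 10 * base m + 1)"

text \<open>
  The committed entries have distinct sources, so the machine can count them in order to see whether all nodes
  are spanned.
\<close>

lemma table_base_le:
  assumes tab: "table_ok n E \<theta> q queue \<phi> m"
  shows "card (firsts m (base m)) = base m" and "firsts m (base m) \<subseteq> {..<n}"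
    and "base m \<le> n" and "base m < n \<longleftrightarrow> (\<exists>v<n. \<not> spanned \<phi> v)"
proof -
  have "inj_on (nats m 6) {..<base m}"
    using tab by (intro inj_on_inverseI[where g = "nats m 12"]) (simp add: table_ok_def)
  then show card: "card (firsts m (base m)) = base m" by (simp add: card_image)
  show sub: "firsts m (base m) \<subseteq> {..<n}" using tab by (auto simp: table_ok_def)
  show "base m \<le> n" using card_mono[OF _ sub] card by simp
  have "base m = n \<longleftrightarrow> firsts m (base m) = {..<n}"
    using card card_subset_eq[OF _ sub] by auto
  then show "base m < n \<longleftrightarrow> (\<exists>v<n. \<not> spanned \<phi> v)"
    using \<open>base m \<le> n\<close> sub unfolding spanned_table[OF tab] by auto
qed

text \<open>
  While no walk is under way the test for visited nodes is the test for spanned nodes, so this loop finds the first node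
  in the queue that is not spanned.
\<close>

lemma exec_skip:
  assumes tab: "table_ok n E \<theta> q queue \<phi> m" and cb: "cnt m = base m"
    and k: "nats m 14 0 \<le> k" "k < n" "\<not> spanned \<phi> (queue ! k)"
    and before: "\<And>j. nats m 14 0 \<le> j \<Longrightarrow> j < k \<Longrightarrow> spanned \<phi> (queue ! j)"
  shows "exec skip_prog (m, t) = return_spmf (write_nat 14 0 k m, Suc t + 2 * (k - nats m 14 0))"
proof -
  let ?g = "\<lambda>(m, _). bval (visited (NCell 1 (cell 14))) m"
  let ?f = "\<lambda>(m, t). bind_spmf (exec (NAssign 14 (NConst 0) (NPlus (cell 14) (NConst 1))) (m, t))
      (\<lambda>(m, t). return_spmf (m, Suc t))"
  let ?m = "\<lambda>j. write_nat 14 0 j m"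
  have vis: "?g (?m j, s) \<longleftrightarrow> spanned \<phi> (queue ! j)" if "j \<le> k" for j s
  proof -
    have "\<forall>k<cnt (?m j). nats (?m j) 12 (nats (?m j) 6 k) = k" using tab by (simp add: table_ok_def)
    from bval_visited[OF this, of "NCell 1 (cell 14)"]
    have "?g (?m j, s) \<longleftrightarrow> nats m 1 j \<in> firsts m (base m)" using cb by simp
    moreover have "nats m 1 j = queue ! j"
      using that k(2) tab by (simp add: table_ok_def input_ok_def)
    ultimately show ?thesis by (simp only: spanned_table[OF tab])
  qed
  have "while_spmf ?g ?f (?m j, s) = return_spmf (?m k, s + 2 * (k - j))" if "nats m 14 0 \<le> j" "j \<le> k" for j s
    using that(2,1)
  proof (induction j arbitrary: s rule: inc_induct)
    case base
    then show ?case using vis[of k] k by (subst while_spmf.simps) simp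
  next
    case (step j)
    have "?g (?m j, s)" using vis[of j] before[of j] step by simp
    then have "while_spmf ?g ?f (?m j, s) = while_spmf ?g ?f (?m (Suc j), Suc (Suc s))"
      by (subst while_spmf.simps) (simp add: write_nat_def)
    also have "\<dots> = return_spmf (?m k, Suc (Suc s) + 2 * (k - Suc j))" using step by (intro step.IH) simp
    also have "Suc (Suc s) + 2 * (k - Suc j) = s + 2 * (k - j)" using step by simp
    finally show ?case .
  qed
  from this[of "nats m 14 0" "Suc t"] k(1) have
    "while_spmf ?g ?f (?m (nats m 14 0), Suc t) = return_spmf (?m k, Suc t + 2 * (k - nats m 14 0))" by simp
  moreover have "?m (nats m 14 0) = m" by (simp add: write_nat_def)
  ultimately show ?thesis by (simp only: skip_prog_def exec.simps prod.case)
qed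

lemma hd_filter_nth:
  assumes "k < length xs" and "Q (xs ! k)" and "\<And>j. j < k \<Longrightarrow> \<not> Q (xs ! j)"
  shows "hd (filter Q xs) = xs ! k"
proof -
  have "filter Q (take k xs) = []" using assms by (auto simp: filter_empty_conv in_set_conv_nth)
  then have "filter Q xs = xs ! k # filter Q (drop (Suc k) xs)"
    using assms by (subst id_take_nth_drop[OF assms(1)]) simp
  then show ?thesis by simp
qed

lemma exec_loop_body:
  assumes inst: "mtsf_instance n E \<theta> q queue"
    and rel: "loop_rel n E \<theta> q queue (m, t) (\<phi>, l)" and un: "\<exists>v<n. \<not> spanned \<phi> v"
  shows "rel_spmf (loop_rel n E \<theta> q queue)
   (bind_spmf (exec (Seq skip_prog
      (Seq (NAssign 18 (NConst 0) (NCell 1 (cell 14)))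
      (Seq (NAssign 13 (NConst 0) (cell 18))
      (Seq (NAssign 15 (NConst 0) (NConst 1))
      (Seq walk_prog
           (NAssign 11 (NConst 0) (cell 5))))))) (m, t)) (\<lambda>(m, t). return_spmf (m, Suc t)))
   (grow E \<theta> q queue (\<phi>, l))"
proof -
  have tab: "table_ok n E \<theta> q queue \<phi> m" and cb: "cnt m = base m" and lg: "logged n m = l"
    and time: "t \<le> 21 * length l + 2 * nats m 14 0 + 10 * base m + 1"
    using rel by (auto simp: loop_rel_def)
  have queue: "set queue = {..<n}" "distinct queue" using inst by (auto simp: mtsf_instance_def)
  have len: "length queue = n" using distinct_card[OF queue(2)] queue(1) by simp
  define k where "k = (LEAST k. k < n \<and> \<not> spanned \<phi> (queue ! k))"
  from un obtain v where "v < n" "\<not> spanned \<phi> v" by blast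
  then obtain j where "j < n" "\<not> spanned \<phi> (queue ! j)" using queue(1) len by (metis in_set_conv_nth lessThan_iff)
  then have k: "k < n" "\<not> spanned \<phi> (queue ! k)"
    using LeastI[of "\<lambda>k. k < n \<and> \<not> spanned \<phi> (queue ! k)" j] by (auto simp: k_def)
  have before: "spanned \<phi> (queue ! j)" if "j < k" for j
    using not_less_Least[of j "\<lambda>k. k < n \<and> \<not> spanned \<phi> (queue ! k)"] that k(1) by (auto simp: k_def)
  have qpk: "nats m 14 0 \<le> k" using k tab by (meson table_ok_def not_le)
  have hd: "hd (filter (\<lambda>v. \<not> spanned \<phi> v) queue) = queue ! k"
    using k before len by (intro hd_filter_nth) auto
  let ?i = "queue ! k"
  define m1 where "m1 = write_nat 15 0 1 (write_nat 13 0 ?i (write_nat 18 0 ?i (write_nat 14 0 k m)))"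
  define t1 where "t1 = Suc (Suc (Suc (Suc (t + 2 * (k - nats m 14 0)))))"
  have q1: "nats m 1 k = ?i" using tab k by (simp add: table_ok_def input_ok_def)
  have ex: "exec (Seq skip_prog
      (Seq (NAssign 18 (NConst 0) (NCell 1 (cell 14)))
      (Seq (NAssign 13 (NConst 0) (cell 18))
      (Seq (NAssign 15 (NConst 0) (NConst 1))
      (Seq walk_prog
           (NAssign 11 (NConst 0) (cell 5))))))) (m, t) =
    bind_spmf (exec walk_prog (m1, t1)) (\<lambda>(m, t). return_spmf (write_nat 11 0 (cnt m) m, Suc t))"
    using exec_skip[OF tab cb qpk k before] q1 by (simp add: m1_def t1_def case_prod_unfold)
  have bank: "nats m1 b = nats m b" if "b \<notin> {13, 14, 15, 18}" for b using that by (simp add: m1_def)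
  have bank14: "nats m1 14 0 = k" by (simp add: m1_def)
  have tab1: "table_ok n E \<theta> q queue \<phi> m1"
  proof -
    have "input_ok n E \<theta> q queue m1"
      using tab input_ok_cong[of m1 m] bank by (simp add: table_ok_def m1_def)
    moreover have "entries m1 = entries m" by (intro ext entries_cong) (simp_all add: bank)
    ultimately show ?thesis
      using tab k before unfolding table_ok_def bank14 by (simp add: bank)
  qed
  have i: "?i < n" using queue(1) len k(1) nth_mem by blast
  have act: "active \<phi> n ([], Some ?i, ?i, l)" using first_unspanned[OF inst un] hd by simp
  have start: "walk_rel n E \<theta> q queue \<phi> m1 ([], Some ?i, ?i, l)"
  proof -
    have "nats m1 13 0 = ?i" "nats m1 18 0 = ?i" "nats m1 15 0 = 1" by (simp_all add: m1_def)
    moreover have "base m1 = cnt m1" using cb by (simp add: bank)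
    moreover then have "entries m1 (base m1) (cnt m1) = []" "prefix_sums \<theta> m1"
      by (simp_all add: entries_def prefix_sums_def)
    moreover have "logged n m1 = l" using lg logged_cong[of m1 m n] bank by simp
    ultimately show ?thesis using tab1 i act by (simp add: walk_rel_def)
  qed
  have "rel_spmf (loop_rel n E \<theta> q queue)
    (bind_spmf (exec walk_prog (m1, t1)) (\<lambda>(m, t). return_spmf (write_nat 11 0 (cnt m) m, Suc (Suc t))))
    (bind_spmf (while_spmf (walk_continues \<phi>) (walk_step E \<theta> q) ([], Some ?i, ?i, l))
      (\<lambda>(p, u, u', l'). return_spmf (commit \<phi> p u u', l')))"
  proof (rule rel_spmf_bindI[OF exec_walk[OF inst start]])
    fix s a
    assume R: "(\<lambda>(m', t') s. (walk_rel n E \<theta> q queue \<phi> m' s \<and>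
      t' + 21 * length l \<le> Suc t1 + 21 * length (snd (snd (snd s))) \<and> nats m' 11 = nats m1 11 \<and> nats m' 14 = nats m1 14) \<and>
      nats m' 15 0 = 0) s a"
    obtain m2 t2 where s: "s = (m2, t2)" by (cases s)
    obtain p u u' l' where a: "a = (p, u, u', l')" by (cases a)
    have tab2: "table_ok n E \<theta> q queue \<phi> m2" and lg2: "logged n m2 = l'"
      and fin: "final_entries n m2 (commit \<phi> p u u')" and same: "base m2 = base m" "nats m2 14 0 = k"
      and time2: "t2 + 21 * length l \<le> Suc t1 + 21 * length l'"
      using R by (auto simp: s a walk_rel_def bank bank14)
    let ?m = "write_nat 11 0 (cnt m2) m2"
    have b2: "base m2 < cnt m2" using fin by (simp add: final_entries_def)
    have "table_ok n E \<theta> q queue (commit \<phi> p u u') ?m"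
      unfolding table_ok_def
    proof (intro conjI)
      show "input_ok n E \<theta> q queue ?m"
        using tab2 input_ok_cong[of ?m m2] by (simp add: table_ok_def)
      show "\<forall>k<nats ?m 14 0. spanned (commit \<phi> p u u') (queue ! k)"
      proof -
        have "\<forall>k<nats m2 14 0. spanned \<phi> (queue ! k)" using tab2 unfolding table_ok_def by blast
        then show ?thesis by (simp add: spanned_commit)
      qed
      show "commit \<phi> p u u' = element_of n ` set (entries ?m 0 (base ?m))"
        using fin entries_cong[of ?m m2 0 "cnt m2"] by (simp add: final_entries_def)
    qed (use tab2 fin in \<open>simp_all add: table_ok_def final_entries_def\<close>)
    moreover have "logged n ?m = l'" using lg2 logged_cong[of ?m m2 n] by simp
    moreover have "Suc (Suc t2) \<le> 21 * length l' + 2 * k + 10 * cnt m2 + 1"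
      using time time2 b2 same qpk by (simp add: t1_def)
    ultimately have "loop_rel n E \<theta> q queue (?m, Suc (Suc t2)) (commit \<phi> p u u', l')"
      using same by (simp add: loop_rel_def)
    then show "rel_spmf (loop_rel n E \<theta> q queue)
      ((\<lambda>(m, t). return_spmf (write_nat 11 0 (cnt m) m, Suc (Suc t))) s)
      ((\<lambda>(p, u, u', l'). return_spmf (commit \<phi> p u u', l')) a)"
      by (simp add: s a)
  qed
  then show ?thesis
    unfolding ex grow_alt[OF inst] hd by (simp add: case_prod_unfold)
qed

lemma exec_mtsf:
  assumes inst: "mtsf_instance n E \<theta> q queue" and inp: "input_memory n E \<theta> q queue m"
  shows "rel_spmf (loop_rel n E \<theta> q queue) (exec mtsf_prog (m, 0)) (mtsf_sampling n E \<theta> q queue)"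
proof -
  let ?g = "\<lambda>(m, _). bval (Less (cell 11) (cell 0)) m"
  let ?h = "\<lambda>(m, t :: nat). (element_of n ` set (entries m 0 (base m)), logged n m)"
  have guard: "?g s \<longleftrightarrow> (\<lambda>(\<phi>, _). \<exists>v<n. \<not> spanned \<phi> v) a" if "loop_rel n E \<theta> q queue s a" for s a
  proof -
    obtain m t \<phi> l where sa: "s = (m, t)" "a = (\<phi>, l)" by (cases s, cases a)
    then have tab: "table_ok n E \<theta> q queue \<phi> m" using that by (simp add: loop_rel_def)
    then have "nats m 0 0 = n" by (simp add: table_ok_def input_ok_def)
    then show ?thesis using table_base_le(4)[OF tab] by (simp add: sa)
  qed
  have "rel_spmf (\<lambda>s a. loop_rel n E \<theta> q queue s a \<and> \<not> ?g s) (exec mtsf_prog (m, 0)) (mtsf_sampling n E \<theta> q queue)"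
    unfolding mtsf_prog_def mtsf_sampling_def exec.simps(8) prod.case
  proof (rule rel_spmf_while[where h = ?h])
    show "loop_rel n E \<theta> q queue (m, Suc 0) ({}, [])"
      using inp by (simp add: loop_rel_def table_ok_def input_memory_def input_ok_def entries_def logged_def)
    fix s a assume R: "loop_rel n E \<theta> q queue s a"
    obtain m t \<phi> l where sa: "s = (m, t)" "a = (\<phi>, l)" by (cases s, cases a)
    show "a = ?h s" using R by (simp add: sa loop_rel_def table_ok_def)
    show "?g s \<longleftrightarrow> (\<lambda>(\<phi>, _). \<exists>v<n. \<not> spanned \<phi> v) a" by (rule guard[OF R])
    assume "?g s"
    then have "\<exists>v<n. \<not> spanned \<phi> v" using guard[OF R] by (simp add: sa)
    from exec_loop_body[OF inst R[unfolded sa] this]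
    show "rel_spmf (loop_rel n E \<theta> q queue)
      ((\<lambda>(m, t). bind_spmf (exec (Seq skip_prog
        (Seq (NAssign 18 (NConst 0) (NCell 1 (cell 14)))
        (Seq (NAssign 13 (NConst 0) (cell 18))
        (Seq (NAssign 15 (NConst 0) (NConst 1))
        (Seq walk_prog
           (NAssign 11 (NConst 0) (cell 5))))))) (m, t)) (\<lambda>(m, t). return_spmf (m, Suc t))) s)
      (grow E \<theta> q queue a)"
      unfolding sa prod.case .
  qed
  then show ?thesis by (rule rel_spmf_mono) simp
qed

lemma mtsf_prog_implements: "implements_mtsf_sampling mtsf_prog"
  unfolding implements_mtsf_sampling_def
proof (intro allI impI)
  fix n E \<theta> q queue m
  assume inst: "mtsf_instance n E \<theta> q queue" and inp: "input_memory n E \<theta> q queue m"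
  have "rel_spmf (loop_rel n E \<theta> q queue) (exec mtsf_prog (m, 0)) (mtsf_sampling n E \<theta> q queue)"
    by (rule exec_mtsf[OF inst inp])
  then show "map_spmf (\<lambda>(m', t). decode_output n m') (exec mtsf_prog (m, 0)) = mtsf_sampling n E \<theta> q queue"
    by (rule rel_spmf_functionalD) (auto simp: loop_rel_def table_ok_def decode_output_alt)
qed

text \<open>
  The factor must not be zero because of \<open>0 * \<infinity> = 0\<close>.
\<close>

lemma wp_cmult:
  assumes "0 < k"
  shows "wp (\<lambda>x. of_nat k * g x) p = of_nat k * wp g p"
proof -
  have "wp (\<lambda>x. of_nat k * g x) p = (\<integral>\<^sup>+x. of_nat k * (case x of None \<Rightarrow> \<infinity> | Some r \<Rightarrow> g r) \<partial>measure_pmf p)"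
    unfolding wp_def using assms by (intro nn_integral_cong) (auto simp: ennreal_mult_eq_top_iff split: option.split)
  then show ?thesis unfolding wp_def by (simp add: nn_integral_cmult del: infinity_ennreal_def)
qed

lemma expected_time_le:
  assumes inst: "mtsf_instance n E \<theta> q queue" and inp: "input_memory n E \<theta> q queue m"
  shows "expected_time mtsf_prog m \<le> of_nat (12 * n + 1) + 21 * expected_calls n E \<theta> q queue"
proof -
  let ?p = "exec mtsf_prog (m, 0)"
  have rel: "rel_spmf (loop_rel n E \<theta> q queue) ?p (mtsf_sampling n E \<theta> q queue)"
    by (rule exec_mtsf[OF inst inp])
  have time: "t \<le> 12 * n + 1 + 21 * length (snd (decode_output n m'))" if "(m', t) \<in> set_spmf ?p" for m' t
  proof -
    from rel_spmf_domainD[OF rel that] obtain \<phi> l where R: "loop_rel n E \<theta> q queue (m', t) (\<phi>, l)" by auto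
    then have tab: "table_ok n E \<theta> q queue \<phi> m'" by (simp add: loop_rel_def)
    have "nats m' 14 0 \<le> n" using tab by (simp add: table_ok_def)
    then show ?thesis using R table_base_le(3)[OF tab] by (simp add: loop_rel_def decode_output_alt)
  qed
  have "expected_time mtsf_prog m = wp (\<lambda>(m', t). of_nat t) ?p"
    by (simp add: expected_time_def expected_count_wp case_prod_unfold)
  also have "\<dots> \<le> wp (\<lambda>s. of_nat (12 * n + 1) + of_nat 21 * of_nat (length (snd ((\<lambda>(m', t). decode_output n m') s)))) ?p"
  proof (rule wp_mono)
    fix s assume "s \<in> set_spmf ?p"
    then obtain m' t where s: "s = (m', t)" "(m', t) \<in> set_spmf ?p" by (cases s) auto
    have "(of_nat t :: ennreal) \<le> of_nat (12 * n + 1 + 21 * length (snd (decode_output n m')))"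
      using time[OF s(2)] by (rule of_nat_mono)
    then show "(case s of (m', t) \<Rightarrow> of_nat t) \<le> (of_nat (12 * n + 1) + of_nat 21 * of_nat (length (snd ((\<lambda>(m', t). decode_output n m') s))) :: ennreal)"
      by (simp only: s(1) prod.case of_nat_add of_nat_mult)
  qed
  also have "\<dots> = of_nat (12 * n + 1) + of_nat 21 * wp (\<lambda>r. of_nat (length (snd r))) (map_spmf (\<lambda>(m', t). decode_output n m') ?p)"
    unfolding wp_map wp_add_const by (subst wp_cmult) simp_all
  also have "map_spmf (\<lambda>(m', t). decode_output n m') ?p = mtsf_sampling n E \<theta> q queue"
    using mtsf_prog_implements inst inp unfolding implements_mtsf_sampling_def by blast
  also have "wp (\<lambda>r. of_nat (length (snd r))) (mtsf_sampling n E \<theta> q queue) = expected_calls n E \<theta> q queue"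
    by (simp add: expected_calls_def expected_count_wp case_prod_unfold)
  finally show ?thesis by simp
qed

theorem proposition2p8:
  shows "(\<forall>n E \<theta> q queue. mtsf_instance n E \<theta> q queue \<longrightarrow>
            expected_calls n E \<theta> q queue \<le>
              ennreal (mat_trace (the (mat_inverse (laplacian n E + q \<cdot>\<^sub>m 1\<^sub>m n))
                                    * (degree_matrix n E + q \<cdot>\<^sub>m 1\<^sub>m n))))
       \<and> (\<exists>P. implements_mtsf_sampling P \<and>
            (\<forall>K. \<exists>C. \<forall>n E \<theta> q queue m.
               mtsf_instance n E \<theta> q queue \<and> input_memory n E \<theta> q queue m \<and>
               real n \<le> K * (real (card E) / q) \<longrightarrow>
               expected_time P m \<le> ennreal (C * (real (card E) / q))))"
proof -
  have graph: "simple_graph n E" "0 < q" if "mtsf_instance n E \<theta> q queue" for n E \<theta> q queue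
    using that by (auto simp: mtsf_instance_def)
  have calls: "expected_calls n E \<theta> q queue \<le> ennreal (mat_trace (green_matrix n E q * (degree_matrix n E + q \<cdot>\<^sub>m 1\<^sub>m n)))"
    if inst: "mtsf_instance n E \<theta> q queue" for n E \<theta> q queue
    using expected_calls_le_remaining[OF inst] remaining_le_trace[OF graph[OF inst]] by (rule order_trans)
  have time: "expected_time mtsf_prog m \<le> ennreal ((42 + 34 * K) * (real (card E) / q))"
    if inst: "mtsf_instance n E \<theta> q queue" and inp: "input_memory n E \<theta> q queue m"
      and K: "real n \<le> K * (real (card E) / q)" for n E \<theta> q queue m K
  proof -
    define x where "x = real (card E) / q"
    note g = graph[OF inst]
    have n: "1 \<le> n" using g(1) by (simp add: simple_graph_def)
    have x: "0 \<le> x" using g(2) by (simp add: x_def)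
    have "expected_calls n E \<theta> q queue \<le> ennreal (2 * x + real n)"
      using order_trans[OF calls[OF inst] ennreal_leI[OF trace_green_le[OF g]]] by (simp only: x_def)
    then have "of_nat (12 * n + 1) + 21 * expected_calls n E \<theta> q queue \<le>
        of_nat (12 * n + 1) + 21 * ennreal (2 * x + real n)"
      by (rule add_left_mono[OF mult_left_mono]) simp
    with expected_time_le[OF inst inp]
    have "expected_time mtsf_prog m \<le> of_nat (12 * n + 1) + 21 * ennreal (2 * x + real n)"
      by (rule order_trans)
    also have "\<dots> = ennreal (real (12 * n + 1) + 21 * (2 * x + real n))"
    proof -
      have "ennreal a + 21 * ennreal b = ennreal (a + 21 * b)" if "0 \<le> a" "0 \<le> b" for a b
        using that by (simp add: ennreal_mult)
      moreover have "0 \<le> 2 * x + real n" using x by simp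
      ultimately show ?thesis unfolding ennreal_of_nat_eq_real_of_nat using of_nat_0_le_iff by blast
    qed
    \<comment> \<open>Per node there are 21 units for the calls, 12 for the loops and 1 for the start, as \<open>1 \<le> n\<close>.\<close>
    also have "\<dots> \<le> ennreal ((42 + 34 * K) * x)"
      using n K[folded x_def] by (intro ennreal_leI) (simp add: algebra_simps)
    finally show ?thesis unfolding x_def .
  qed
  show ?thesis
  proof (intro conjI exI[of _ mtsf_prog] allI impI)
    fix n E \<theta> q queue assume "mtsf_instance n E \<theta> q queue"
    then show "expected_calls n E \<theta> q queue \<le>
        ennreal (mat_trace (the (mat_inverse (laplacian n E + q \<cdot>\<^sub>m 1\<^sub>m n)) * (degree_matrix n E + q \<cdot>\<^sub>m 1\<^sub>m n)))"
      by (rule calls[unfolded green_matrix_def killed_laplacian_def])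
  next
    show "implements_mtsf_sampling mtsf_prog" by (rule mtsf_prog_implements)
  next
    fix K :: real
    \<comment> \<open>With a name for the predicate, the introduction of the witness is a first-order unification problem.\<close>
    define fast where "fast = (\<lambda>C. \<forall>n E \<theta> q queue m.
        mtsf_instance n E \<theta> q queue \<and> input_memory n E \<theta> q queue m \<and> real n \<le> K * (real (card E) / q) \<longrightarrow>
        expected_time mtsf_prog m \<le> ennreal (C * (real (card E) / q)))"
    have "fast (42 + 34 * K)"
      unfolding fast_def by (intro allI impI, elim conjE) (rule time)
    then have "\<exists>C. fast C" ..
    then show "\<exists>C. \<forall>n E \<theta> q queue m. mtsf_instance n E \<theta> q queue \<and> input_memory n E \<theta> q queue m \<and>
        real n \<le> K * (real (card E) / q) \<longrightarrow> expected_time mtsf_prog m \<le> ennreal (C * (real (card E) / q))"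
      unfolding fast_def .
  qed
qed

end
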